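(* Let $b_1,b_2>0$, $0<x_2<1$ and $k\ge1$. The reflection coefficient $r_k(\lambda)$ of the operator $P_k$ continues (meromorphically) to $\mathbb{C}_-=\{\lambda\in\mathbb{C}:\operatorname{Im}\lambda<0\}$, and the poles of this continuation in $\mathbb{C}_-$ are exactly the points of the resonance spectrum $\mathrm{Res}(P_k)$.
   Context: Let $a:\mathbb{R}\to(0,\infty)$ be the $1$-periodic function with $a(x)=b_2^{-2}$ for $x\in[0,x_2)$ and $a(x)=b_1^{-2}$ for $x\in[x_2,1)$. Let $a_k(x)=a(x)$ for $x\in[0,k]$ and $a_k(x)=b_1^{-2}$ for $x\notin[0,k]$. The operator $P_k=-\partial_xa_k(x)\partial_x$, with domain $\{u\in H^1(\mathbb{R}): a_k\partial_xu\in H^1(\mathbb{R})\}\subset L^2(\mathbb{R})$, is self-adjoint. For $\operatorname{Im}\lambda>0$ put $R_k(\lambda)=(P_k-\lambda^2)^{-1}$. As an operator-valued function $L^2_{\rm comp}(\mathbb{R})\to L^2_{\rm loc}(\mathbb{R})$, $R_k(\lambda)$ continues meromorphically to $\mathbb{C}$. Its poles in $\mathbb{C}_-$ are called resonances, and $\mathrm{Res}(P_k)$ is the set of resonances. The reflection and transmission coefficients $r_k(\lambda),t_k(\lambda)$ are defined (first for $\operatorname{Im}\lambda\ge0$, $\lambda\ne0$) by the existence of a solution $\psi$ of $-\partial_xa_k(x)\partial_x\psi=\lambda^2\psi$, with $\psi$ and $a_k\partial_x\psi$ continuous, such that $\psi(x)=e^{i\lambda b_1x}+r_ke^{-i\lambda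 b_1x}$ for $x<0$ and $\psi(x)=t_ke^{i\lambda b_1x}$ for $x>k$. *)

theory Defs
  imports "HOL-Complex_Analysis.Complex_Analysis"
begin

section \<open>Square integrable functions and Sobolev regularity on the line\<close>

text \<open>Elements of $L^2$ are represented by Borel functions; identities between them are
  always understood almost everywhere.\<close>

definition L2 :: "(real \<Rightarrow> complex) set" where
  "L2 = {f \<in> borel_measurable lborel. integrable lborel (\<lambda>x. (cmod (f x))\<^sup>2)}"

definition L2_norm :: "(real \<Rightarrow> complex) \<Rightarrow> real" where
  "L2_norm f = sqrt (LINT x|lborel. (cmod (f x))\<^sup>2)"

definition L2_comp :: "(real \<Rightarrow> complex) set" where
  "L2_comp = {f \<in> L2. \<exists>N. AE x in lborel. \<bar>x\<bar> > N \<longrightarrow> f x = 0}"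

text \<open>Weak derivatives are tested against $C^1_c$ functions, as in Brezis' textbook.\<close>

definition test_function :: "(real \<Rightarrow> real) \<Rightarrow> bool" where
  "test_function \<phi> \<longleftrightarrow> \<phi> C1_differentiable_on UNIV \<and> (\<exists>K. compact K \<and> (\<forall>x. x \<notin> K \<longrightarrow> \<phi> x = 0))"

definition has_weak_deriv :: "(real \<Rightarrow> complex) \<Rightarrow> (real \<Rightarrow> complex) \<Rightarrow> bool" where
  "has_weak_deriv u v \<longleftrightarrow>
     (\<forall>\<phi>. test_function \<phi> \<longrightarrow>
        (LINT x|lborel. of_real (deriv \<phi> x) * u x) = - (LINT x|lborel. of_real (\<phi> x) * v x))"

definition H1 :: "(real \<Rightarrow> complex) set" where
  "H1 = {u \<in> L2. \<exists>v\<in>L2. has_weak_deriv u v}"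

text \<open>The choice below is irrelevant: weak derivatives are unique almost everywhere.\<close>

definition weak_deriv :: "(real \<Rightarrow> complex) \<Rightarrow> real \<Rightarrow> complex" where
  "weak_deriv u = (SOME v. v \<in> L2 \<and> has_weak_deriv u v)"


section \<open>The coefficient, the operator and its resolvent\<close>

definition coeff_periodic :: "real \<Rightarrow> real \<Rightarrow> real \<Rightarrow> real \<Rightarrow> real" where
  "coeff_periodic b1 b2 x2 x = (if frac x < x2 then 1 / b2\<^sup>2 else 1 / b1\<^sup>2)"

definition coeff_trunc :: "real \<Rightarrow> real \<Rightarrow> real \<Rightarrow> nat \<Rightarrow> real \<Rightarrow> real" where
  "coeff_trunc b1 b2 x2 k x =
     (if x \<in> {0..real k} then coeff_periodic b1 b2 x2 x else 1 / b1\<^sup>2)"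

definition op_domain :: "(real \<Rightarrow> real) \<Rightarrow> (real \<Rightarrow> complex) set" where
  "op_domain a = {u \<in> H1. (\<lambda>x. of_real (a x) * weak_deriv u x) \<in> H1}"

definition op_P :: "(real \<Rightarrow> real) \<Rightarrow> (real \<Rightarrow> complex) \<Rightarrow> real \<Rightarrow> complex" where
  "op_P a u = (\<lambda>x. - weak_deriv (\<lambda>y. of_real (a y) * weak_deriv u y) x)"

text \<open>Meaningful for $\mathrm{Im}\,\mu > 0$, where self-adjointness and nonnegativity of the
  operator make the solution unique almost everywhere.\<close>

definition resolvent :: "(real \<Rightarrow> real) \<Rightarrow> complex \<Rightarrow> (real \<Rightarrow> complex) \<Rightarrow> real \<Rightarrow> complex" where
  "resolvent a \<mu> f =
     (SOME u. u \<in> op_domain a \<and> (AE x in lborel. op_P a u x - \<mu>\<^sup>2 * u x = f x))"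


section \<open>Meromorphic families of operators\<close>

type_synonym fun_op = "(real \<Rightarrow> complex) \<Rightarrow> (real \<Rightarrow> complex)"

definition op_bound :: "fun_op \<Rightarrow> real \<Rightarrow> bool" where
  "op_bound T C \<longleftrightarrow> (\<forall>f\<in>L2. T f \<in> L2 \<and> L2_norm (T f) \<le> C * L2_norm f)"

text \<open>Linearity and boundedness together imply that the operator respects equality almost
  everywhere, i.e. acts on the quotient space.\<close>

definition bounded_op :: "fun_op \<Rightarrow> bool" where
  "bounded_op T \<longleftrightarrow>
     (\<exists>C. op_bound T C) \<and>
     (\<forall>f\<in>L2. \<forall>g\<in>L2. \<forall>c d. AE x in lborel.
        T (\<lambda>y. c * f y + d * g y) x = c * T f x + d * T g x)"

text \<open>Complex differentiability with respect to the operator norm on $L^2$.\<close>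

definition op_has_deriv :: "(complex \<Rightarrow> fun_op) \<Rightarrow> fun_op \<Rightarrow> complex \<Rightarrow> bool" where
  "op_has_deriv T D z \<longleftrightarrow>
     (\<forall>\<epsilon>>0. \<forall>\<^sub>F w in at z. op_bound (\<lambda>f x. (T w f x - T z f x) / (w - z) - D f x) \<epsilon>)"

definition op_holomorphic_on :: "(complex \<Rightarrow> fun_op) \<Rightarrow> complex set \<Rightarrow> bool" where
  "op_holomorphic_on T U \<longleftrightarrow>
     (\<forall>z\<in>U. bounded_op (T z) \<and> (\<exists>D. bounded_op D \<and> op_has_deriv T D z))"

text \<open>\<open>T z = A z + (\<Sum>j=1..J. B j / (z - z0) ^ j)\<close> in a punctured neighbourhood of \<open>z0\<close>, with
  \<open>A\<close> holomorphic. As for \<open>meromorphic_on\<close>, the value \<open>T z0\<close> itself is irrelevant.\<close>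

definition op_polar_part ::
    "(complex \<Rightarrow> fun_op) \<Rightarrow> complex \<Rightarrow> nat \<Rightarrow> (nat \<Rightarrow> fun_op) \<Rightarrow> bool" where
  "op_polar_part T z0 J B \<longleftrightarrow>
     (\<forall>j\<in>{1..J}. bounded_op (B j)) \<and>
     (\<exists>r>0. \<exists>A. op_holomorphic_on A (ball z0 r) \<and>
        (\<forall>z\<in>ball z0 r - {z0}. bounded_op (T z) \<and>
           (\<forall>f\<in>L2. AE x in lborel.
              T z f x = A z f x + (\<Sum>j=1..J. B j f x / (z - z0) ^ j))))"

definition op_meromorphic_at :: "(complex \<Rightarrow> fun_op) \<Rightarrow> complex \<Rightarrow> bool" where
  "op_meromorphic_at T z0 \<longleftrightarrow> (\<exists>J B. op_polar_part T z0 J B)"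

definition op_is_pole :: "(complex \<Rightarrow> fun_op) \<Rightarrow> complex \<Rightarrow> bool" where
  "op_is_pole T z0 \<longleftrightarrow>
     (\<exists>J B. J \<ge> 1 \<and> op_polar_part T z0 J B \<and> \<not> (\<forall>f\<in>L2. AE x in lborel. B J f x = 0))"

text \<open>A family of operators from $L^2_{comp}$ to $L^2_{loc}$ is studied through its cut-offs, which
  act on $L^2$.\<close>

definition cutoff :: "real \<Rightarrow> fun_op \<Rightarrow> fun_op" where
  "cutoff N T f = (\<lambda>x. indicator {-N..N} x * T (\<lambda>y. indicator {-N..N} y * f y) x)"

definition resolvent_continuation :: "(real \<Rightarrow> real) \<Rightarrow> (complex \<Rightarrow> fun_op) \<Rightarrow> bool" where
  "resolvent_continuation a R \<longleftrightarrow>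
     (\<forall>\<mu>. Im \<mu> > 0 \<longrightarrow> (\<forall>f\<in>L2_comp. AE x in lborel. R \<mu> f x = resolvent a \<mu> f x)) \<and>
     (\<forall>N z. op_meromorphic_at (\<lambda>\<mu>. cutoff N (R \<mu>)) z)"

text \<open>By the identity theorem all continuations of the resolvent have the same poles.\<close>

definition resonances :: "(real \<Rightarrow> real) \<Rightarrow> complex set" where
  "resonances a =
     {z. Im z < 0 \<and>
        (\<exists>R. resolvent_continuation a R \<and> (\<exists>N. op_is_pole (\<lambda>\<mu>. cutoff N (R \<mu>)) z))}"


section \<open>The reflection coefficient\<close>

text \<open>The function \<open>w\<close> is the flux $a\,\partial_x\psi$; at the finitely many discontinuities
  of \<open>a\<close> only the continuity of \<open>\<psi>\<close> and \<open>w\<close> is imposed.\<close>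

definition stationary_solution ::
    "(real \<Rightarrow> real) \<Rightarrow> complex \<Rightarrow> (real \<Rightarrow> complex) \<Rightarrow> bool" where
  "stationary_solution a \<mu> \<psi> \<longleftrightarrow>
     continuous_on UNIV \<psi> \<and>
     (\<exists>w. continuous_on UNIV w \<and>
        (\<forall>x. isCont a x \<longrightarrow>
           (\<exists>d. (\<psi> has_vector_derivative d) (at x) \<and> w x = of_real (a x) * d) \<and>
           (\<exists>e. (w has_vector_derivative e) (at x) \<and> - e = \<mu>\<^sup>2 * \<psi> x)))"

definition scattering_coeffs ::
    "real \<Rightarrow> real \<Rightarrow> real \<Rightarrow> nat \<Rightarrow> complex \<Rightarrow> complex \<Rightarrow> complex \<Rightarrow> bool" where
  "scattering_coeffs b1 b2 x2 k \<mu> r t \<longleftrightarrow>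
     (\<exists>\<psi>. stationary_solution (coeff_trunc b1 b2 x2 k) \<mu> \<psi> \<and>
        (\<forall>x<0. \<psi> x = exp (\<i> * \<mu> * of_real (b1 * x)) + r * exp (- \<i> * \<mu> * of_real (b1 * x))) \<and>
        (\<forall>x>real k. \<psi> x = t * exp (\<i> * \<mu> * of_real (b1 * x))))"

text \<open>Only used for $\mathrm{Im}\,\mu \ge 0$, $\mu \neq 0$, where the coefficients exist
  and are unique.\<close>

definition reflection_coeff ::
    "real \<Rightarrow> real \<Rightarrow> real \<Rightarrow> nat \<Rightarrow> complex \<Rightarrow> complex" where
  "reflection_coeff b1 b2 x2 k \<mu> = (THE r. \<exists>t. scattering_coeffs b1 b2 x2 k \<mu> r t)"

end

theory Submission
  imports Defs
begin

text \<open>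
  Write the stationary equation as the first order system $p' = i\mu q/a$, $q' = i\mu p$ with
  $p=\psi$ and $i\mu q=a\psi'$. Its solutions are explicit in each layer and entire in $\mu$. Let
  $\psi_-$ be the solution equal to $e^{-i\mu b_1x}$ for $x<0$ and $\psi_+$ the one equal to
  $e^{i\mu b_1x}$ for $x>k$, and write $\psi_+=Ae^{i\mu b_1x}+Be^{-i\mu b_1x}$ for $x<0$. Then
  $r_k=B/A$ with $A$, $B$ entire and without common zeros, so the poles of $r_k$ are the zeros of $A$.
  The Wronskian of $\psi_\pm$ is a multiple of $A$, so the resolvent has the kernel
  $\frac{ib_1}{2\mu A(\mu)}\psi_+(\max(x,y))\,\psi_-(\min(x,y))$, whose numerator is entire in
  $\mu$ and never the zero kernel; its poles in the lower half plane are again the zeros of $A$. Any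
  other continuation of the resolvent has the same poles, by the identity theorem applied to the
  matrix elements.
\<close>

section \<open>Locally absolutely continuous functions\<close>

text \<open>The definitions see functions only up to null sets: weak derivatives and the resolvent
  are arbitrary choices, and a continuation of the resolvent is any family with the right values
  almost everywhere. Elements of the operator domain are therefore replaced by locally absolutely
  continuous representatives, together with one of their flux, so that Wronskians are constant at
  every point. For Im \<mu> > 0 the difference of two solutions of the resolvent equation has
  Wronskians with \<psi>_+ and \<psi>_- that are integrable over a half-line, hence zero; this
  identifies the chosen resolvent with the kernel operator. Dividing the flux by i \<mu> makes the
  Cauchy data (1, 1/b1) and (1, -1/b1) at 0 independent of \<mu> and keeps the two solutions
  independent at \<mu> = 0. The factor \<mu> then occurs only in the denominator of the kernel, and
  its zero lies outside the lower half plane. Meromorphy in operator norm is obtained from divided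
  differences of the kernel in \<mu>: they give exact Taylor formulas whose remainders are again
  bounded kernels.\<close>

definition loc_int :: "(real \<Rightarrow> complex) \<Rightarrow> bool" where
  "loc_int v \<longleftrightarrow> (\<forall>a b. set_integrable lborel {a..b} v)"

text \<open>Absolute continuity is encoded by the fundamental theorem of calculus, with the
  derivative as a second argument: \<open>v\<close> matters only up to null sets, whereas
  \<open>u\<close> is constrained at every point.\<close>

definition abs_cont :: "(real \<Rightarrow> complex) \<Rightarrow> (real \<Rightarrow> complex) \<Rightarrow> bool" where
  "abs_cont u v \<longleftrightarrow> loc_int v \<and> (\<forall>a b. a \<le> b \<longrightarrow> u b - u a = (LINT x:{a..b}|lborel. v x))"

text \<open>The definition controls \<open>v\<close> on bounded intervals only; at each point the
  truncations to [-n, n] are eventually equal to \<open>v\<close>.\<close>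

lemma loc_int_measurable:
  assumes "loc_int v" shows "v \<in> borel_measurable borel"
proof (rule borel_measurable_LIMSEQ_metric)
  show "(\<lambda>x. indicator {- real n..real n} x *\<^sub>R v x) \<in> borel_measurable borel" for n
  proof -
    have "integrable lborel (\<lambda>x. indicator {- real n..real n} x *\<^sub>R v x)"
      using assms by (auto simp: loc_int_def set_integrable_def)
    from borel_measurable_integrable[OF this] show ?thesis by simp
  qed
  fix x :: real
  have "eventually (\<lambda>n. indicator {- real n..real n} x *\<^sub>R v x = v x) sequentially"
    using eventually_ge_at_top[of "nat \<lceil>\<bar>x\<bar>\<rceil>"]
    by eventually_elim (auto simp: indicator_def; linarith)
  then show "(\<lambda>n. indicator {- real n..real n} x *\<^sub>R v x) \<longlonglongrightarrow> v x"
    by (rule tendsto_eventually)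
qed

lemma loc_int_continuous: "continuous_on UNIV v \<Longrightarrow> loc_int v"
  unfolding loc_int_def
  by (auto intro!: borel_integrable_atLeastAtMost' continuous_on_subset[of UNIV])

lemma loc_int_add: "loc_int u \<Longrightarrow> loc_int v \<Longrightarrow> loc_int (\<lambda>x. u x + v x)"
  unfolding loc_int_def by auto

lemma loc_int_cmult: "loc_int u \<Longrightarrow> loc_int (\<lambda>x. c * u x)"
  unfolding loc_int_def by auto

lemma loc_int_cong_AE:
  assumes "loc_int u" "AE x in lborel. u x = v x" "v \<in> borel_measurable borel"
  shows "loc_int v"
  unfolding loc_int_def
proof (intro allI)
  fix a b
  have "set_integrable lborel {a..b} u" using assms by (simp add: loc_int_def)
  moreover have "AE x \<in> {a..b} in lborel. u x = v x" using assms(2) by eventually_elim simp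
  ultimately show "set_integrable lborel {a..b} v"
    using loc_int_measurable[OF assms(1)] assms(3)
    using set_integrable_cong_AE[of u lborel v "{a..b}"] by auto
qed

lemma loc_int_mult_bounded:
  assumes v: "loc_int v" and g: "g \<in> borel_measurable borel"
    and bd: "\<And>a b. \<exists>C. \<forall>x\<in>{a..b}. cmod (g x) \<le> C"
  shows "loc_int (\<lambda>x. g x * v x)"
  unfolding loc_int_def
proof (intro allI)
  fix a b
  obtain C where C: "\<And>x. x \<in> {a..b} \<Longrightarrow> cmod (g x) \<le> C" using bd by meson
  have vm: "v \<in> borel_measurable borel" by (rule loc_int_measurable[OF v])
  have i: "integrable lborel (\<lambda>x. C *\<^sub>R (indicator {a..b} x *\<^sub>R v x))"
    using v unfolding loc_int_def set_integrable_def by (intro integrable_scaleR_right) blast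
  show "set_integrable lborel {a..b} (\<lambda>x. g x * v x)"
    unfolding set_integrable_def
  proof (rule Bochner_Integration.integrable_bound[OF i])
    show "(\<lambda>x. indicat_real {a..b} x *\<^sub>R (g x * v x)) \<in> borel_measurable lborel"
      using g vm by auto
    show "AE x in lborel. norm (indicat_real {a..b} x *\<^sub>R (g x * v x))
      \<le> norm (C *\<^sub>R indicat_real {a..b} x *\<^sub>R v x)"
      by (intro AE_I2) (auto simp: indicator_def norm_mult intro!: mult_right_mono order_trans[OF C])
  qed
qed

lemma loc_int_mult_continuous:
  assumes v: "loc_int v" and g: "continuous_on UNIV g"
  shows "loc_int (\<lambda>x. g x * v x)"
proof (rule loc_int_mult_bounded[OF v])
  show "g \<in> borel_measurable borel" using g by (rule borel_measurable_continuous_onI)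
  fix a b :: real
  have "compact (g ` {a..b})"
    by (intro compact_continuous_image continuous_on_subset[OF g]) auto
  then show "\<exists>C. \<forall>x\<in>{a..b}. cmod (g x) \<le> C"
    by (auto dest!: compact_imp_bounded simp: bounded_iff)
qed

lemma abs_contI:
  assumes "loc_int v" "\<And>a b. a \<le> b \<Longrightarrow> u b - u a = (LINT x:{a..b}|lborel. v x)"
  shows "abs_cont u v"
  using assms by (auto simp: abs_cont_def)

lemma abs_cont_loc_int: "abs_cont u v \<Longrightarrow> loc_int v"
  and abs_cont_diff: "abs_cont u v \<Longrightarrow> a \<le> b \<Longrightarrow> u b - u a = (LINT x:{a..b}|lborel. v x)"
  by (auto simp: abs_cont_def)

lemma abs_cont_diff_integral:
  assumes "abs_cont u v" "a \<le> b"
  shows "v integrable_on {a..b}" "u b = u a + integral {a..b} v"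
proof -
  have i: "set_integrable lborel {a..b} v" using assms by (auto simp: abs_cont_def loc_int_def)
  show "v integrable_on {a..b}" using set_borel_integral_eq_integral[OF i] by simp
  show "u b = u a + integral {a..b} v"
    using set_borel_integral_eq_integral[OF i] abs_cont_diff[OF assms] by (simp add: algebra_simps)
qed

lemma abs_cont_continuous:
  assumes "abs_cont u v"
  shows "continuous_on UNIV u"
proof -
  have "isCont u x" for x
  proof -
    have c: "continuous_on {x-1..x+1} (\<lambda>y. u (x-1) + integral {x-1..y} v)"
      by (intro continuous_intros indefinite_integral_continuous_1 abs_cont_diff_integral[OF assms]) auto
    have "u (x-1) + integral {x-1..y} v = u y" if "y \<in> {x-1..x+1}" for y
      using abs_cont_diff_integral(2)[OF assms, of "x-1" y] that by auto
    then have "continuous_on {x-1..x+1} u" by (rule continuous_on_eq[OF c])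
    then show ?thesis by (rule continuous_on_interior) simp
  qed
  then show ?thesis by (simp add: continuous_at_imp_continuous_on)
qed

lemma abs_cont_has_vector_derivative:
  assumes "abs_cont u v" "isCont v x"
  shows "(u has_vector_derivative v x) (at x)"
proof -
  have "((\<lambda>y. integral {x-1..y} v) has_vector_derivative v x) (at x within ({x-1..x+1} - {}))"
    by (rule integral_has_vector_derivative_continuous_at)
       (use assms in \<open>auto intro: continuous_at_imp_continuous_at_within abs_cont_diff_integral\<close>)
  then have "((\<lambda>y. integral {x-1..y} v) has_vector_derivative v x) (at x)"
    by (simp only: Diff_empty at_within_Icc_at[of "x-1" x "x+1"] less_add_one diff_less_eq)
  then have "((\<lambda>y. u (x-1) + integral {x-1..y} v) has_vector_derivative 0 + v x) (at x)"
    by (intro has_vector_derivative_add has_vector_derivative_const)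
  then have "((\<lambda>y. u (x-1) + integral {x-1..y} v) has_vector_derivative v x) (at x)"
    by simp
  then show ?thesis
  proof (rule has_vector_derivative_transform_within_open[where S = "{x-1<..<x+1}"])
    fix y assume "y \<in> {x-1<..<x+1}"
    then show "u (x-1) + integral {x-1..y} v = u y"
      using abs_cont_diff_integral(2)[OF assms(1), of "x-1" y] by auto
  qed auto
qed

text \<open>Stationary solutions are known to be differentiable only off the layer boundaries;
  continuity of \<open>u\<close> bridges such a finite set.\<close>

lemma abs_cont_FTC:
  assumes "finite S" "continuous_on UNIV u" "loc_int v"
    and "\<And>x. x \<notin> S \<Longrightarrow> (u has_vector_derivative v x) (at x)"
  shows "abs_cont u v"
proof (rule abs_contI[OF assms(3)])
  fix a b :: real assume ab: "a \<le> b"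
  have "(v has_integral (u b - u a)) {a..b}"
    by (rule fundamental_theorem_of_calculus_strong[OF assms(1) ab])
       (use assms in \<open>auto intro: continuous_on_subset\<close>)
  then show "u b - u a = (LINT x:{a..b}|lborel. v x)"
    using set_borel_integral_eq_integral(2)[of "{a..b}" v] assms(3)
    by (simp add: loc_int_def integral_unique)
qed

lemma abs_cont_C1:
  assumes "\<And>x. (u has_vector_derivative v x) (at x)" "continuous_on UNIV v"
  shows "abs_cont u v"
  using assms
  by (intro abs_cont_FTC[of "{}"] loc_int_continuous)
     (auto simp: continuous_on_eq_continuous_within intro: has_vector_derivative_continuous)

lemma abs_cont_const: "abs_cont (\<lambda>x. c) (\<lambda>x. 0)"
  by (rule abs_cont_C1) auto

lemma abs_cont_add:
  "abs_cont u v \<Longrightarrow> abs_cont u' v' \<Longrightarrow> abs_cont (\<lambda>x. u x + u' x) (\<lambda>x. v x + v' x)"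
  unfolding abs_cont_def loc_int_def by (auto simp: set_integral_add(2)) (metis add_diff_add)

lemma abs_cont_cmult: "abs_cont u v \<Longrightarrow> abs_cont (\<lambda>x. c * u x) (\<lambda>x. c * v x)"
  unfolding abs_cont_def loc_int_def by (auto simp flip: right_diff_distrib)

lemma abs_cont_minus: "abs_cont u v \<Longrightarrow> abs_cont (\<lambda>x. - u x) (\<lambda>x. - v x)"
  using abs_cont_cmult[of u v "-1"] by simp

lemma abs_cont_sub:
  "abs_cont u v \<Longrightarrow> abs_cont u' v' \<Longrightarrow> abs_cont (\<lambda>x. u x - u' x) (\<lambda>x. v x - v' x)"
  using abs_cont_add[OF _ abs_cont_minus, of u v u' v'] by simp

lemma abs_cont_cnj: "abs_cont u v \<Longrightarrow> abs_cont (\<lambda>x. cnj (u x)) (\<lambda>x. cnj (v x))"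
  unfolding abs_cont_def loc_int_def set_integrable_def set_lebesgue_integral_def
  by (auto simp flip: complex_cnj_diff complex_cnj_scaleR)

text \<open>Equality almost everywhere does not carry over Borel measurability, because
  \<open>lborel\<close> is not complete, so that of \<open>v'\<close> is a separate
  assumption.\<close>

lemma abs_cont_cong_AE:
  assumes "abs_cont u v" "AE x in lborel. v x = v' x" "v' \<in> borel_measurable borel"
  shows "abs_cont u v'"
proof (rule abs_contI)
  show "loc_int v'" using assms by (auto intro: loc_int_cong_AE dest: abs_cont_loc_int)
  fix a b :: real assume ab: "a \<le> b"
  have "AE x \<in> {a..b} in lborel. v x = v' x" using assms(2) by eventually_elim simp
  then have "(LINT x:{a..b}|lborel. v x) = (LINT x:{a..b}|lborel. v' x)"
    using loc_int_measurable[OF abs_cont_loc_int[OF assms(1)]] assms(3)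
    by (intro set_lebesgue_integral_cong_AE) auto
  then show "u b - u a = (LINT x:{a..b}|lborel. v' x)"
    using abs_cont_diff[OF assms(1) ab] by simp
qed

lemma abs_cont_zero_const:
  assumes "abs_cont u (\<lambda>x. 0)" shows "u x = u y"
  using abs_cont_diff[OF assms, of x y] abs_cont_diff[OF assms, of y x]
  by (cases "x \<le> y") (auto simp: set_lebesgue_integral_def)

text \<open>Only the values have to match at \<open>c\<close>, the derivatives may jump. This is how
  the solutions of adjacent layers are joined.\<close>

lemma abs_cont_glue:
  assumes u: "abs_cont u v" and u': "abs_cont u' v'" and eq: "u c = u' c"
  shows "abs_cont (\<lambda>x. if x < c then u x else u' x) (\<lambda>x. if x < c then v x else v' x)"
    (is "abs_cont ?u ?v")
proof -
  have m: "v \<in> borel_measurable borel" "v' \<in> borel_measurable borel"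
    using u u' by (auto intro: loc_int_measurable abs_cont_loc_int)
  have AEc: "AE x in lborel. x \<noteq> c" by (rule AE_lborel_singleton)
  \<comment> \<open>The integrands are compared only off \<open>c\<close>: on an interval that ends
    at \<open>c\<close> the left branch is meant, although the glued derivative already takes the
    right branch at \<open>c\<close> itself.\<close>
  have part: "set_integrable lborel {a..b} ?v \<and> (LINT x:{a..b}|lborel. ?v x) = w b - w a"
    if w: "abs_cont w w'" and ab: "a \<le> b" and eq: "\<And>x. x \<in> {a..b} \<Longrightarrow> x \<noteq> c \<Longrightarrow> ?v x = w' x"
    for w w' a b
  proof -
    have ae: "AE x\<in>{a..b} in lborel. ?v x = w' x" using AEc by eventually_elim (use eq in blast)
    have "set_integrable lborel {a..b} w'" "w' \<in> borel_measurable borel"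
      using abs_cont_loc_int[OF w] by (auto simp: loc_int_def intro: loc_int_measurable[unfolded loc_int_def])
    then show ?thesis
      using set_integrable_cong_AE[OF _ _ ae] set_lebesgue_integral_cong_AE[OF _ _ _ ae] m
        abs_cont_diff[OF w ab] by simp
  qed
  note left = part[OF u] and right = part[OF u']
  have main: "set_integrable lborel {a..b} ?v \<and> (LINT x:{a..b}|lborel. ?v x) = ?u b - ?u a"
    if ab: "a \<le> b" for a b
  proof -
    consider "b \<le> c" | "c \<le> a" | "a < c" "c < b" by linarith
    then show ?thesis
    proof cases
      case 3
      have un: "{a..b} = {a..c} \<union> {c..b}" using 3 by auto
      have "set_integrable lborel {a..b} ?v"
        unfolding un using left[of a c] right[of c b] 3 by (intro set_integrable_Un) auto
      moreover have "(LINT x:{a..b}|lborel. ?v x)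
          = (LINT x:{a..c}|lborel. ?v x) + (LINT x:{c..b}|lborel. ?v x)"
        unfolding un
      proof (rule set_integral_Un_AE)
        show "AE x in lborel. \<not> (x \<in> {a..c} \<and> x \<in> {c..b})" using AEc by eventually_elim auto
      qed (use left[of a c] right[of c b] 3 in auto)
      ultimately show ?thesis using left[of a c] right[of c b] 3 eq by auto
    qed (use left[OF ab] right[OF ab] ab eq in \<open>auto simp: not_less\<close>)
  qed
  show ?thesis
  proof (rule abs_contI)
    show "loc_int ?v" unfolding loc_int_def
    proof (intro allI)
      fix a b show "set_integrable lborel {a..b} ?v"
        using main[of a b] by (cases "a \<le> b") (auto simp: set_integrable_def)
    qed
  qed (use main in auto)
qed

section \<open>The product rule by Fubini\<close>

abbreviation lborel2 :: "(real \<times> real) measure" where "lborel2 \<equiv> lborel \<Otimes>\<^sub>M lborel"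

lemma integrable_pair_mult:
  fixes f g :: "real \<Rightarrow> complex"
  assumes f: "integrable lborel f" and g: "integrable lborel g"
  shows "integrable lborel2 (\<lambda>(x,y). f x * g y)"
proof (rule lborel_pair.Fubini_integrable)
  have [measurable]: "f \<in> borel_measurable borel" "g \<in> borel_measurable borel"
    using f g by auto
  show "(\<lambda>(x, y). f x * g y) \<in> borel_measurable lborel2" by measurable
  show "integrable lborel (\<lambda>x. LINT y|lborel. norm (case (x, y) of (x, y) \<Rightarrow> f x * g y))"
    using f g by (auto simp: norm_mult)
  show "AE x in lborel. integrable lborel (\<lambda>y. case (x, y) of (x, y) \<Rightarrow> f x * g y)"
    using g by auto
qed

text \<open>The product of the two increments is the integral of \<open>v1 s * v2 t\<close> over the
  square with side [a, b]. Integrating over the triangles on either side of the diagonal gives the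
  two terms of the product rule, up to boundary values.\<close>

lemma abs_cont_mult:
  assumes u1: "abs_cont u1 v1" and u2: "abs_cont u2 v2"
  shows "abs_cont (\<lambda>x. u1 x * u2 x) (\<lambda>x. v1 x * u2 x + u1 x * v2 x)"
proof (rule abs_contI)
  have l1: "loc_int (\<lambda>x. v1 x * u2 x)"
    using loc_int_mult_continuous[OF abs_cont_loc_int[OF u1] abs_cont_continuous[OF u2]]
    by (simp add: mult.commute)
  have l2: "loc_int (\<lambda>x. u1 x * v2 x)"
    using loc_int_mult_continuous[OF abs_cont_loc_int[OF u2] abs_cont_continuous[OF u1]] .
  show "loc_int (\<lambda>x. v1 x * u2 x + u1 x * v2 x)" using l1 l2 by (rule loc_int_add)
  fix a b :: real assume ab: "a \<le> b"
  define f1 where "f1 x = indicator {a..b} x *\<^sub>R v1 x" for x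
  define f2 where "f2 x = indicator {a..b} x *\<^sub>R v2 x" for x
  have i1: "integrable lborel f1" and i2: "integrable lborel f2"
    using abs_cont_loc_int[OF u1] abs_cont_loc_int[OF u2]
    by (auto simp: f1_def[abs_def] f2_def[abs_def] loc_int_def set_integrable_def)
  have [measurable]: "f1 \<in> borel_measurable borel" "f2 \<in> borel_measurable borel"
    using i1 i2 by auto
  have I: "integrable lborel2 (\<lambda>(x,y). f1 x * f2 y)"
    by (rule integrable_pair_mult[OF i1 i2])
  \<comment> \<open>The diagonal belongs to \<open>L\<close> only, so that \<open>L\<close> and
    \<open>U\<close> add up to the full product at every point. The strict inequality in
    \<open>U\<close> costs one null set in \<open>low1\<close>.\<close>
  define L where "L = (\<lambda>(s,t). if t \<le> s then f1 s * f2 t else (0::complex))"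
  define U where "U = (\<lambda>(s,t). if s < t then f1 s * f2 t else (0::complex))"
  have meas[measurable]: "L \<in> borel_measurable lborel2"
      "U \<in> borel_measurable lborel2"
    unfolding L_def U_def by measurable
  have IL: "integrable lborel2 L" "integrable lborel2 U"
    by (rule Bochner_Integration.integrable_bound[OF I]; auto simp: L_def U_def)+
  have low2: "(LINT t|lborel. (if t \<le> s then f2 t else 0)) = u2 s - u2 a" if "s \<in> {a..b}" for s
  proof -
    have "(LINT t|lborel. (if t \<le> s then f2 t else 0)) = (LINT t:{a..s}|lborel. v2 t)"
      unfolding set_lebesgue_integral_def
      by (rule Bochner_Integration.integral_cong) (use that in \<open>auto simp: f2_def indicator_def\<close>)
    then show ?thesis using abs_cont_diff[OF u2, of a s] that by simp
  qed
  have low1: "(LINT t|lborel. (if t < s then f1 t else 0)) = u1 s - u1 a" if "s \<in> {a..b}" for s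
  proof -
    have "(LINT t|lborel. (if t < s then f1 t else 0)) = (LINT t:{a..s}|lborel. v1 t)"
      unfolding set_lebesgue_integral_def
    proof (rule integral_cong_AE)
      have [measurable]: "v1 \<in> borel_measurable borel"
        by (rule loc_int_measurable[OF abs_cont_loc_int[OF u1]])
      show "(\<lambda>x. indicat_real {a..s} x *\<^sub>R v1 x) \<in> borel_measurable lborel" by measurable
      show "AE x in lborel. (if x < s then f1 x else 0) = indicat_real {a..s} x *\<^sub>R v1 x"
        using AE_lborel_singleton[of s]
        by eventually_elim (use that in \<open>auto simp: f1_def indicator_def\<close>)
    qed measurable
    then show ?thesis using abs_cont_diff[OF u1, of a s] that by simp
  qed
  have sint: "set_integrable lborel {a..b} v1" "set_integrable lborel {a..b} v2"
     "set_integrable lborel {a..b} (\<lambda>x. v1 x * u2 x)" "set_integrable lborel {a..b} (\<lambda>x. u1 x * v2 x)"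
    using abs_cont_loc_int[OF u1] abs_cont_loc_int[OF u2] l1 l2 by (auto simp: loc_int_def)
  have "integral\<^sup>L lborel2 L = (LINT s|lborel. LINT t|lborel. L (s,t))"
    using lborel_pair.integral_fst'[OF IL(1)] by simp
  also have "\<dots> = (LINT s:{a..b}|lborel. v1 s * (u2 s - u2 a))"
    unfolding set_lebesgue_integral_def
  proof (rule Bochner_Integration.integral_cong[OF refl])
    fix s
    have "(LINT t|lborel. L (s,t)) = (LINT t|lborel. f1 s * (if t \<le> s then f2 t else 0))"
      by (rule Bochner_Integration.integral_cong) (auto simp: L_def)
    then show "(LINT t|lborel. L (s,t)) = indicat_real {a..b} s *\<^sub>R (v1 s * (u2 s - u2 a))"
      using low2[of s] by (cases "s \<in> {a..b}") (auto simp: f1_def)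
  qed
  also have "\<dots> = (LINT s:{a..b}|lborel. v1 s * u2 s - u2 a * v1 s)"
    by (simp add: algebra_simps)
  also have "\<dots> = (LINT s:{a..b}|lborel. v1 s * u2 s) - u2 a * (u1 b - u1 a)"
    using sint by (subst set_integral_diff) (auto simp: abs_cont_diff[OF u1 ab])
  finally have eL: "integral\<^sup>L lborel2 L
    = (LINT s:{a..b}|lborel. v1 s * u2 s) - u2 a * (u1 b - u1 a)" .
  have "integral\<^sup>L lborel2 U = (LINT t|lborel. LINT s|lborel. U (s,t))"
    using lborel_pair.integral_snd[of "\<lambda>x y. U (x,y)"] IL(2) by simp
  also have "\<dots> = (LINT t:{a..b}|lborel. v2 t * (u1 t - u1 a))"
    unfolding set_lebesgue_integral_def
  proof (rule Bochner_Integration.integral_cong[OF refl])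
    fix t
    have "(LINT s|lborel. U (s,t)) = (LINT s|lborel. f2 t * (if s < t then f1 s else 0))"
      by (rule Bochner_Integration.integral_cong) (auto simp: U_def)
    then show "(LINT s|lborel. U (s,t)) = indicat_real {a..b} t *\<^sub>R (v2 t * (u1 t - u1 a))"
      using low1[of t] by (cases "t \<in> {a..b}") (auto simp: f2_def)
  qed
  also have "\<dots> = (LINT s:{a..b}|lborel. u1 s * v2 s - u1 a * v2 s)"
    by (simp add: algebra_simps)
  also have "\<dots> = (LINT s:{a..b}|lborel. u1 s * v2 s) - u1 a * (u2 b - u2 a)"
    using sint by (subst set_integral_diff) (auto simp: abs_cont_diff[OF u2 ab])
  finally have eU: "integral\<^sup>L lborel2 U
    = (LINT s:{a..b}|lborel. u1 s * v2 s) - u1 a * (u2 b - u2 a)" .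
  have "integral\<^sup>L lborel2 L + integral\<^sup>L lborel2 U
      = integral\<^sup>L lborel2 (\<lambda>z. L z + U z)"
    using IL by simp
  also have "\<dots> = integral\<^sup>L lborel2 (\<lambda>(x,y). f1 x * f2 y)"
    by (rule Bochner_Integration.integral_cong) (auto simp: L_def U_def)
  also have "\<dots> = (LINT x|lborel. f1 x) * (LINT y|lborel. f2 y)"
    using lborel_pair.integral_fst'[OF I] by simp
  also have "\<dots> = (u1 b - u1 a) * (u2 b - u2 a)"
    using abs_cont_diff[OF u1 ab] abs_cont_diff[OF u2 ab]
    by (simp add: f1_def f2_def set_lebesgue_integral_def)
  finally have eq: "integral\<^sup>L lborel2 L + integral\<^sup>L lborel2 U
    = (u1 b - u1 a) * (u2 b - u2 a)" .
  have alg: "b1 * b2 - a1 * a2 = I1 + I2"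
    if "(I1 - a2 * (b1 - a1)) + (I2 - a1 * (b2 - a2)) = (b1 - a1) * (b2 - a2)"
    for I1 I2 a1 a2 b1 b2 :: complex
    using that by algebra
  have "(LINT x:{a..b}|lborel. v1 x * u2 x + u1 x * v2 x)
    = (LINT s:{a..b}|lborel. v1 s * u2 s) + (LINT s:{a..b}|lborel. u1 s * v2 s)"
    by (rule set_integral_add(2)[OF sint(3,4)])
  then show "u1 b * u2 b - u1 a * u2 a = (LINT x:{a..b}|lborel. v1 x * u2 x + u1 x * v2 x)"
    using alg[OF eq[unfolded eL eU]] by (rule trans[OF _ sym, rotated])
qed

section \<open>Square integrable functions and weak derivatives\<close>

lemma L2_measurable: "f \<in> L2 \<Longrightarrow> f \<in> borel_measurable borel"
  and L2_square_integrable: "f \<in> L2 \<Longrightarrow> integrable lborel (\<lambda>x. (cmod (f x))\<^sup>2)"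
  by (auto simp: L2_def)

lemma L2I:
  "f \<in> borel_measurable borel \<Longrightarrow> integrable lborel (\<lambda>x. (cmod (f x))\<^sup>2) \<Longrightarrow> f \<in> L2"
  by (auto simp: L2_def)

lemma L2_bound:
  assumes "integrable lborel g" "f \<in> borel_measurable borel" "AE x in lborel. (cmod (f x))\<^sup>2 \<le> g x"
  shows "f \<in> L2"
proof (rule L2I[OF assms(2)], rule Bochner_Integration.integrable_bound[OF assms(1)])
  show "(\<lambda>x. (cmod (f x))\<^sup>2) \<in> borel_measurable lborel" using assms(2) by measurable
  show "AE x in lborel. norm ((cmod (f x))\<^sup>2) \<le> norm (g x)" using assms(3) by eventually_elim auto
qed

lemma square_add_le: "(cmod (x + y))\<^sup>2 \<le> 2 * (cmod x)\<^sup>2 + 2 * (cmod y)\<^sup>2"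
proof -
  have "(cmod (x + y))\<^sup>2 \<le> (cmod x + cmod y)\<^sup>2" by (intro power_mono norm_triangle_ineq) auto
  also have "\<dots> \<le> 2 * (cmod x)\<^sup>2 + 2 * (cmod y)\<^sup>2"
    using sum_squares_bound[of "cmod x" "cmod y"] by (simp add: power2_sum)
  finally show ?thesis .
qed

lemma cmod_mult_le: "cmod (x * y) \<le> (cmod x)\<^sup>2 + (cmod y)\<^sup>2"
  using sum_squares_bound[of "cmod x" "cmod y"] mult_nonneg_nonneg[of "cmod x" "cmod y"]
    norm_ge_zero[of x] norm_ge_zero[of y] unfolding norm_mult by linarith

lemma L2_add: "f \<in> L2 \<Longrightarrow> g \<in> L2 \<Longrightarrow> (\<lambda>x. f x + g x) \<in> L2"
  by (rule L2_bound[where g = "\<lambda>x. 2 * (cmod (f x))\<^sup>2 + 2 * (cmod (g x))\<^sup>2"])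
     (auto intro!: Bochner_Integration.integrable_add integrable_mult_right L2_square_integrable
       intro: borel_measurable_add dest: L2_measurable simp: square_add_le)

lemma L2_mult_bounded:
  assumes f: "f \<in> L2" and g: "g \<in> borel_measurable borel" and bd: "\<And>x. cmod (g x) \<le> C"
  shows "(\<lambda>x. g x * f x) \<in> L2"
proof (rule L2_bound[where g = "\<lambda>x. C\<^sup>2 * (cmod (f x))\<^sup>2"])
  show "integrable lborel (\<lambda>x. C\<^sup>2 * (cmod (f x))\<^sup>2)" using L2_square_integrable[OF f] by simp
  show "(\<lambda>x. g x * f x) \<in> borel_measurable borel" using g L2_measurable[OF f] by measurable
  show "AE x in lborel. (cmod (g x * f x))\<^sup>2 \<le> C\<^sup>2 * (cmod (f x))\<^sup>2"
    by (intro AE_I2) (auto simp: norm_mult power_mult_distrib intro!: mult_right_mono power_mono bd)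
qed

lemma L2_cmult: "f \<in> L2 \<Longrightarrow> (\<lambda>x. c * f x) \<in> L2"
  by (rule L2_mult_bounded[where C = "cmod c"]) auto

lemma L2_minus: "f \<in> L2 \<Longrightarrow> (\<lambda>x. - f x) \<in> L2"
  using L2_cmult[of f "-1"] by simp

lemma L2_diff: "f \<in> L2 \<Longrightarrow> g \<in> L2 \<Longrightarrow> (\<lambda>x. f x - g x) \<in> L2"
  using L2_add[OF _ L2_minus, of f g] by simp

lemma L2_cnj: "f \<in> L2 \<Longrightarrow> (\<lambda>x. cnj (f x)) \<in> L2"
  by (rule L2I) (auto dest: L2_square_integrable L2_measurable intro: borel_measurable_continuous_on[OF continuous_on_cnj[OF continuous_on_id], of f, unfolded id_def])

lemma L2_cong_AE:
  assumes "f \<in> L2" "AE x in lborel. f x = g x" "g \<in> borel_measurable borel"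
  shows "g \<in> L2"
proof (rule L2_bound[OF L2_square_integrable[OF assms(1)] assms(3)])
  show "AE x in lborel. (cmod (g x))\<^sup>2 \<le> (cmod (f x))\<^sup>2" using assms(2) by eventually_elim auto
qed

lemma L2_mult_integrable:
  assumes "f \<in> L2" "g \<in> L2" shows "integrable lborel (\<lambda>x. f x * g x)"
proof (rule Bochner_Integration.integrable_bound)
  show "integrable lborel (\<lambda>x. (cmod (f x))\<^sup>2 + (cmod (g x))\<^sup>2)"
    using assms by (auto intro: L2_square_integrable)
  show "(\<lambda>x. f x * g x) \<in> borel_measurable lborel"
    using L2_measurable[OF assms(1)] L2_measurable[OF assms(2)] by measurable
  show "AE x in lborel. norm (f x * g x) \<le> norm ((cmod (f x))\<^sup>2 + (cmod (g x))\<^sup>2)"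
    by (intro AE_I2) (use cmod_mult_le in auto)
qed

lemma indicator_interval_L2: "(\<lambda>x. indicator {a..b} x) \<in> L2"
proof (rule L2_bound)
  show "integrable lborel (\<lambda>x. indicator {a..b} x :: real)"
    using emeasure_lborel_Icc_eq[of a b] by (auto simp: integrable_indicator_iff)
qed (auto simp: indicator_def)

lemma L2_loc_int: assumes "f \<in> L2" shows "loc_int f"
  unfolding loc_int_def set_integrable_def
proof (intro allI)
  fix a b
  have "integrable lborel (\<lambda>x. indicator {a..b} x * f x)"
    by (rule L2_mult_integrable[OF indicator_interval_L2 assms])
  moreover have "(\<lambda>x. indicator {a..b} x * f x) = (\<lambda>x. indicator {a..b} x *\<^sub>R f x)"
    by (auto simp: indicator_def)
  ultimately show "integrable lborel (\<lambda>x. indicator {a..b} x *\<^sub>R f x)" by simp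
qed

lemma abs_cont_exists:
  assumes v: "loc_int v" obtains u where "abs_cont u v"
proof
  \<comment> \<open>The oriented integral from 0 covers both signs of x with one formula.\<close>
  show "abs_cont (\<lambda>x. LBINT t=ereal 0..ereal x. v t) v"
  proof (rule abs_contI[OF v])
    fix a b :: real assume ab: "a \<le> b"
    define l h where "l = min 0 (min a b)" and "h = max 0 (max a b)"
    have lh: "ereal l \<le> ereal h" by (simp add: l_def h_def min_def max_def)
    have "set_integrable lborel {l..h} v" using v by (auto simp: loc_int_def)
    then have "set_integrable lborel (einterval (ereal l) (ereal h)) v"
      by (rule set_integrable_subset) (auto simp: einterval_def)
    then have "interval_lebesgue_integrable lborel (ereal l) (ereal h) v"
      unfolding interval_lebesgue_integrable_def using lh by (simp only: if_True)
    moreover have "ereal l = min (ereal 0) (min (ereal a) (ereal b))"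
      "ereal h = max (ereal 0) (max (ereal a) (ereal b))"
      by (simp_all add: l_def h_def min_def max_def)
    ultimately have "interval_lebesgue_integrable lborel (min (ereal 0) (min (ereal a) (ereal b)))
        (max (ereal 0) (max (ereal a) (ereal b))) v"
      by simp
    from interval_integral_sum[OF this]
    show "(LBINT t=ereal 0..ereal b. v t) - (LBINT t=ereal 0..ereal a. v t) = (LINT x:{a..b}|lborel. v x)"
      using interval_integral_Icc[OF ab, of v] by (metis add_diff_cancel_left')
  qed
qed

section \<open>Test functions, and weak derivatives versus absolute continuity\<close>

lemma test_functionE:
  assumes "test_function \<phi>"
  obtains N where "N > 0" "\<And>x. \<bar>x\<bar> \<ge> N \<Longrightarrow> \<phi> x = 0" "\<And>x. \<bar>x\<bar> \<ge> N \<Longrightarrow> deriv \<phi> x = 0"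
    "\<And>x. (\<phi> has_real_derivative deriv \<phi> x) (at x)" "continuous_on UNIV (deriv \<phi>)"
proof -
  from assms obtain D K where D: "\<And>x. (\<phi> has_vector_derivative D x) (at x)" "continuous_on UNIV D"
    and K: "compact K" "\<And>x. x \<notin> K \<Longrightarrow> \<phi> x = 0"
    by (auto simp: test_function_def C1_differentiable_on_def)
  have d: "(\<phi> has_real_derivative D x) (at x)" for x
    using D(1)[of x] by (simp add: has_real_derivative_iff_has_vector_derivative)
  then have dD: "deriv \<phi> x = D x" for x by (rule DERIV_imp_deriv)
  then have dD': "deriv \<phi> = D" by auto
  obtain M where M: "\<And>x. x \<in> K \<Longrightarrow> \<bar>x\<bar> \<le> M"
    using compact_imp_bounded[OF K(1)] by (auto simp: bounded_iff)
  \<comment> \<open>The margin 1 puts the points with |x| = N inside the open set where \<phi>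
    vanishes, so the derivative vanishes there as well.\<close>
  define N where "N = \<bar>M\<bar> + 1"
  have z: "\<phi> x = 0" if "\<bar>x\<bar> > \<bar>M\<bar>" for x
    using K(2)[of x] M[of x] that by force
  have dz: "D x = 0" if "\<bar>x\<bar> > \<bar>M\<bar>" for x
  proof -
    have "((\<lambda>x. 0) has_real_derivative 0) (at x)" by simp
    moreover have "open {y. \<bar>y\<bar> > \<bar>M\<bar>}" by (intro open_Collect_less continuous_intros)
    ultimately have "(\<phi> has_real_derivative 0) (at x)"
      by (rule has_field_derivative_transform_within_open) (use that z in auto)
    then show ?thesis using d DERIV_unique by blast
  qed
  show ?thesis
  proof
    show "0 < N" by (simp add: N_def)
    show "\<phi> x = 0" if "\<bar>x\<bar> \<ge> N" for x using z that by (auto simp: N_def)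
    show "deriv \<phi> x = 0" if "\<bar>x\<bar> \<ge> N" for x using dz that by (auto simp: N_def dD)
    show "(\<phi> has_real_derivative deriv \<phi> x) (at x)" for x using d by (simp add: dD)
    show "continuous_on UNIV (deriv \<phi>)" using D(2) by (simp add: dD')
  qed
qed

lemma test_functionI:
  assumes "\<And>x. (\<phi> has_real_derivative \<phi>' x) (at x)" "continuous_on UNIV \<phi>'"
    "\<And>x. \<bar>x\<bar> \<ge> N \<Longrightarrow> \<phi> x = 0"
  shows "test_function \<phi>"
  unfolding test_function_def C1_differentiable_on_def
proof (intro conjI exI allI ballI impI)
  show "(\<phi> has_vector_derivative \<phi>' x) (at x)" for x
    using assms(1) by (simp add: has_real_derivative_iff_has_vector_derivative)
  show "compact {-N..N}" by simp
  show "\<phi> x = 0" if "x \<notin> {-N..N}" for x using that by (intro assms(3)) auto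
qed (rule assms(2))

lemma integral_cutoff:
  fixes g :: "real \<Rightarrow> complex"
  assumes "set_integrable lborel {-N..N} g" "\<And>x. \<bar>x\<bar> \<ge> N \<Longrightarrow> g x = 0"
  shows "integrable lborel g" "(LINT x|lborel. g x) = (LINT x:{-N..N}|lborel. g x)"
proof -
  have "(\<lambda>x. indicator {-N..N} x *\<^sub>R g x) = g"
    using assms(2) by (auto simp: indicator_def fun_eq_iff abs_le_iff not_le)
  then show "integrable lborel g" "(LINT x|lborel. g x) = (LINT x:{-N..N}|lborel. g x)"
    using assms(1) by (simp_all add: set_integrable_def set_lebesgue_integral_def)
qed

lemma abs_cont_test_function:
  assumes "test_function \<phi>"
  shows "abs_cont (\<lambda>x. of_real (\<phi> x)) (\<lambda>x. of_real (deriv \<phi> x))"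
proof (rule test_functionE[OF assms], rule abs_cont_C1)
  assume d: "\<And>x. (\<phi> has_real_derivative deriv \<phi> x) (at x)" and c: "continuous_on UNIV (deriv \<phi>)"
  show "((\<lambda>x. complex_of_real (\<phi> x)) has_vector_derivative of_real (deriv \<phi> x)) (at x)" for x
    by (rule has_vector_derivative_of_real[OF d])
  show "continuous_on UNIV (\<lambda>x. complex_of_real (deriv \<phi> x))"
    by (rule continuous_on_of_real[OF c])
qed

lemma test_function_integrable:
  assumes "test_function \<phi>" "loc_int v"
  shows "integrable lborel (\<lambda>x. of_real (\<phi> x) * v x)"
    "integrable lborel (\<lambda>x. of_real (deriv \<phi> x) * v x)"
proof -
  from test_functionE[OF assms(1)] obtain N where N: "\<And>x. \<bar>x\<bar> \<ge> N \<Longrightarrow> \<phi> x = 0"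
    "\<And>x. \<bar>x\<bar> \<ge> N \<Longrightarrow> deriv \<phi> x = 0" "continuous_on UNIV (deriv \<phi>)" by metis
  have c: "continuous_on UNIV (\<lambda>x. complex_of_real (\<phi> x))"
    "continuous_on UNIV (\<lambda>x. complex_of_real (deriv \<phi> x))"
    using abs_cont_continuous[OF abs_cont_test_function[OF assms(1)]] N(3)
    by (auto intro: continuous_intros)
  have "loc_int (\<lambda>x. of_real (\<phi> x) * v x)" "loc_int (\<lambda>x. of_real (deriv \<phi> x) * v x)"
    using loc_int_mult_continuous[OF assms(2)] c by auto
  then show "integrable lborel (\<lambda>x. of_real (\<phi> x) * v x)"
    "integrable lborel (\<lambda>x. of_real (deriv \<phi> x) * v x)"
    by (auto intro!: integral_cutoff(1)[of N] simp: loc_int_def N)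
qed

text \<open>The product \<phi> u vanishes at -N and N, so its derivative has integral zero.\<close>

lemma abs_cont_imp_weak_deriv:
  assumes "abs_cont u v" shows "has_weak_deriv u v"
  unfolding has_weak_deriv_def
proof (intro allI impI)
  fix \<phi> assume t: "test_function \<phi>"
  from test_functionE[OF t] obtain N where N: "N > 0" "\<And>x. \<bar>x\<bar> \<ge> N \<Longrightarrow> \<phi> x = 0"
    "\<And>x. \<bar>x\<bar> \<ge> N \<Longrightarrow> deriv \<phi> x = 0" by metis
  let ?g = "\<lambda>x. of_real (deriv \<phi> x) * u x + of_real (\<phi> x) * v x"
  have ac: "abs_cont (\<lambda>x. of_real (\<phi> x) * u x) ?g"
    by (rule abs_cont_mult[OF abs_cont_test_function[OF t] assms])
  have "(LINT x|lborel. ?g x) = (LINT x:{-N..N}|lborel. ?g x)"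
    using abs_cont_loc_int[OF ac] by (intro integral_cutoff) (auto simp: loc_int_def N)
  also have "\<dots> = 0" using abs_cont_diff[OF ac, of "-N" N] N by simp
  finally show "(LINT x|lborel. of_real (deriv \<phi> x) * u x) = - (LINT x|lborel. of_real (\<phi> x) * v x)"
    using test_function_integrable[OF t abs_cont_loc_int[OF assms]]
      test_function_integrable[OF t loc_int_continuous[OF abs_cont_continuous[OF assms]]]
    by (simp add: eq_neg_iff_add_eq_0)
qed

text \<open>Test functions are only required to be C^1, so squares of positive parts are regular
  enough to build bumps from.\<close>

lemma has_real_derivative_max_square:
  "((\<lambda>x::real. (max 0 x)\<^sup>2) has_real_derivative 2 * max 0 x) (at x)"
proof -
  consider "x > 0" | "x < 0" | "x = 0" by linarith
  then show ?thesis
  proof cases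
    case 1
    have "((\<lambda>x::real. x\<^sup>2) has_real_derivative 2 * max 0 x) (at x)"
      using DERIV_pow[of 2 x UNIV] 1 by (simp add: max_def)
    then show ?thesis
      by (rule has_field_derivative_transform_within_open[where S = "{0<..}"]) (use 1 in auto)
  next
    case 2
    have "((\<lambda>x::real. 0) has_real_derivative 2 * max 0 x) (at x)"
      using 2 by (simp add: max_def)
    then show ?thesis
      by (rule has_field_derivative_transform_within_open[where S = "{..<0}"]) (use 2 in auto)
  next
    case 3
    have "((\<lambda>y::real. (max 0 y)\<^sup>2 / y) \<longlongrightarrow> 0) (at 0)"
    proof (rule Lim_null_comparison)
      show "\<forall>\<^sub>F y in at 0. norm ((max 0 y)\<^sup>2 / y) \<le> \<bar>y\<bar>"
        by (intro always_eventually allI) (simp add: max_def power2_eq_square)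
      show "((\<lambda>y::real. \<bar>y\<bar>) \<longlongrightarrow> 0) (at 0)" by (rule tendsto_rabs_zero[OF tendsto_ident_at])
    qed
    then show ?thesis using 3 by (simp add: has_field_derivative_iff)
  qed
qed

text \<open>The function is (x - a)_+^2 (b - x)_+^2 / (b - a)^4. On the interval each square is at
  most (b - a)^2, so the denominator keeps the values in [0, 1], as the powers of 1 - \<phi> in
  \<open>weak_zero_integral\<close> require.\<close>

lemma bump_function:
  fixes a b :: real assumes ab: "a < b"
  obtains \<phi> where "test_function \<phi>" "\<And>x. 0 \<le> \<phi> x" "\<And>x. \<phi> x \<le> 1"
    "\<And>x. x \<in> {a<..<b} \<Longrightarrow> 0 < \<phi> x" "\<And>x. x \<notin> {a<..<b} \<Longrightarrow> \<phi> x = 0"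
proof
  define s where "s x = (max 0 x :: real)\<^sup>2" for x
  have s: "(s has_real_derivative 2 * max 0 x) (at x)" for x
    using has_real_derivative_max_square[of x] by (simp add: s_def[abs_def])
  let ?c = "(b - a)^4"
  let ?\<phi> = "\<lambda>x. s (x - a) * s (b - x) / ?c"
  have c: "?c > 0" using ab by simp
  show "test_function ?\<phi>"
  proof (rule test_functionI[where N = "max \<bar>a\<bar> \<bar>b\<bar>"])
    show "(?\<phi> has_real_derivative
      (2 * max 0 (x - a) * s (b - x) - 2 * max 0 (b - x) * s (x - a)) / ?c) (at x)" for x
    proof (rule DERIV_cdivide)
      show "((\<lambda>x. s (x - a) * s (b - x)) has_real_derivative
        2 * max 0 (x - a) * s (b - x) - 2 * max 0 (b - x) * s (x - a)) (at x)"
        by (auto intro!: derivative_eq_intros DERIV_chain2[OF s])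
    qed
    show "continuous_on UNIV
      (\<lambda>x. (2 * max 0 (x - a) * s (b - x) - 2 * max 0 (b - x) * s (x - a)) / ?c)"
      unfolding s_def using c by (intro continuous_intros) auto
    show "?\<phi> x = 0" if "\<bar>x\<bar> \<ge> max \<bar>a\<bar> \<bar>b\<bar>" for x
      using that ab by (auto simp: s_def max_def split: if_splits)
  qed
  show "0 \<le> ?\<phi> x" for x using c by (auto simp: s_def)
  show out: "?\<phi> x = 0" if "x \<notin> {a<..<b}" for x using that ab by (auto simp: s_def max_def)
  show "0 < ?\<phi> x" if "x \<in> {a<..<b}" for x using that c by (auto simp: s_def max_def)
  show "?\<phi> x \<le> 1" for x
  proof (cases "x \<in> {a<..<b}")
    case True
    have "s (x - a) * s (b - x) \<le> (b - a)\<^sup>2 * (b - a)\<^sup>2"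
      using True by (intro mult_mono) (auto simp: s_def max_def intro!: power_mono)
    also have "\<dots> = ?c" by (simp flip: power_add)
    finally show ?thesis using c by (simp add: divide_le_eq)
  next
    case False
    show ?thesis using out[OF False] by linarith
  qed
qed

text \<open>For a bump \<phi> on (a, b) the test functions 1 - (1 - \<phi>)^n tend pointwise to the
  indicator of (a, b) and are dominated by that of [a, b].\<close>

lemma weak_zero_integral:
  assumes h: "loc_int h" and z: "\<And>\<phi>. test_function \<phi> \<Longrightarrow> (LINT x|lborel. of_real (\<phi> x) * h x) = 0"
  shows "(LINT x:{a..b}|lborel. h x) = 0"
proof (cases "a < b")
  case False
  have "AE x in lborel. indicator {a..b} x *\<^sub>R h x = 0"
    using AE_lborel_singleton[of a] by eventually_elim (use False in \<open>auto simp: indicator_def\<close>)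
  then show ?thesis unfolding set_lebesgue_integral_def by (rule integral_eq_zero_AE)
next
  case ab: True
  from bump_function[OF ab] obtain \<phi> where p: "test_function \<phi>" "\<And>x. 0 \<le> \<phi> x" "\<And>x. \<phi> x \<le> 1"
    "\<And>x. x \<in> {a<..<b} \<Longrightarrow> 0 < \<phi> x" "\<And>x. x \<notin> {a<..<b} \<Longrightarrow> \<phi> x = 0" by metis
  from test_functionE[OF p(1)] obtain N where N: "\<And>x. \<bar>x\<bar> \<ge> N \<Longrightarrow> \<phi> x = 0"
    "\<And>x. (\<phi> has_real_derivative deriv \<phi> x) (at x)" "continuous_on UNIV (deriv \<phi>)" by metis
  have cphi: "continuous_on UNIV \<phi>"
    using N(2) by (meson DERIV_continuous continuous_at_imp_continuous_on)
  define pn where "pn n x = 1 - (1 - \<phi> x) ^ n" for n x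
  \<comment> \<open>With the index \<open>Suc n\<close> the chain rule leaves the exponent
    \<open>n\<close>, not a truncated difference.\<close>
  have tn: "test_function (pn (Suc n))" for n
  proof (rule test_functionI)
    show "(pn (Suc n) has_real_derivative real (Suc n) * (1 - \<phi> x) ^ n * deriv \<phi> x) (at x)" for x
      unfolding pn_def by (auto intro!: derivative_eq_intros N(2) simp del: power_Suc simp: mult_ac)
    show "continuous_on UNIV (\<lambda>x. real (Suc n) * (1 - \<phi> x) ^ n * deriv \<phi> x)"
      by (intro continuous_intros cphi N(3))
    show "pn (Suc n) x = 0" if "\<bar>x\<bar> \<ge> N" for x using N(1)[OF that] by (simp add: pn_def)
  qed
  have hm: "h \<in> borel_measurable borel" by (rule loc_int_measurable[OF h])
  have pm: "\<phi> \<in> borel_measurable borel" using cphi by (rule borel_measurable_continuous_onI)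
  have "(\<lambda>n. LINT x|lborel. of_real (pn (Suc n) x) * h x)
     \<longlonglongrightarrow> (LINT x|lborel. indicator {a<..<b} x *\<^sub>R h x)"
  proof (rule integral_dominated_convergence)
    show "(\<lambda>x. indicat_real {a<..<b} x *\<^sub>R h x) \<in> borel_measurable lborel" using hm by measurable
    show "(\<lambda>x. of_real (pn (Suc n) x) * h x) \<in> borel_measurable lborel" for n
      unfolding pn_def using hm pm by measurable
    have "set_integrable lborel {a..b} h" using h by (auto simp: loc_int_def)
    then show "integrable lborel (\<lambda>x. norm (indicator {a..b} x *\<^sub>R h x))"
      unfolding set_integrable_def by (rule integrable_norm)
    show "AE x in lborel. norm (of_real (pn (Suc n) x) * h x) \<le> norm (indicator {a..b} x *\<^sub>R h x)" for n
    proof (rule AE_I2)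
      fix x
      have "pn (Suc n) x \<in> {0..1}" using p(2,3)[of x] by (auto simp: pn_def power_le_one simp del: power_Suc)
      moreover have "pn (Suc n) x = 0" if "x \<notin> {a<..<b}" using p(5)[OF that] by (simp add: pn_def)
      ultimately show "norm (of_real (pn (Suc n) x) * h x) \<le> norm (indicator {a..b} x *\<^sub>R h x)"
        by (cases "x \<in> {a<..<b}") (auto simp: norm_mult intro: mult_left_le_one_le)
    qed
    show "AE x in lborel. (\<lambda>n. of_real (pn (Suc n) x) * h x) \<longlonglongrightarrow> indicator {a<..<b} x *\<^sub>R h x"
    proof (rule AE_I2)
      fix x
      have "(\<lambda>n. pn (Suc n) x) \<longlonglongrightarrow> indicator {a<..<b} x"
      proof (cases "x \<in> {a<..<b}")
        case True
        have "(\<lambda>n. 1 - (1 - \<phi> x) ^ Suc n) \<longlonglongrightarrow> 1 - 0"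
          using p(2,3)[of x] p(4)[OF True]
          by (intro tendsto_intros LIMSEQ_Suc[OF LIMSEQ_realpow_zero]) auto
        then show ?thesis using True by (simp add: pn_def)
      qed (use p(5)[of x] in \<open>simp add: pn_def\<close>)
      then have "(\<lambda>n. of_real (pn (Suc n) x) * h x) \<longlonglongrightarrow> of_real (indicator {a<..<b} x) * h x"
        by (intro tendsto_intros)
      then show "(\<lambda>n. of_real (pn (Suc n) x) * h x) \<longlonglongrightarrow> indicator {a<..<b} x *\<^sub>R h x"
        by (simp add: scaleR_conv_of_real)
    qed
  qed
  then have "(LINT x|lborel. indicator {a<..<b} x *\<^sub>R h x) = 0"
    using z[OF tn] LIMSEQ_unique[OF _ tendsto_const] by simp
  moreover have "(LINT x|lborel. indicator {a<..<b} x *\<^sub>R h x) = (LINT x:{a..b}|lborel. h x)"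
    unfolding set_lebesgue_integral_def
  proof (rule integral_cong_AE)
    show "AE x in lborel. indicat_real {a<..<b} x *\<^sub>R h x = indicat_real {a..b} x *\<^sub>R h x"
      using AE_lborel_singleton[of a] AE_lborel_singleton[of b]
      by eventually_elim (auto simp: indicator_def)
  qed (use hm in measurable)
  ultimately show ?thesis by simp
qed

text \<open>After truncation to [-n, n] the vanishing of the integrals passes from intervals to all
  Borel sets by a Dynkin system argument, and a density is determined by its integrals.\<close>

lemma zero_integrals_imp_AE_zero:
  assumes h: "loc_int h" and z: "\<And>a b. (LINT x:{a..b}|lborel. h x) = 0"
  shows "AE x in lborel. h x = 0"
proof -
  have "AE x in lborel. indicator {-real n..real n} x *\<^sub>R h x = 0" for n
  proof -
    let ?h = "\<lambda>x. indicator {-real n..real n} x *\<^sub>R h x"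
    have i: "integrable lborel ?h" using h by (auto simp: loc_int_def set_integrable_def)
    have Ih: "set_integrable lborel A ?h" if "A \<in> sets borel" for A
      using i that integrable_mult_indicator[of A lborel ?h] by (auto simp: set_integrable_def)
    have int0: "(LINT x:{a..b}|lborel. ?h x) = 0" for a b
    proof -
      have "(LINT x:{a..b}|lborel. ?h x) = (LINT x:{max a (-real n)..min b (real n)}|lborel. h x)"
        unfolding set_lebesgue_integral_def
        by (rule Bochner_Integration.integral_cong) (auto simp: indicator_def)
      then show ?thesis using z by simp
    qed
    have tot: "(LINT x|lborel. ?h x) = 0"
      using z[of "-real n" "real n"] by (simp add: set_lebesgue_integral_def)
    have all: "(LINT x:A|lborel. ?h x) = 0" if A: "A \<in> sigma_sets UNIV (range (\<lambda>(a,b). {a..b::real}))" for A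
    proof (rule sigma_sets_induct_disjoint[OF _ _ A])
      have bs: "sigma_sets UNIV (range (\<lambda>(a,b). {a..b::real})) = sets borel"
        by (subst borel_eq_atLeastAtMost) (simp add: sets_measure_of)
      show "Int_stable (range (\<lambda>(a,b). {a..b::real}))"
        by (auto simp: Int_stable_def)
      show "(LINT x:B|lborel. ?h x) = 0" if "B \<in> range (\<lambda>(a,b). {a..b::real})" for B
        using that int0 by auto
      show "(LINT x:UNIV - B|lborel. ?h x) = 0"
        if B: "B \<in> sigma_sets UNIV (range (\<lambda>(a,b). {a..b::real}))" and "(LINT x:B|lborel. ?h x) = 0" for B
      proof -
        have "(LINT x:B \<union> (UNIV - B)|lborel. ?h x) = (LINT x:B|lborel. ?h x) + (LINT x:UNIV - B|lborel. ?h x)"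
          using B by (intro set_integral_Un Ih) (auto simp: bs)
        moreover have "(LINT x:B \<union> (UNIV - B)|lborel. ?h x) = 0"
          using tot by (simp add: set_lebesgue_integral_def)
        ultimately show ?thesis using that by simp
      qed
      show "(LINT x:(\<Union>i. B i)|lborel. ?h x) = 0"
        if "disjoint_family B" "range B \<subseteq> sigma_sets UNIV (range (\<lambda>(a,b). {a..b::real}))"
          "\<And>i. (LINT x:B i|lborel. ?h x) = 0" for B :: "nat \<Rightarrow> real set"
      proof -
        have m: "B i \<in> sets lborel" for i using that(2) by (auto simp: bs)
        have "(LINT x:(\<Union>i. B i)|lborel. ?h x) = (\<Sum>i. (LINT x:B i|lborel. ?h x))"
          using that(1) m by (intro lebesgue_integral_countable_add Ih)
            (auto simp: disjoint_family_on_def)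
        then show ?thesis using that(3) by simp
      qed
    qed (auto simp: set_lebesgue_integral_def)
    have "sets borel = sigma_sets UNIV (range (\<lambda>(a,b). {a..b::real}))"
      by (subst borel_eq_atLeastAtMost) (simp add: sets_measure_of)
    then have "AE x in lborel. ?h x = (\<lambda>x. 0) x"
      by (intro sigma_finite_measure.density_unique_banach[OF sigma_finite_lborel i]) (auto simp: all set_lebesgue_integral_def[of _ _ "\<lambda>x. 0"])
    then show ?thesis by simp
  qed
  then have "AE x in lborel. \<forall>n. indicator {-real n..real n} x *\<^sub>R h x = 0"
    unfolding AE_all_countable by blast
  then show ?thesis
  proof eventually_elim
    fix x assume a: "\<forall>n. indicator {-real n..real n} x *\<^sub>R h x = 0"
    obtain n where "\<bar>x\<bar> \<le> real n" using real_arch_simple by blast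
    then show "h x = 0" using a[rule_format, of n] by (auto simp: abs_le_iff)
  qed
qed

lemma weak_zero_AE:
  assumes "loc_int h" "\<And>\<phi>. test_function \<phi> \<Longrightarrow> (LINT x|lborel. of_real (\<phi> x) * h x) = 0"
  shows "AE x in lborel. h x = 0"
  using assms by (intro zero_integrals_imp_AE_zero weak_zero_integral)

lemma weak_deriv_unique:
  assumes "has_weak_deriv u v" "has_weak_deriv u v'" "loc_int v" "loc_int v'"
  shows "AE x in lborel. v x = v' x"
proof -
  have l: "loc_int (\<lambda>x. v x - v' x)"
    using loc_int_add[OF assms(3) loc_int_cmult[OF assms(4), of "-1"]] by simp
  have "AE x in lborel. v x - v' x = 0"
  proof (rule weak_zero_AE[OF l])
    fix \<phi> assume t: "test_function \<phi>"
    have "(LINT x|lborel. of_real (\<phi> x) * v x) = (LINT x|lborel. of_real (\<phi> x) * v' x)"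
    proof -
      have "(LINT x|lborel. of_real (deriv \<phi> x) * u x) = - (LINT x|lborel. of_real (\<phi> x) * v x)"
        "(LINT x|lborel. of_real (deriv \<phi> x) * u x) = - (LINT x|lborel. of_real (\<phi> x) * v' x)"
        using assms(1,2) t by (auto simp: has_weak_deriv_def)
      then show ?thesis by (simp only: neg_equal_iff_equal)
    qed
    then show "(LINT x|lborel. of_real (\<phi> x) * (v x - v' x)) = 0"
      using test_function_integrable[OF t assms(3)] test_function_integrable[OF t assms(4)]
      by (simp add: right_diff_distrib)
  qed
  then show ?thesis by simp
qed

text \<open>The lemma of du Bois-Reymond. Subtracting from a test function \<open>h\<close> a
  multiple of a fixed bump \<open>w\<close> leaves a function of mean zero, which is the derivative
  of a test function. The constant is the average of \<open>u\<close> with weight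
  \<open>w\<close>.\<close>

lemma weak_deriv_zero_const:
  assumes u: "loc_int u"
    and z: "\<And>\<phi>. test_function \<phi> \<Longrightarrow> (LINT x|lborel. of_real (deriv \<phi> x) * u x) = 0"
  obtains c where "AE x in lborel. u x = c"
proof -
  have l1: "loc_int (\<lambda>x. 1)" by (intro loc_int_continuous) auto
  obtain w where b: "test_function w" "\<And>x. 0 \<le> w x" "\<And>x. x \<in> {0<..<1} \<Longrightarrow> 0 < w x"
    using bump_function[of 0 1] by (metis zero_less_one)
  have bi: "integrable lborel (\<lambda>x. complex_of_real (w x))"
    using test_function_integrable(1)[OF b(1) l1] by simp
  define m where "m = (LINT x|lborel. complex_of_real (w x))"
  have m: "m \<noteq> 0"
  proof
    assume "m = 0"
    then have "(LINT x|lborel. w x) = 0" by (simp add: m_def)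
    moreover have "integrable lborel w" using integrable_Re[OF bi] by simp
    ultimately have "AE x in lborel. w x = 0"
      using integral_nonneg_eq_0_iff_AE[of lborel w] b(2) by simp
    then have "AE x in lborel. x \<notin> {0<..<1::real}" by eventually_elim (use b(3) in fastforce)
    then have "emeasure lborel {0<..<1::real} = 0" by (subst (asm) AE_iff_measurable[of "{0<..<1}"]) auto
    then show False by simp
  qed
  define c where "c = (LINT x|lborel. of_real (w x) * u x) / m"
  have l: "loc_int (\<lambda>x. u x - c)"
    using loc_int_add[OF u loc_int_cmult[OF l1, of "-c"]] by simp
  have "AE x in lborel. u x - c = 0"
  proof (rule weak_zero_AE[OF l])
    fix h assume t: "test_function h"
    have ti: "integrable lborel (\<lambda>x. complex_of_real (h x))"
      using test_function_integrable(1)[OF t l1] by simp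
    define M where "M = (LINT x|lborel. complex_of_real (h x))"
    have rM: "M = of_real (LINT x|lborel. h x)" "m = of_real (LINT x|lborel. w x)"
      unfolding M_def m_def by simp_all
    \<comment> \<open>Test functions are real, so the multiple has to be a quotient of real
      integrals; the fact \<open>q\<close> restates it for the complex integrals.\<close>
    define q where "q = (LINT x|lborel. h x) / (LINT x|lborel. w x)"
    have q: "M = of_real q * m" using m by (simp add: q_def rM)
    define g where "g x = h x - q * w x" for x
    obtain N1 where N1: "\<And>x. \<bar>x\<bar> \<ge> N1 \<Longrightarrow> h x = 0" "\<And>x. (h has_real_derivative deriv h x) (at x)"
      using test_functionE[OF t] by metis
    obtain N2 where N2: "N2 > 0" "\<And>x. \<bar>x\<bar> \<ge> N2 \<Longrightarrow> w x = 0" "\<And>x. (w has_real_derivative deriv w x) (at x)"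
      using test_functionE[OF b(1)] by metis
    define N where "N = max N1 N2"
    have zN: "g x = 0" if "\<bar>x\<bar> \<ge> N" for x using N1(1)[of x] N2(2)[of x] that by (auto simp: N_def g_def)
    have Npos: "N > 0" using N2(1) by (auto simp: N_def)
    have zc: "continuous_on UNIV g"
      unfolding g_def using N1(2) N2(3)
      by (intro continuous_intros) (meson DERIV_continuous continuous_at_imp_continuous_on)+
    then have zcc: "continuous_on UNIV (\<lambda>x. complex_of_real (g x))" by (intro continuous_intros)
    obtain F where F: "abs_cont F (\<lambda>x. complex_of_real (g x))"
      using abs_cont_exists[OF loc_int_continuous[OF zcc]] by metis
    \<comment> \<open>Subtracting the value at -N makes \<open>G\<close> vanish to the left; the
      zero mean of \<open>g\<close> makes it vanish beyond N too, so \<open>G\<close> has compact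
      support.\<close>
    define G where "G x = Re (F x) - Re (F (-N))" for x
    have dPhi: "(G has_real_derivative g x) (at x)" for x
    proof -
      have "(F has_vector_derivative complex_of_real (g x)) (at x)"
        by (rule abs_cont_has_vector_derivative[OF F]) (use zcc in \<open>simp add: continuous_on_eq_continuous_at\<close>)
      from bounded_linear.has_vector_derivative[OF bounded_linear_Re this]
      have "((\<lambda>x. Re (F x)) has_real_derivative g x) (at x)"
        by (simp add: has_real_derivative_iff_has_vector_derivative)
      from DERIV_diff[OF this DERIV_const] show ?thesis unfolding G_def by simp
    qed
    have zi: "(LINT x|lborel. complex_of_real (g x)) = 0"
      using ti bi q by (simp add: g_def M_def m_def)
    have FN: "F x = F (-N)" if "\<bar>x\<bar> \<ge> N" for x
    proof (cases "x \<le> -N")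
      case True
      have "F (-N) - F x = (LINT y:{x..-N}|lborel. complex_of_real (g y))"
        by (rule abs_cont_diff[OF F True])
      also have "\<dots> = (LINT y:{x..-N}|lborel. 0)"
        by (rule set_lebesgue_integral_cong) (use zN Npos in auto)
      finally show ?thesis by (simp add: set_lebesgue_integral_def)
    next
      case False
      then have xN: "N \<le> x" using that by auto
      have "F x - F (-N) = (LINT y:{-N..x}|lborel. complex_of_real (g y))"
        by (rule abs_cont_diff[OF F]) (use xN Npos in auto)
      also have "\<dots> = (LINT y|lborel. complex_of_real (g y))"
        unfolding set_lebesgue_integral_def
        by (rule Bochner_Integration.integral_cong) (use zN xN in \<open>auto simp: indicator_def\<close>)
      finally show ?thesis using zi by simp
    qed
    have "G x = 0" if "\<bar>x\<bar> \<ge> N" for x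
      unfolding G_def by (subst FN[OF that]) simp
    then have tG: "test_function G" by (rule test_functionI[OF dPhi zc])
    have "deriv G = g" using dPhi by (auto intro: DERIV_imp_deriv)
    then have "0 = (LINT x|lborel. of_real (g x) * u x)" using z[OF tG] by simp
    also have "\<dots> = (LINT x|lborel. of_real (h x) * u x - of_real q * (of_real (w x) * u x))"
      by (simp add: g_def algebra_simps)
    also have "\<dots> = (LINT x|lborel. of_real (h x) * u x) - of_real q * (LINT x|lborel. of_real (w x) * u x)"
      using test_function_integrable(1)[OF t u] test_function_integrable(1)[OF b(1) u] by simp
    also have "\<dots> = (LINT x|lborel. of_real (h x) * u x) - M * c"
      using m by (simp add: c_def q)
    finally show "(LINT x|lborel. of_real (h x) * (u x - c)) = 0"
      using test_function_integrable(1)[OF t u] ti by (simp add: right_diff_distrib M_def)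
  qed
  then show ?thesis using that[of c] by simp
qed

text \<open>\<open>u\<close> and a primitive of \<open>v\<close> have the same weak derivative, so
  they differ by a constant almost everywhere.\<close>

lemma has_weak_deriv_imp_abs_cont:
  assumes "has_weak_deriv u v" "loc_int u" "loc_int v"
  obtains U where "abs_cont U v" "AE x in lborel. u x = U x"
proof -
  obtain V where V: "abs_cont V v" using abs_cont_exists[OF assms(3)] .
  have lV: "loc_int V" by (rule loc_int_continuous[OF abs_cont_continuous[OF V]])
  have l: "loc_int (\<lambda>x. u x - V x)"
    using loc_int_add[OF assms(2) loc_int_cmult[OF lV, of "-1"]] by simp
  obtain c where c: "AE x in lborel. u x - V x = c"
  proof (rule weak_deriv_zero_const[OF l])
    fix \<phi> assume t: "test_function \<phi>"
    have "(LINT x|lborel. of_real (deriv \<phi> x) * u x) = (LINT x|lborel. of_real (deriv \<phi> x) * V x)"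
      using assms(1) abs_cont_imp_weak_deriv[OF V] t by (simp add: has_weak_deriv_def)
    then show "(LINT x|lborel. of_real (deriv \<phi> x) * (u x - V x)) = 0"
      using test_function_integrable(2)[OF t assms(2)] test_function_integrable(2)[OF t lV]
      by (simp add: right_diff_distrib)
  qed
  show ?thesis
  proof
    show "abs_cont (\<lambda>x. V x + c) v" using abs_cont_add[OF V abs_cont_const] by simp
    show "AE x in lborel. u x = V x + c" using c by eventually_elim (simp add: algebra_simps)
  qed
qed

lemma has_weak_deriv_cong_AE:
  assumes "has_weak_deriv u v" "AE x in lborel. u x = u' x" "AE x in lborel. v x = v' x"
    "u \<in> borel_measurable borel" "u' \<in> borel_measurable borel"
    "v \<in> borel_measurable borel" "v' \<in> borel_measurable borel"
  shows "has_weak_deriv u' v'"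
  unfolding has_weak_deriv_def
proof (intro allI impI)
  fix \<phi> assume t: "test_function \<phi>"
  from test_functionE[OF t] obtain "continuous_on UNIV (deriv \<phi>)" "continuous_on UNIV \<phi>"
    by (meson DERIV_continuous continuous_at_imp_continuous_on)
  then have [measurable]: "\<phi> \<in> borel_measurable borel" "deriv \<phi> \<in> borel_measurable borel"
    by (auto intro: borel_measurable_continuous_onI)
  note [measurable] = assms(4-7)
  have "(LINT x|lborel. of_real (deriv \<phi> x) * u' x) = (LINT x|lborel. of_real (deriv \<phi> x) * u x)"
    by (rule integral_cong_AE) (use assms(2) in auto)
  moreover have "(LINT x|lborel. of_real (\<phi> x) * v' x) = (LINT x|lborel. of_real (\<phi> x) * v x)"
    by (rule integral_cong_AE) (use assms(3) in auto)
  ultimately show "(LINT x|lborel. of_real (deriv \<phi> x) * u' x) = - (LINT x|lborel. of_real (\<phi> x) * v' x)"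
    using assms(1) t by (simp add: has_weak_deriv_def)
qed

section \<open>Solutions in a layered medium and the reflection coefficient\<close>

text \<open>In this form the coefficient is never differentiated: its jumps are harmless, and
  continuity of the flux is built in.\<close>

definition transport ::
    "(real \<Rightarrow> real) \<Rightarrow> complex \<Rightarrow> (real \<Rightarrow> complex) \<Rightarrow> (real \<Rightarrow> complex) \<Rightarrow> bool" where
  "transport a \<mu> p q \<longleftrightarrow>
     abs_cont p (\<lambda>x. \<i> * \<mu> * q x / of_real (a x)) \<and> abs_cont q (\<lambda>x. \<i> * \<mu> * p x)"

lemma transport_lincomb:
  assumes "transport a \<mu> p q" "transport a \<mu> p' q'"
  shows "transport a \<mu> (\<lambda>x. c * p x + d * p' x) (\<lambda>x. c * q x + d * q' x)"
proof -
  have "abs_cont (\<lambda>x. c * p x + d * p' x)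
      (\<lambda>x. c * (\<i> * \<mu> * q x / of_real (a x)) + d * (\<i> * \<mu> * q' x / of_real (a x)))"
    using assms unfolding transport_def by (intro abs_cont_add abs_cont_cmult) auto
  moreover have "abs_cont (\<lambda>x. c * q x + d * q' x) (\<lambda>x. c * (\<i> * \<mu> * p x) + d * (\<i> * \<mu> * p' x))"
    using assms unfolding transport_def by (intro abs_cont_add abs_cont_cmult) auto
  ultimately show ?thesis unfolding transport_def
    by (simp add: distrib_left add_divide_distrib mult_ac)
qed

text \<open>The bracket is the usual Wronskian divided by i \<mu>. Its derivative cancels
  identically, whatever the jumps of \<open>a\<close>.\<close>

lemma transport_wronskian:
  assumes "transport a \<mu> p q" "transport a \<mu> p' q'"
  shows "p x * q' x - p' x * q x = p y * q' y - p' y * q y"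
proof -
  let ?W = "\<lambda>x. p x * q' x - p' x * q x"
  have "abs_cont ?W (\<lambda>x. (\<i> * \<mu> * q x / of_real (a x) * q' x + p x * (\<i> * \<mu> * p' x))
       - (\<i> * \<mu> * q' x / of_real (a x) * q x + p' x * (\<i> * \<mu> * p x)))"
    using assms unfolding transport_def by (intro abs_cont_sub abs_cont_mult) auto
  moreover have "(\<lambda>x. (\<i> * \<mu> * q x / of_real (a x) * q' x + p x * (\<i> * \<mu> * p' x))
       - (\<i> * \<mu> * q' x / of_real (a x) * q x + p' x * (\<i> * \<mu> * p x))) = (\<lambda>x. 0)"
    by (simp add: fun_eq_iff mult_ac)
  ultimately have "abs_cont ?W (\<lambda>x. 0)" by simp
  then show ?thesis by (rule abs_cont_zero_const)
qed

text \<open>The flow of the system from position \<open>c\<close> in a layer with a = 1/b^2. There p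
  + b q and p - b q decouple: they are multiplied by exp(i \<mu> b (x - c)) and exp(-i \<mu> b (x -
  c)), and the formula recovers p and q from them.\<close>

definition evolve ::
    "real \<Rightarrow> real \<Rightarrow> complex \<Rightarrow> complex \<times> complex \<Rightarrow> real \<Rightarrow> complex \<times> complex" where
  "evolve b c \<mu> v x =
     (let e = exp (\<i> * \<mu> * of_real (b * (x - c)));
          e' = exp (- \<i> * \<mu> * of_real (b * (x - c)));
          s = fst v + of_real b * snd v; d = fst v - of_real b * snd v
      in ((e * s + e' * d) / 2, (e * s - e' * d) / (2 * of_real b)))"

lemma evolve_self: "b \<noteq> 0 \<Longrightarrow> evolve b c \<mu> v c = v"
  by (cases v) (simp add: evolve_def Let_def field_simps)

lemma evolve_plus:
  "b \<noteq> 0 \<Longrightarrow> fst (evolve b c \<mu> v x) + of_real b * snd (evolve b c \<mu> v x)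
     = exp (\<i> * \<mu> * of_real (b * (x - c))) * (fst v + of_real b * snd v)"
  by (simp add: evolve_def Let_def field_simps)

lemma evolve_minus:
  "b \<noteq> 0 \<Longrightarrow> fst (evolve b c \<mu> v x) - of_real b * snd (evolve b c \<mu> v x)
     = exp (- \<i> * \<mu> * of_real (b * (x - c))) * (fst v - of_real b * snd v)"
  by (simp add: evolve_def Let_def field_simps)

lemma has_vector_derivative_exp_of_real:
  fixes z :: complex
  shows "((\<lambda>x. exp (z * of_real (b * (x - c)))) has_vector_derivative
     z * of_real b * exp (z * of_real (b * (x - c)))) (at x)"
proof -
  have f: "((\<lambda>w. exp (z * (of_real b * (w - of_real c)))) has_field_derivative
     exp (z * (of_real b * (of_real x - of_real c))) * (z * of_real b)) (at (of_real x))"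
    by (auto intro!: derivative_eq_intros)
  have o: "(complex_of_real has_vector_derivative 1) (at x)"
    using has_vector_derivative_of_real[OF DERIV_ident] by simp
  from field_vector_diff_chain_at[OF o f] show ?thesis
    by (simp add: o_def mult_ac)
qed

lemma evolve_abs_cont:
  assumes "b \<noteq> 0"
  shows "abs_cont (\<lambda>x. fst (evolve b c \<mu> v x)) (\<lambda>x. \<i> * \<mu> * snd (evolve b c \<mu> v x) * of_real (b\<^sup>2))"
    "abs_cont (\<lambda>x. snd (evolve b c \<mu> v x)) (\<lambda>x. \<i> * \<mu> * fst (evolve b c \<mu> v x))"
proof -
  define s d where "s = fst v + of_real b * snd v" and "d = fst v - of_real b * snd v"
  define e e' where "e x = exp (\<i> * \<mu> * of_real (b * (x - c)))"
    and "e' x = exp (- \<i> * \<mu> * of_real (b * (x - c)))" for x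
  have E: "abs_cont (\<lambda>x. exp (z * of_real (b * (x - c)))) (\<lambda>x. z * of_real b * exp (z * of_real (b * (x - c))))"
    for z :: complex
    by (rule abs_cont_C1[OF has_vector_derivative_exp_of_real]) (intro continuous_intros)
  have e: "abs_cont e (\<lambda>x. \<i> * \<mu> * of_real b * e x)" "abs_cont e' (\<lambda>x. - \<i> * \<mu> * of_real b * e' x)"
    unfolding e_def[abs_def] e'_def[abs_def] by (rule E)+
  have F: "fst (evolve b c \<mu> v x) = (e x * s + e' x * d) / 2"
    and S: "snd (evolve b c \<mu> v x) = (e x * s - e' x * d) / (2 * of_real b)" for x
    by (simp_all add: evolve_def Let_def e_def e'_def s_def d_def)
  have "abs_cont (\<lambda>x. s / 2 * e x + d / 2 * e' x)
    (\<lambda>x. s / 2 * (\<i> * \<mu> * of_real b * e x) + d / 2 * (- \<i> * \<mu> * of_real b * e' x))"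
    by (intro abs_cont_add abs_cont_cmult e)
  moreover have "(\<lambda>x. s / 2 * e x + d / 2 * e' x) = (\<lambda>x. fst (evolve b c \<mu> v x))"
    by (intro ext) (simp add: F field_simps)
  moreover have "(\<lambda>x. s / 2 * (\<i> * \<mu> * of_real b * e x) + d / 2 * (- \<i> * \<mu> * of_real b * e' x))
      = (\<lambda>x. \<i> * \<mu> * snd (evolve b c \<mu> v x) * of_real (b\<^sup>2))"
    using assms by (intro ext) (simp add: S field_simps power2_eq_square)
  ultimately show "abs_cont (\<lambda>x. fst (evolve b c \<mu> v x)) (\<lambda>x. \<i> * \<mu> * snd (evolve b c \<mu> v x) * of_real (b\<^sup>2))"
    by simp
  have "abs_cont (\<lambda>x. s / (2 * of_real b) * e x + (- d / (2 * of_real b)) * e' x)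
    (\<lambda>x. s / (2 * of_real b) * (\<i> * \<mu> * of_real b * e x)
      + (- d / (2 * of_real b)) * (- \<i> * \<mu> * of_real b * e' x))"
    by (intro abs_cont_add abs_cont_cmult e)
  moreover have "(\<lambda>x. s / (2 * of_real b) * e x + (- d / (2 * of_real b)) * e' x)
      = (\<lambda>x. snd (evolve b c \<mu> v x))"
    using assms by (intro ext) (simp add: S field_simps)
  moreover have "(\<lambda>x. s / (2 * of_real b) * (\<i> * \<mu> * of_real b * e x)
      + (- d / (2 * of_real b)) * (- \<i> * \<mu> * of_real b * e' x)) = (\<lambda>x. \<i> * \<mu> * fst (evolve b c \<mu> v x))"
    using assms by (intro ext) (simp add: F field_simps)
  ultimately show "abs_cont (\<lambda>x. snd (evolve b c \<mu> v x)) (\<lambda>x. \<i> * \<mu> * fst (evolve b c \<mu> v x))"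
    by simp
qed

lemma evolve_holomorphic:
  assumes "b \<noteq> 0" "(\<lambda>\<mu>. fst (v \<mu>)) holomorphic_on A" "(\<lambda>\<mu>. snd (v \<mu>)) holomorphic_on A"
  shows "(\<lambda>\<mu>. fst (evolve b c \<mu> (v \<mu>) x)) holomorphic_on A"
    "(\<lambda>\<mu>. snd (evolve b c \<mu> (v \<mu>) x)) holomorphic_on A"
  using assms unfolding evolve_def Let_def fst_conv snd_conv by (auto intro!: holomorphic_intros)

section \<open>Bounds uniform on bounded sets of frequencies and positions\<close>

text \<open>Uniformity in both variables at once is what later bounds the windowed resolvent kernels
  by a single constant near a given frequency.\<close>

definition loc_bounded :: "(complex \<Rightarrow> real \<Rightarrow> complex) \<Rightarrow> bool" where
  "loc_bounded f \<longleftrightarrow> (\<forall>M N. \<exists>C. \<forall>\<mu> x. cmod \<mu> \<le> M \<longrightarrow> \<bar>x\<bar> \<le> N \<longrightarrow> cmod (f \<mu> x) \<le> C)"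

lemma loc_boundedI:
  assumes "loc_bounded f" "loc_bounded g"
    and "\<And>C D \<mu> x. cmod (f \<mu> x) \<le> C \<Longrightarrow> cmod (g \<mu> x) \<le> D \<Longrightarrow> cmod (h \<mu> x) \<le> H C D"
  shows "loc_bounded h"
  unfolding loc_bounded_def
proof (intro allI)
  fix M N
  obtain C D where "\<And>\<mu> x. cmod \<mu> \<le> M \<Longrightarrow> \<bar>x\<bar> \<le> N \<Longrightarrow> cmod (f \<mu> x) \<le> C"
    "\<And>\<mu> x. cmod \<mu> \<le> M \<Longrightarrow> \<bar>x\<bar> \<le> N \<Longrightarrow> cmod (g \<mu> x) \<le> D"
    using assms(1,2) unfolding loc_bounded_def by meson
  then show "\<exists>C. \<forall>\<mu> x. cmod \<mu> \<le> M \<longrightarrow> \<bar>x\<bar> \<le> N \<longrightarrow> cmod (h \<mu> x) \<le> C"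
    by (intro exI[of _ "H C D"] allI impI assms(3))
qed

lemma loc_bounded_add:
  "loc_bounded f \<Longrightarrow> loc_bounded g \<Longrightarrow> loc_bounded (\<lambda>\<mu> x. f \<mu> x + g \<mu> x)"
  by (rule loc_boundedI[where f = f and g = g and H = "(+)"]) (auto intro: norm_triangle_mono)

lemma loc_bounded_mult:
  "loc_bounded f \<Longrightarrow> loc_bounded g \<Longrightarrow> loc_bounded (\<lambda>\<mu> x. f \<mu> x * g \<mu> x)"
  by (rule loc_boundedI[where f = f and g = g and H = "(*)"]) (auto simp: norm_mult intro: mult_mono')

lemma loc_bounded_holomorphic:
  assumes "f holomorphic_on UNIV" shows "loc_bounded (\<lambda>\<mu> x. f \<mu>)"
  unfolding loc_bounded_def
proof (intro allI)
  fix M N :: real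
  have "continuous_on (cball 0 M) f"
    using assms by (meson holomorphic_on_imp_continuous_on continuous_on_subset subset_UNIV)
  then have "bounded (f ` cball 0 M)"
    by (intro compact_imp_bounded compact_continuous_image compact_cball)
  then show "\<exists>C. \<forall>\<mu> x::real. cmod \<mu> \<le> M \<longrightarrow> \<bar>x\<bar> \<le> N \<longrightarrow> cmod (f \<mu>) \<le> C"
    unfolding bounded_iff by (metis imageI mem_cball_0)
qed

lemma loc_bounded_exp: "loc_bounded (\<lambda>\<mu> x. exp (z * \<mu> * of_real (b * (x - c))))"
  unfolding loc_bounded_def
proof (intro allI)
  fix M N :: real
  show "\<exists>C. \<forall>\<mu> x. cmod \<mu> \<le> M \<longrightarrow> \<bar>x\<bar> \<le> N \<longrightarrow> cmod (exp (z * \<mu> * of_real (b * (x - c)))) \<le> C"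
  proof (intro exI[of _ "exp (cmod z * M * (\<bar>b\<bar> * (N + \<bar>c\<bar>)))"] allI impI)
    fix \<mu> :: complex and x :: real assume h: "cmod \<mu> \<le> M" "\<bar>x\<bar> \<le> N"
    have "cmod (exp (z * \<mu> * of_real (b * (x - c)))) \<le> exp (cmod (z * \<mu> * of_real (b * (x - c))))"
      by (rule norm_exp)
    also have "\<dots> = exp (cmod z * cmod \<mu> * (\<bar>b\<bar> * \<bar>x - c\<bar>))"
      by (simp add: norm_mult abs_mult del: of_real_mult of_real_diff)
    also have "\<dots> \<le> exp (cmod z * M * (\<bar>b\<bar> * (N + \<bar>c\<bar>)))"
      using h order_trans[OF norm_ge_zero h(1)] order_trans[OF abs_ge_zero h(2)]
      by (intro iffD2[OF exp_le_cancel_iff] mult_mono) auto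
    finally show "cmod (exp (z * \<mu> * of_real (b * (x - c)))) \<le> exp (cmod z * M * (\<bar>b\<bar> * (N + \<bar>c\<bar>)))" .
  qed
qed

lemma loc_bounded_lincomb:
  assumes "\<alpha> holomorphic_on UNIV" "\<beta> holomorphic_on UNIV" "loc_bounded f" "loc_bounded g"
  shows "loc_bounded (\<lambda>\<mu> x. \<alpha> \<mu> * f \<mu> x + \<beta> \<mu> * g \<mu> x)"
  by (intro loc_bounded_add loc_bounded_mult loc_bounded_holomorphic assms)

lemma loc_bounded_evolve:
  assumes "b \<noteq> 0" "(\<lambda>\<mu>. fst (v \<mu>)) holomorphic_on UNIV" "(\<lambda>\<mu>. snd (v \<mu>)) holomorphic_on UNIV"
  shows "loc_bounded (\<lambda>\<mu> x. fst (evolve b c \<mu> (v \<mu>) x))"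
    "loc_bounded (\<lambda>\<mu> x. snd (evolve b c \<mu> (v \<mu>) x))"
proof -
  define e e' where "e \<mu> x = exp (\<i> * \<mu> * of_real (b * (x - c)))"
    and "e' \<mu> x = exp (- \<i> * \<mu> * of_real (b * (x - c)))" for \<mu> :: complex and x :: real
  define s d where "s \<mu> = fst (v \<mu>) + of_real b * snd (v \<mu>)"
    and "d \<mu> = fst (v \<mu>) - of_real b * snd (v \<mu>)" for \<mu>
  have h: "s holomorphic_on UNIV" "d holomorphic_on UNIV"
    unfolding s_def[abs_def] d_def[abs_def] by (intro holomorphic_intros assms)+
  have e: "loc_bounded e" "loc_bounded e'"
    unfolding e_def[abs_def] e'_def[abs_def] by (rule loc_bounded_exp)+
  have m: "loc_bounded (\<lambda>\<mu> x. e \<mu> x * s \<mu>)" "loc_bounded (\<lambda>\<mu> x. e' \<mu> x * d \<mu>)"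
    by (intro loc_bounded_mult loc_bounded_holomorphic h e)+
  have "loc_bounded (\<lambda>\<mu> x. 1 / 2 * (e \<mu> x * s \<mu>) + 1 / 2 * (e' \<mu> x * d \<mu>))"
    by (intro loc_bounded_lincomb m holomorphic_intros)
  moreover have "1 / 2 * (e \<mu> x * s \<mu>) + 1 / 2 * (e' \<mu> x * d \<mu>) = fst (evolve b c \<mu> (v \<mu>) x)" for \<mu> x
    unfolding evolve_def Let_def fst_conv e_def s_def e'_def d_def by (simp add: add_divide_distrib)
  ultimately show "loc_bounded (\<lambda>\<mu> x. fst (evolve b c \<mu> (v \<mu>) x))" by simp
  have "loc_bounded (\<lambda>\<mu> x. 1 / (2 * of_real b) * (e \<mu> x * s \<mu>) + (- 1 / (2 * of_real b)) * (e' \<mu> x * d \<mu>))"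
    using assms(1) by (intro loc_bounded_lincomb m holomorphic_intros) auto
  moreover have "1 / (2 * of_real b) * (e \<mu> x * s \<mu>) + (- 1 / (2 * of_real b)) * (e' \<mu> x * d \<mu>)
      = snd (evolve b c \<mu> (v \<mu>) x)" for \<mu> x
  proof -
    have "snd (evolve b c \<mu> (v \<mu>) x) = (e \<mu> x * s \<mu> - e' \<mu> x * d \<mu>) / (2 * of_real b)"
      unfolding evolve_def Let_def snd_conv e_def s_def e'_def d_def ..
    then show ?thesis by (simp only: diff_divide_distrib) simp
  qed
  ultimately show "loc_bounded (\<lambda>\<mu> x. snd (evolve b c \<mu> (v \<mu>) x))" by simp
qed

lemma loc_bounded_if:
  "loc_bounded f \<Longrightarrow> loc_bounded g \<Longrightarrow> loc_bounded (\<lambda>\<mu> x. if x < c then f \<mu> x else g \<mu> x)"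
  by (rule loc_boundedI[where f = f and g = g and H = max]) (auto simp: le_max_iff_disj)

lemma isCont_if_less:
  fixes c x :: real
  assumes "x \<noteq> c" "isCont f x" "isCont g x"
  shows "isCont (\<lambda>y. if y < c then f y else g y) x"
proof -
  let ?h = "if x < c then f else g" and ?S = "if x < c then {..<c} else {c<..}"
  have "\<forall>\<^sub>F y in nhds x. (if y < c then f y else g y) = ?h y"
    using assms(1) by (intro eventually_mono[OF eventually_nhds_in_open[of ?S]]) (auto split: if_splits)
  then show ?thesis using assms(2,3) by (simp add: isCont_cong)
qed

section \<open>The layered medium and the solutions prescribed on the left\<close>

locale layers =
  fixes b1 b2 x2 :: real and k :: nat
  assumes b1: "b1 > 0" and b2: "b2 > 0" and x2: "0 < x2" "x2 < 1" and k: "k \<ge> 1"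
begin

abbreviation wave_p :: "complex \<Rightarrow> real \<Rightarrow> complex" where
  "wave_p \<mu> x \<equiv> exp (\<i> * \<mu> * of_real (b1 * x))"

abbreviation wave_m :: "complex \<Rightarrow> real \<Rightarrow> complex" where
  "wave_m \<mu> x \<equiv> exp (- \<i> * \<mu> * of_real (b1 * x))"

text \<open>The argument \<open>s\<close> is used with the values 1 and -1; the data (1, s/b1) at 0
  then belong to the wave exp(s i \<mu> b1 x). \<open>sol s n\<close> belongs to the medium that has
  only its first n cells and is continued by the background. The next cell overrides it from x = n
  on, restarting from its value there.\<close>

primrec sol :: "complex \<Rightarrow> nat \<Rightarrow> complex \<Rightarrow> real \<Rightarrow> complex \<times> complex" where
  "sol s 0 \<mu> = evolve b1 0 \<mu> (1, s / of_real b1)"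
| "sol s (Suc n) \<mu> = (\<lambda>x. if x < real n then sol s n \<mu> x
      else if x < real n + x2 then evolve b2 n \<mu> (sol s n \<mu> n) x
      else evolve b1 (n + x2) \<mu> (evolve b2 n \<mu> (sol s n \<mu> n) (n + x2)) x)"

abbreviation p1 where "p1 \<mu> x \<equiv> fst (sol 1 k \<mu> x)"
abbreviation q1 where "q1 \<mu> x \<equiv> snd (sol 1 k \<mu> x)"

text \<open>The reciprocal of the coefficient, built by the same case distinction as
  \<open>sol\<close>, so that the gluing lemma produces it literally as the factor in the
  derivative.\<close>

primrec inv_coeff :: "nat \<Rightarrow> real \<Rightarrow> real" where
  "inv_coeff 0 = (\<lambda>x. b1\<^sup>2)"
| "inv_coeff (Suc n) = (\<lambda>x. if x < real n then inv_coeff n x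
      else if x < real n + x2 then b2\<^sup>2 else b1\<^sup>2)"

abbreviation ak :: "real \<Rightarrow> real" where "ak \<equiv> coeff_trunc b1 b2 x2 k"

lemma inv_coeff_eq:
  "inv_coeff n x = (if 0 \<le> x \<and> x < real n \<and> frac x < x2 then b2\<^sup>2 else b1\<^sup>2)"
proof (induction n)
  case (Suc n)
  consider "x < real n" | "real n \<le> x" "x < real n + 1" | "real n + 1 \<le> x" by linarith
  then show ?case
  proof cases
    case 2
    then have "\<lfloor>x\<rfloor> = int n" by (simp add: floor_eq_iff)
    then have "frac x = x - real n" by (simp add: frac_def)
    then show ?thesis using 2 by auto
  qed (use Suc x2 in auto)
qed simp

text \<open>The point k is a genuine exception: the closed interval {0..k} and frac k = 0 give
  \<open>ak\<close> the value 1/b2^2 there, whereas \<open>inv_coeff k\<close> has already returned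
  to the background.\<close>

lemma ak_eq: "x \<noteq> real k \<Longrightarrow> ak x = 1 / inv_coeff k x"
  unfolding inv_coeff_eq coeff_trunc_def coeff_periodic_def by auto

lemma ak_cases: "ak x = 1 / b1\<^sup>2 \<or> ak x = 1 / b2\<^sup>2"
  by (auto simp: coeff_trunc_def coeff_periodic_def)

lemma ak_pos: "ak x > 0"
  using ak_cases[of x] b1 b2 by auto

lemma ak_outside: "x < 0 \<or> x > real k \<Longrightarrow> ak x = 1 / b1\<^sup>2"
  by (auto simp: coeff_trunc_def)

text \<open>Candidates for the discontinuities; for b1 = b2 the coefficient is in fact
  continuous.\<close>

definition breaks :: "real set" where
  "breaks = real ` {0..k} \<union> (\<lambda>n. real n + x2) ` {0..<k}"

lemma finite_breaks: "finite breaks" by (simp add: breaks_def)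

lemma breaks_subset: "breaks \<subseteq> {0..real k}"
  using x2 by (auto simp: breaks_def)

lemma isCont_ak: assumes "x \<notin> breaks" shows "isCont ak x"
proof -
  have "isCont (inv_coeff n) x" if "n \<le> k" for n
    using that
  proof (induction n)
    case (Suc n)
    have "real n \<in> breaks" "real n + x2 \<in> breaks" using Suc.prems by (auto simp: breaks_def)
    then have "x \<noteq> real n" "x \<noteq> real n + x2" using assms by auto
    then show ?case using Suc by (auto intro!: isCont_if_less)
  qed simp
  moreover have "inv_coeff k x \<noteq> 0" using b1 b2 by (auto simp: inv_coeff_eq)
  ultimately have "isCont (\<lambda>x. 1 / inv_coeff k x) x" by (intro continuous_intros) auto
  moreover have "x \<noteq> real k" using assms by (auto simp: breaks_def)
  then have "\<forall>\<^sub>F y in nhds x. ak y = 1 / inv_coeff k y"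
    by (intro eventually_mono[OF eventually_nhds_in_open[of "-{real k}"]]) (auto simp: ak_eq)
  ultimately show ?thesis by (simp add: isCont_cong)
qed

lemma measurable_inv_coeff: "inv_coeff n \<in> borel_measurable borel"
proof (induction n)
  case (Suc n)
  note [measurable] = Suc
  show ?case unfolding inv_coeff.simps by measurable
qed simp

lemma measurable_ak: "ak \<in> borel_measurable borel"
proof -
  have "ak = (\<lambda>x. if x = real k then ak (real k) else 1 / inv_coeff k x)"
    by (auto simp: ak_eq)
  also have "\<dots> \<in> borel_measurable borel"
    using measurable_inv_coeff[of k] by measurable
  finally show ?thesis .
qed

text \<open>Each cell needs two gluings, at n + x2 and at n. The values match because every branch
  starts from the end value of the preceding one.\<close>

lemma sol_abs_cont:
  "abs_cont (\<lambda>x. fst (sol s n \<mu> x)) (\<lambda>x. \<i> * \<mu> * snd (sol s n \<mu> x) * of_real (inv_coeff n x)) \<and>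
   abs_cont (\<lambda>x. snd (sol s n \<mu> x)) (\<lambda>x. \<i> * \<mu> * fst (sol s n \<mu> x))"
proof (induction n)
  case 0
  show ?case using evolve_abs_cont[of b1 0 \<mu> "(1, s / of_real b1)"] b1 by simp
next
  case (Suc n)
  have b: "b1 \<noteq> 0" "b2 \<noteq> 0" using b1 b2 by auto
  let ?v = "sol s n \<mu> n"
  let ?w = "evolve b2 n \<mu> ?v (n + x2)"
  note e2 = evolve_abs_cont[OF b(2), of n \<mu> ?v] and e1 = evolve_abs_cont[OF b(1), of "n + x2" \<mu> ?w]
  have cong: "abs_cont u v \<Longrightarrow> u = u' \<Longrightarrow> v = v' \<Longrightarrow> abs_cont u' v'" for u v u' v' by simp
  show ?case
  proof
    show "abs_cont (\<lambda>x. fst (sol s (Suc n) \<mu> x))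
        (\<lambda>x. \<i> * \<mu> * snd (sol s (Suc n) \<mu> x) * of_real (inv_coeff (Suc n) x))"
      by (rule cong[OF abs_cont_glue[OF Suc[THEN conjunct1] abs_cont_glue[OF e2(1) e1(1), of "n + x2"], of n]])
         (use x2 b in \<open>auto simp: evolve_self\<close>)
    show "abs_cont (\<lambda>x. snd (sol s (Suc n) \<mu> x)) (\<lambda>x. \<i> * \<mu> * fst (sol s (Suc n) \<mu> x))"
      by (rule cong[OF abs_cont_glue[OF Suc[THEN conjunct2] abs_cont_glue[OF e2(2) e1(2), of "n + x2"], of n]])
         (use x2 b in \<open>auto simp: evolve_self\<close>)
  qed
qed

lemma sol_transport: "transport ak \<mu> (\<lambda>x. fst (sol s k \<mu> x)) (\<lambda>x. snd (sol s k \<mu> x))"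
proof -
  note ac = sol_abs_cont[of s k \<mu>, THEN conjunct1] sol_abs_cont[of s k \<mu>, THEN conjunct2]
  have [measurable]: "(\<lambda>x. snd (sol s k \<mu> x)) \<in> borel_measurable borel" "ak \<in> borel_measurable borel"
    using abs_cont_continuous[OF ac(2)] measurable_ak by (auto intro: borel_measurable_continuous_onI)
  have "abs_cont (\<lambda>x. fst (sol s k \<mu> x)) (\<lambda>x. \<i> * \<mu> * snd (sol s k \<mu> x) / of_real (ak x))"
  proof (rule abs_cont_cong_AE[OF ac(1)])
    show "AE x in lborel. \<i> * \<mu> * snd (sol s k \<mu> x) * of_real (inv_coeff k x)
        = \<i> * \<mu> * snd (sol s k \<mu> x) / of_real (ak x)"
      using AE_lborel_singleton[of "real k"] by eventually_elim (simp add: ak_eq)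
  qed measurable
  then show ?thesis using ac(2) by (simp add: transport_def)
qed

lemma sol_holomorphic:
  "(\<lambda>\<mu>. fst (sol s n \<mu> x)) holomorphic_on UNIV \<and> (\<lambda>\<mu>. snd (sol s n \<mu> x)) holomorphic_on UNIV"
proof (induction n arbitrary: x)
  case 0
  show ?case using b1 by (auto intro!: evolve_holomorphic)
next
  case (Suc n)
  then have h: "(\<lambda>\<mu>. fst (sol s n \<mu> n)) holomorphic_on UNIV" "(\<lambda>\<mu>. snd (sol s n \<mu> n)) holomorphic_on UNIV"
    by auto
  have b: "b1 \<noteq> 0" "b2 \<noteq> 0" using b1 b2 by auto
  note e2 = evolve_holomorphic[OF b(2) h]
  note e1 = evolve_holomorphic[OF b(1) e2]
  show ?case
    using Suc e1 e2 by (cases "x < real n"; cases "x < real n + x2"; simp)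
qed

lemma sol_loc_bounded:
  "loc_bounded (\<lambda>\<mu> x. fst (sol s n \<mu> x)) \<and> loc_bounded (\<lambda>\<mu> x. snd (sol s n \<mu> x))"
proof (induction n)
  case 0
  show ?case using b1 by (auto intro!: loc_bounded_evolve)
next
  case (Suc n)
  have h: "(\<lambda>\<mu>. fst (sol s n \<mu> n)) holomorphic_on UNIV" "(\<lambda>\<mu>. snd (sol s n \<mu> n)) holomorphic_on UNIV"
    using sol_holomorphic by auto
  have b: "b1 \<noteq> 0" "b2 \<noteq> 0" using b1 b2 by auto
  note e = evolve_holomorphic[OF b(2) h, of "real n" "n + x2"]
  have "loc_bounded (\<lambda>\<mu> x. if x < real n then fst (sol s n \<mu> x) else if x < real n + x2
         then fst (evolve b2 n \<mu> (sol s n \<mu> n) x)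
         else fst (evolve b1 (n + x2) \<mu> (evolve b2 n \<mu> (sol s n \<mu> n) (n + x2)) x))"
   "loc_bounded (\<lambda>\<mu> x. if x < real n then snd (sol s n \<mu> x) else if x < real n + x2
         then snd (evolve b2 n \<mu> (sol s n \<mu> n) x)
         else snd (evolve b1 (n + x2) \<mu> (evolve b2 n \<mu> (sol s n \<mu> n) (n + x2)) x))"
    using Suc by (auto intro!: loc_bounded_if loc_bounded_evolve b h e)
  then show ?case by (simp add: if_distrib[of fst] if_distrib[of snd] cong: if_cong)
qed

lemma sol_left: assumes "x < 0" shows "sol s n \<mu> x = evolve b1 0 \<mu> (1, s / of_real b1) x"
  by (induction n) (use assms in auto)

text \<open>Beyond the last cell p + b1 q and p - b1 q only acquire the phases of the
  background.\<close>

lemma sol_right: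
  assumes x: "x \<ge> real k"
  shows "fst (sol s k \<mu> x) + of_real b1 * snd (sol s k \<mu> x)
     = wave_p \<mu> (x - k) * (fst (sol s k \<mu> k) + of_real b1 * snd (sol s k \<mu> k))"
    "fst (sol s k \<mu> x) - of_real b1 * snd (sol s k \<mu> x)
     = wave_m \<mu> (x - k) * (fst (sol s k \<mu> k) - of_real b1 * snd (sol s k \<mu> k))"
proof -
  obtain n where n: "k = Suc n" using k by (cases k) auto
  \<comment> \<open>The base point n + x2 of the last branch lies to the left of k = n + 1, so
    \<open>x\<close> and \<open>k\<close> are reached by one and the same evolution.\<close>
  obtain v where v: "sol s k \<mu> y = evolve b1 (n + x2) \<mu> v y" if "y \<ge> real k" for y
    using x2 that unfolding n by auto
  have b: "b1 \<noteq> 0" using b1 by simp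
  show "fst (sol s k \<mu> x) + of_real b1 * snd (sol s k \<mu> x)
     = wave_p \<mu> (x - k) * (fst (sol s k \<mu> k) + of_real b1 * snd (sol s k \<mu> k))"
    unfolding v[OF x] v[OF order_refl] evolve_plus[OF b] mult.assoc[symmetric] exp_add[symmetric]
    by (simp add: algebra_simps)
  show "fst (sol s k \<mu> x) - of_real b1 * snd (sol s k \<mu> x)
     = wave_m \<mu> (x - k) * (fst (sol s k \<mu> k) - of_real b1 * snd (sol s k \<mu> k))"
    unfolding v[OF x] v[OF order_refl] evolve_minus[OF b] mult.assoc[symmetric] exp_add[symmetric]
    by (simp add: algebra_simps)
qed

section \<open>The outgoing solutions and the coefficients A and B\<close>

text \<open>Right of k, the left-moving part p - b1 q of \<open>pp\<close> must vanish. This is one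
  linear equation for (A, B), solved by exchanging its two coefficients up to sign; hence no
  division occurs and both are entire. The factor \<open>wave_p \<mu> k / 2\<close> normalises
  \<open>pp\<close>, given the Wronskian -2/b1 of the two solutions from the left.\<close>

definition cA :: "complex \<Rightarrow> complex" where
  "cA \<mu> = wave_p \<mu> k * (fst (sol (-1) k \<mu> k) - of_real b1 * snd (sol (-1) k \<mu> k)) / 2"

definition cB :: "complex \<Rightarrow> complex" where
  "cB \<mu> = wave_p \<mu> k * (of_real b1 * q1 \<mu> k - p1 \<mu> k) / 2"

definition pm where "pm \<mu> x = fst (sol (-1) k \<mu> x)"
definition qm where "qm \<mu> x = snd (sol (-1) k \<mu> x)"
definition pp where "pp \<mu> x = cA \<mu> * p1 \<mu> x + cB \<mu> * pm \<mu> x"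
definition qp where "qp \<mu> x = cA \<mu> * q1 \<mu> x + cB \<mu> * qm \<mu> x"

lemma cA_holomorphic: "cA holomorphic_on UNIV" and cB_holomorphic: "cB holomorphic_on UNIV"
  unfolding cA_def[abs_def] cB_def[abs_def]
  by (intro holomorphic_intros sol_holomorphic[THEN conjunct1] sol_holomorphic[THEN conjunct2]; simp)+

lemma pm_holomorphic: "(\<lambda>\<mu>. pm \<mu> x) holomorphic_on UNIV"
  and pp_holomorphic: "(\<lambda>\<mu>. pp \<mu> x) holomorphic_on UNIV"
  unfolding pm_def pp_def
  by (intro holomorphic_intros sol_holomorphic[THEN conjunct1] cA_holomorphic cB_holomorphic)+

lemma pm_loc_bounded: "loc_bounded pm"
  unfolding pm_def[abs_def] using sol_loc_bounded by blast

lemma pp_loc_bounded: "loc_bounded pp"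
  unfolding pp_def[abs_def]
  by (intro loc_bounded_lincomb cA_holomorphic cB_holomorphic pm_loc_bounded sol_loc_bounded[THEN conjunct1])

lemma pm_transport: "transport ak \<mu> (pm \<mu>) (qm \<mu>)"
  using sol_transport[of \<mu> "-1"] by (simp add: pm_def[abs_def] qm_def[abs_def])

lemma pp_transport: "transport ak \<mu> (pp \<mu>) (qp \<mu>)"
  unfolding pp_def[abs_def] qp_def[abs_def] by (intro transport_lincomb sol_transport pm_transport)

lemma sol1_left:
  assumes "x < 0"
  shows "p1 \<mu> x = wave_p \<mu> x"
    "q1 \<mu> x = wave_p \<mu> x / of_real b1"
  using b1 by (auto simp: sol_left[OF assms] evolve_def Let_def)

lemma pm_left:
  assumes "x < 0"
  shows "pm \<mu> x = wave_m \<mu> x"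
    "qm \<mu> x = - wave_m \<mu> x / of_real b1"
  using b1 by (auto simp: sol_left[OF assms] evolve_def Let_def pm_def qm_def)

lemma pp_left:
  assumes "x < 0"
  shows "pp \<mu> x = cA \<mu> * wave_p \<mu> x + cB \<mu> * wave_m \<mu> x"
    "qp \<mu> x = (cA \<mu> * wave_p \<mu> x - cB \<mu> * wave_m \<mu> x) / of_real b1"
  unfolding pp_def qp_def sol1_left[OF assms] pm_left[OF assms] by (auto simp: diff_divide_distrib)

text \<open>A constant, evaluated at -1, where both solutions are pure exponentials.\<close>

lemma sol_wronskian:
  "p1 \<mu> x * qm \<mu> x - pm \<mu> x * q1 \<mu> x = - 2 / of_real b1"
proof -
  have "p1 \<mu> x * qm \<mu> x - pm \<mu> x * q1 \<mu> x
      = p1 \<mu> (-1) * qm \<mu> (-1) - pm \<mu> (-1) * q1 \<mu> (-1)"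
    by (rule transport_wronskian[OF sol_transport pm_transport])
  also have "\<dots> = - 2 / of_real b1"
    using sol1_left[of "-1" \<mu>] pm_left[of "-1" \<mu>] by (simp flip: exp_add add: field_simps exp_minus)
  finally show ?thesis .
qed

lemma wronskian: "pp \<mu> x * qm \<mu> x - pm \<mu> x * qp \<mu> x = - 2 * cA \<mu> / of_real b1"
proof -
  have "pp \<mu> x * qm \<mu> x - pm \<mu> x * qp \<mu> x
     = cA \<mu> * (p1 \<mu> x * qm \<mu> x - pm \<mu> x * q1 \<mu> x)"
    by (simp add: pp_def qp_def algebra_simps)
  then show ?thesis unfolding sol_wronskian by simp
qed

text \<open>In p + b1 q the terms combine to the Wronskian of the two solutions from the left, in p
  - b1 q they cancel by the choice of \<open>cA\<close> and \<open>cB\<close>.\<close>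

lemma pp_right:
  assumes x: "x \<ge> real k"
  shows "pp \<mu> x = wave_p \<mu> x" "qp \<mu> x = wave_p \<mu> x / of_real b1"
proof -
  define E where "E = wave_p \<mu> k"
  define P1 Q1 P2 Q2 where "P1 = p1 \<mu> k" and "Q1 = q1 \<mu> k"
    and "P2 = fst (sol (-1) k \<mu> k)" and "Q2 = snd (sol (-1) k \<mu> k)"
  have b: "complex_of_real b1 \<noteq> 0" using b1 by simp
  have W: "P1 * Q2 - P2 * Q1 = - 2 / of_real b1"
    using sol_wronskian[of \<mu> k] by (simp add: P1_def Q1_def P2_def Q2_def pm_def qm_def)
  have AB: "cA \<mu> = E * (P2 - of_real b1 * Q2) / 2" "cB \<mu> = E * (of_real b1 * Q1 - P1) / 2"
    by (simp_all add: cA_def cB_def E_def P1_def Q1_def P2_def Q2_def)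
  have "pp \<mu> x + of_real b1 * qp \<mu> x =
     cA \<mu> * (p1 \<mu> x + of_real b1 * q1 \<mu> x)
      + cB \<mu> * (fst (sol (-1) k \<mu> x) + of_real b1 * snd (sol (-1) k \<mu> x))"
    by (simp add: pp_def qp_def pm_def qm_def algebra_simps)
  also have "\<dots> = wave_p \<mu> (x - k) *
      (cA \<mu> * (P1 + of_real b1 * Q1) + cB \<mu> * (P2 + of_real b1 * Q2))"
    unfolding sol_right[OF x] P1_def Q1_def P2_def Q2_def by (simp add: algebra_simps)
  also have "cA \<mu> * (P1 + of_real b1 * Q1) + cB \<mu> * (P2 + of_real b1 * Q2)
     = - E * of_real b1 * (P1 * Q2 - P2 * Q1)"
    unfolding AB by (simp add: field_simps)
  also have "\<dots> = 2 * E" unfolding W using b by simp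
  also have "wave_p \<mu> (x - k) * (2 * E) = 2 * wave_p \<mu> x"
    unfolding E_def by (simp flip: exp_add add: algebra_simps)
  finally have s: "pp \<mu> x + of_real b1 * qp \<mu> x = 2 * wave_p \<mu> x" .
  have "pp \<mu> x - of_real b1 * qp \<mu> x =
     cA \<mu> * (p1 \<mu> x - of_real b1 * q1 \<mu> x)
      + cB \<mu> * (fst (sol (-1) k \<mu> x) - of_real b1 * snd (sol (-1) k \<mu> x))"
    by (simp add: pp_def qp_def pm_def qm_def algebra_simps)
  also have "\<dots> = wave_m \<mu> (x - k) *
      (cA \<mu> * (P1 - of_real b1 * Q1) + cB \<mu> * (P2 - of_real b1 * Q2))"
    unfolding sol_right[OF x] P1_def Q1_def P2_def Q2_def by (simp add: algebra_simps)
  also have "cA \<mu> * (P1 - of_real b1 * Q1) + cB \<mu> * (P2 - of_real b1 * Q2) = 0"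
    unfolding AB by (simp add: field_simps)
  finally have d: "pp \<mu> x = of_real b1 * qp \<mu> x" by simp
  show "qp \<mu> x = wave_p \<mu> x / of_real b1" using s b unfolding d by (simp add: field_simps)
  then show "pp \<mu> x = wave_p \<mu> x" unfolding d using b by simp
qed

text \<open>Otherwise \<open>pp\<close> would vanish at k, where it is an exponential. Consequently
  no zero of the denominator is cancelled in B/A.\<close>

lemma cA_cB_nonzero: "cA \<mu> \<noteq> 0 \<or> cB \<mu> \<noteq> 0"
proof (rule ccontr)
  assume "\<not> ?thesis"
  then have "pp \<mu> k = 0" by (simp add: pp_def)
  then show False using pp_right(1)[of "real k" \<mu>] by simp
qed

lemma continuous_pp: "continuous_on UNIV (pp \<mu>)" "continuous_on UNIV (qp \<mu>)"
  and continuous_pm: "continuous_on UNIV (pm \<mu>)" "continuous_on UNIV (qm \<mu>)"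
  using pp_transport pm_transport by (auto simp: transport_def intro: abs_cont_continuous)

text \<open>The energy flux $\mathrm{Re}(p\overline q)$ is nonincreasing for $\mathrm{Im}\,\mu\ge0$.\<close>

lemma cA_nonzero:
  assumes "Im \<mu> \<ge> 0" shows "cA \<mu> \<noteq> 0"
proof
  assume A0: "cA \<mu> = 0"
  let ?p = "pp \<mu>" and ?q = "qp \<mu>"
  \<comment> \<open>Twice the energy flux, written with conjugates instead of a real part so that
    the product rule for \<open>abs_cont\<close> applies.\<close>
  define h where "h x = ?p x * cnj (?q x) + ?q x * cnj (?p x)" for x
  have t: "abs_cont ?p (\<lambda>x. \<i> * \<mu> * ?q x / of_real (ak x))" "abs_cont ?q (\<lambda>x. \<i> * \<mu> * ?p x)"
    using pp_transport[of \<mu>] by (auto simp: transport_def)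
  have h: "abs_cont h (\<lambda>x. (\<i> * \<mu> * ?q x / of_real (ak x) * cnj (?q x) + ?p x * cnj (\<i> * \<mu> * ?p x))
     + (\<i> * \<mu> * ?p x * cnj (?p x) + ?q x * cnj (\<i> * \<mu> * ?q x / of_real (ak x))))"
    unfolding h_def by (intro abs_cont_add abs_cont_mult abs_cont_cnj t)
  define g where "g x = 2 * Im \<mu> * ((cmod (?q x))\<^sup>2 / ak x + (cmod (?p x))\<^sup>2)" for x
  have re: "(\<i> * \<mu> * z / of_real a * cnj z + w * cnj (\<i> * \<mu> * w))
     + (\<i> * \<mu> * w * cnj w + z * cnj (\<i> * \<mu> * z / of_real a)) =
     - complex_of_real (2 * Im \<mu> * ((cmod z)\<^sup>2 / a + (cmod w)\<^sup>2))" if "a > 0" for z w a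
  proof -
    have "(\<i> * \<mu> * z / of_real a * cnj z + w * cnj (\<i> * \<mu> * w))
       + (\<i> * \<mu> * w * cnj w + z * cnj (\<i> * \<mu> * z / of_real a))
      = (\<i> * \<mu> + cnj (\<i> * \<mu>)) * (z * cnj z / of_real a + w * cnj w)"
      by (simp add: algebra_simps add_divide_distrib)
    also have "\<i> * \<mu> + cnj (\<i> * \<mu>) = of_real (- 2 * Im \<mu>)" by (simp add: complex_eq_iff)
    finally show ?thesis by (simp flip: complex_norm_square)
  qed
  have h2: "abs_cont h (\<lambda>x. - complex_of_real (g x))"
    using h re[OF ak_pos] by (simp add: g_def)
  have "h k - h (-1) = (LINT x:{-1..real k}|lborel. - complex_of_real (g x))"
    by (rule abs_cont_diff[OF h2]) auto
  also have "\<dots> = - complex_of_real (LINT x:{-1..real k}|lborel. g x)"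
    unfolding set_integral_complex_of_real[symmetric] by (simp add: set_lebesgue_integral_def)
  finally have "Re (h k) - Re (h (-1)) = - (LINT x:{-1..real k}|lborel. g x)"
    by (simp add: complex_eq_iff)
  moreover have "(LINT x:{-1..real k}|lborel. g x) \<ge> 0"
    unfolding set_lebesgue_integral_def
    by (rule Bochner_Integration.integral_nonneg)
       (use assms ak_pos in \<open>auto simp: g_def indicator_def less_imp_le intro!: mult_nonneg_nonneg add_nonneg_nonneg divide_nonneg_nonneg\<close>)
  ultimately have le: "Re (h k) \<le> Re (h (-1))" by linarith
  have cs: "Re (z * cnj (of_real c * z) + of_real c * z * cnj z) = 2 * c * (cmod z)\<^sup>2"
    for z :: complex and c :: real
    by (simp add: cmod_power2 power2_eq_square[of "Re z"] power2_eq_square[of "Im z"] algebra_simps)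
  \<comment> \<open>With A = 0 only the left-moving wave is present at -1, and its flux is
    nonpositive; the right-moving wave at k has strictly positive flux. A nonincreasing flux forbids
    this.\<close>
  define E F where "E = wave_p \<mu> k" and "F = cB \<mu> * wave_m \<mu> (-1)"
  have "Re (h k) = 2 * (1 / b1) * (cmod E)\<^sup>2"
    using cs[of E "1 / b1"] by (simp add: h_def pp_right E_def)
  moreover have "Re (h (-1)) = 2 * (- 1 / b1) * (cmod F)\<^sup>2"
    using cs[of F "- 1 / b1"] pp_left[of "-1" \<mu>] by (simp add: h_def A0 F_def)
  moreover have "2 * (1 / b1) * (cmod E)\<^sup>2 > 0" using b1 by (simp add: E_def)
  moreover have "2 * (- 1 / b1) * (cmod F)\<^sup>2 \<le> 0" using b1 by (simp add: divide_nonpos_pos)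
  ultimately show False using le by linarith
qed

section \<open>Existence and uniqueness of the scattering coefficients\<close>

abbreviation flux_of :: "complex \<Rightarrow> (real \<Rightarrow> complex) \<Rightarrow> (real \<Rightarrow> complex) \<Rightarrow> bool" where
  "flux_of \<mu> \<psi> w \<equiv> \<forall>x. isCont ak x \<longrightarrow>
           (\<exists>d. (\<psi> has_vector_derivative d) (at x) \<and> w x = of_real (ak x) * d) \<and>
           (\<exists>e. (w has_vector_derivative e) (at x) \<and> - e = \<mu>\<^sup>2 * \<psi> x)"

text \<open>The flux of a stationary solution is only known to exist; off the breaks it is tied to
  the derivative of \<psi>, so exponentials near a point determine it there.\<close>

lemma stationary_flux:
  assumes w: "flux_of \<mu> \<psi> w"
    and S: "open S" "x \<in> S" "x \<notin> breaks" and a: "ak x = 1 / b1\<^sup>2"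
    and eq: "\<And>y. y \<in> S \<Longrightarrow> \<psi> y = c * wave_p \<mu> y + d * wave_m \<mu> y"
  shows "w x = \<i> * \<mu> / of_real b1 * (c * wave_p \<mu> x - d * wave_m \<mu> x)"
proof -
  from w isCont_ak[OF S(3)] obtain D where D: "(\<psi> has_vector_derivative D) (at x)" "w x = of_real (ak x) * D"
    by blast
  have e: "((\<lambda>x. exp (z * of_real (b1 * x))) has_vector_derivative z * of_real b1 * exp (z * of_real (b1 * x))) (at x)" for z :: complex
    using has_vector_derivative_exp_of_real[of z b1 0 x] by simp
  have "((\<lambda>y. c * wave_p \<mu> y + d * exp ((- \<i> * \<mu>) * of_real (b1 * y))) has_vector_derivative
     c * (\<i> * \<mu> * of_real b1 * wave_p \<mu> x)
      + d * ((- \<i> * \<mu>) * of_real b1 * exp ((- \<i> * \<mu>) * of_real (b1 * x)))) (at x)"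
    by (intro has_vector_derivative_add has_vector_derivative_mult_right e)
  then have "(\<psi> has_vector_derivative
     c * (\<i> * \<mu> * of_real b1 * wave_p \<mu> x)
      + d * ((- \<i> * \<mu>) * of_real b1 * exp ((- \<i> * \<mu>) * of_real (b1 * x)))) (at x)"
    by (rule has_vector_derivative_transform_within_open[OF _ S(1,2)]) (simp add: eq)
  from vector_derivative_unique_at[OF D(1) this] show ?thesis
    unfolding D(2) a using b1 by (simp add: field_simps power2_eq_square)
qed

lemma scattering_exists:
  assumes A: "cA \<mu> \<noteq> 0" shows "scattering_coeffs b1 b2 x2 k \<mu> (cB \<mu> / cA \<mu>) (1 / cA \<mu>)"
  unfolding scattering_coeffs_def
proof (intro exI conjI allI impI)
  let ?\<psi> = "\<lambda>x. pp \<mu> x / cA \<mu>" and ?w = "\<lambda>x. \<i> * \<mu> * qp \<mu> x / cA \<mu>"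
  have t: "abs_cont (pp \<mu>) (\<lambda>x. \<i> * \<mu> * qp \<mu> x / of_real (ak x))" "abs_cont (qp \<mu>) (\<lambda>x. \<i> * \<mu> * pp \<mu> x)"
    using pp_transport[of \<mu>] by (auto simp: transport_def)
  show "stationary_solution ak \<mu> ?\<psi>"
    unfolding stationary_solution_def
  proof (intro conjI exI allI impI)
    show "continuous_on UNIV ?\<psi>" "continuous_on UNIV ?w"
      using A by (intro continuous_intros continuous_pp; simp)+
    fix x assume c: "isCont ak x"
    have cq: "isCont (qp \<mu>) x" "isCont (pp \<mu>) x"
      using continuous_pp[of \<mu>] by (auto simp: continuous_on_eq_continuous_at)
    have "isCont (\<lambda>x. \<i> * \<mu> * qp \<mu> x / of_real (ak x)) x"
      using ak_pos[of x] by (intro continuous_intros cq c) auto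
    from abs_cont_has_vector_derivative[OF t(1) this]
    show "(?\<psi> has_vector_derivative (\<i> * \<mu> * qp \<mu> x / of_real (ak x)) / cA \<mu>) (at x)"
      by (rule has_vector_derivative_divide)
    show "?w x = of_real (ak x) * ((\<i> * \<mu> * qp \<mu> x / of_real (ak x)) / cA \<mu>)"
      using ak_pos[of x] by simp
    have "isCont (\<lambda>x. \<i> * \<mu> * pp \<mu> x) x" by (intro continuous_intros cq)
    from abs_cont_has_vector_derivative[OF t(2) this]
    have "((\<lambda>x. \<i> * \<mu> / cA \<mu> * qp \<mu> x) has_vector_derivative \<i> * \<mu> / cA \<mu> * (\<i> * \<mu> * pp \<mu> x)) (at x)"
      by (rule has_vector_derivative_mult_right)
    then show "(?w has_vector_derivative \<i> * \<mu> / cA \<mu> * (\<i> * \<mu> * pp \<mu> x)) (at x)" by simp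
    show "- (\<i> * \<mu> / cA \<mu> * (\<i> * \<mu> * pp \<mu> x)) = \<mu>\<^sup>2 * ?\<psi> x"
      by (simp add: power2_eq_square mult_ac)
  qed
  show "?\<psi> x = wave_p \<mu> x + cB \<mu> / cA \<mu> * wave_m \<mu> x"
    if "x < 0" for x using A by (simp add: pp_left[OF that] field_simps)
  show "?\<psi> x = 1 / cA \<mu> * wave_p \<mu> x" if "x > real k" for x
    using that by (simp add: pp_right)
qed

text \<open>Any scattering solution has zero Wronskian with \<open>pp\<close>: to the right of the
  layers both are multiples of the same wave. Read off at -1, the same constant is a multiple of r A
  - B.\<close>

lemma scattering_unique:
  assumes A: "cA \<mu> \<noteq> 0" and mu: "\<mu> \<noteq> 0" and s: "scattering_coeffs b1 b2 x2 k \<mu> r t"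
  shows "r = cB \<mu> / cA \<mu>"
proof -
  obtain \<psi> w where c: "continuous_on UNIV \<psi>" "continuous_on UNIV w"
    and w: "flux_of \<mu> \<psi> w"
    and l: "\<And>x. x < 0 \<Longrightarrow> \<psi> x = wave_p \<mu> x + r * wave_m \<mu> x"
    and rr: "\<And>x. x > real k \<Longrightarrow> \<psi> x = t * wave_p \<mu> x"
    using s unfolding scattering_coeffs_def stationary_solution_def by metis
  \<comment> \<open>Here \<mu> \<noteq> 0 enters: the flux is turned into the second component of
    the first order system.\<close>
  let ?q = "\<lambda>x. w x / (\<i> * \<mu>)"
  have [measurable]: "ak \<in> borel_measurable borel" "w \<in> borel_measurable borel"
    using measurable_ak c by (auto intro: borel_measurable_continuous_onI)
  have inv_bd: "cmod (1 / of_real (ak x)) \<le> b1\<^sup>2 + b2\<^sup>2" for x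
    using ak_cases[of x] by (auto simp: norm_power)
  have "transport ak \<mu> \<psi> ?q"
    unfolding transport_def
  proof
    have "loc_int (\<lambda>x. 1 / of_real (ak x) * w x)"
      by (rule loc_int_mult_bounded[OF loc_int_continuous[OF c(2)]]) (use inv_bd in auto)
    then have li: "loc_int (\<lambda>x. \<i> * \<mu> * ?q x / of_real (ak x))" using mu by simp
    show "abs_cont \<psi> (\<lambda>x. \<i> * \<mu> * ?q x / of_real (ak x))"
    proof (rule abs_cont_FTC[OF finite_breaks c(1) li])
      fix x assume "x \<notin> breaks"
      then obtain d where "(\<psi> has_vector_derivative d) (at x)" "w x = of_real (ak x) * d"
        using w isCont_ak by blast
      then show "(\<psi> has_vector_derivative \<i> * \<mu> * ?q x / of_real (ak x)) (at x)"
        using ak_pos[of x] mu by simp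
    qed
    show "abs_cont ?q (\<lambda>x. \<i> * \<mu> * \<psi> x)"
    proof (rule abs_cont_FTC[OF finite_breaks])
      show "continuous_on UNIV ?q" using mu by (intro continuous_intros c) auto
      show "loc_int (\<lambda>x. \<i> * \<mu> * \<psi> x)" by (intro loc_int_continuous continuous_intros c)
      fix x assume "x \<notin> breaks"
      then obtain e where e: "(w has_vector_derivative e) (at x)" "- e = \<mu>\<^sup>2 * \<psi> x"
        using w isCont_ak by blast
      have "e = - \<mu>\<^sup>2 * \<psi> x" using e(2) by (metis minus_minus mult_minus_left)
      then have "e / (\<i> * \<mu>) = \<i> * \<mu> * \<psi> x" using mu by (simp add: field_simps power2_eq_square)
      then show "(?q has_vector_derivative \<i> * \<mu> * \<psi> x) (at x)"
        using has_vector_derivative_divide[OF e(1), of "\<i> * \<mu>"] by simp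
    qed
  qed
  from transport_wronskian[OF this pp_transport, of "-1" "real k + 1"]
  have W: "\<psi> (-1) * qp \<mu> (-1) - pp \<mu> (-1) * ?q (-1)
     = \<psi> (real k + 1) * qp \<mu> (real k + 1) - pp \<mu> (real k + 1) * ?q (real k + 1)" .
  define e f where "e = wave_p \<mu> (-1)" and "f = wave_m \<mu> (-1)"
  have nb: "-1 \<notin> breaks" "real k + 1 \<notin> breaks" using breaks_subset by auto
  have b: "complex_of_real b1 \<noteq> 0" using b1 by simp
  have "w (-1) = \<i> * \<mu> / of_real b1 * (1 * e - r * f)"
    unfolding e_def f_def
    by (rule stationary_flux[OF w, of "{..<0}"]) (use nb l in \<open>auto simp: ak_outside\<close>)
  moreover have canc: "\<i> * \<mu> / of_real b1 * X / (\<i> * \<mu>) = X / of_real b1" for X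
    using mu by (simp add: field_simps)
  ultimately have q1: "?q (-1) = (e - r * f) / of_real b1" by (simp only: mult_1)
  have "w (real k + 1) = \<i> * \<mu> / of_real b1 * (t * wave_p \<mu> (real k + 1)
      - 0 * wave_m \<mu> (real k + 1))"
    by (rule stationary_flux[OF w, of "{real k<..}"]) (use nb rr in \<open>auto simp: ak_outside\<close>)
  then have q2: "?q (real k + 1) = t * wave_p \<mu> (real k + 1) / of_real b1"
    using mu by (simp add: field_simps)
  have "\<psi> (real k + 1) * qp \<mu> (real k + 1) - pp \<mu> (real k + 1) * ?q (real k + 1) = 0"
    unfolding q2 using rr[of "real k + 1"] by (simp add: pp_right)
  moreover have "\<psi> (-1) = e + r * f" using l[of "-1"] by (simp add: e_def f_def)
  moreover have "pp \<mu> (-1) = cA \<mu> * e + cB \<mu> * f" "qp \<mu> (-1) = (cA \<mu> * e - cB \<mu> * f) / of_real b1"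
    using pp_left[of "-1" \<mu>] by (simp_all add: e_def f_def)
  ultimately have "(e + r * f) * ((cA \<mu> * e - cB \<mu> * f) / of_real b1)
      - (cA \<mu> * e + cB \<mu> * f) * ((e - r * f) / of_real b1) = 0"
    using W q1 by simp
  then have "(e + r * f) * (cA \<mu> * e - cB \<mu> * f) - (cA \<mu> * e + cB \<mu> * f) * (e - r * f) = 0"
    using b by (simp add: field_simps)
  \<comment> \<open>The terms with e^2 and f^2 cancel, and only the mixed products of the two waves
    survive.\<close>
  then have "2 * (e * f) * (r * cA \<mu> - cB \<mu>) = 0" by (simp add: algebra_simps)
  moreover have "e * f \<noteq> 0" by (simp add: e_def f_def)
  ultimately show ?thesis using A by (simp add: field_simps)
qed

lemma reflection_coeff_eq:
  assumes "Im \<mu> \<ge> 0" "\<mu> \<noteq> 0" shows "reflection_coeff b1 b2 x2 k \<mu> = cB \<mu> / cA \<mu>"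
  unfolding reflection_coeff_def
  using scattering_exists[OF cA_nonzero[OF assms(1)]] scattering_unique[OF cA_nonzero[OF assms(1)] assms(2)]
  by (intro the_equality) blast+

end

section \<open>The resolvent kernel\<close>

lemma integrable_exp_right:
  fixes c :: real assumes "c > 0"
  shows "set_integrable lborel {a..} (\<lambda>x. exp (- c * x))"
proof -
  have "(\<lambda>x. exp (- c * x)) absolutely_integrable_on {a..}"
    by (intro nonnegative_absolutely_integrable_1 integrable_on_exp_minus_to_infinity assms) auto
  then show ?thesis
    unfolding set_integrable_def by (subst (asm) integrable_completion) auto
qed

lemma integrable_exp_left:
  fixes c :: real assumes "c > 0"
  shows "set_integrable lborel {..a} (\<lambda>x. exp (c * x))"
proof -
  have "integrable lborel (\<lambda>x. indicator {-a..} x *\<^sub>R exp (- c * x))"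
    using integrable_exp_right[OF assms, of "-a"] by (simp add: set_integrable_def)
  from lborel_integrable_real_affine[OF this, of "-1" 0]
  have "integrable lborel (\<lambda>x. indicator {-a..} (- x) *\<^sub>R exp (c * x))" by simp
  moreover have "indicator {-a..} (- x) = (indicator {..a} x :: real)" for x :: real
    by (auto simp: indicator_def)
  ultimately show ?thesis by (simp add: set_integrable_def)
qed

lemma L2_tails:
  fixes c :: real
  assumes u: "continuous_on UNIV u" and c: "c > 0"
    and r: "\<And>x. x \<ge> N \<Longrightarrow> (cmod (u x))\<^sup>2 \<le> C * exp (- c * x)"
    and l: "\<And>x. x \<le> - N \<Longrightarrow> (cmod (u x))\<^sup>2 \<le> D * exp (c * x)"
  shows "u \<in> L2"
proof (rule L2_bound)
  have m: "continuous_on UNIV (\<lambda>x. (cmod (u x))\<^sup>2)" using u by (intro continuous_intros)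
  let ?g1 = "\<lambda>x. indicator {-N..N} x *\<^sub>R (cmod (u x))\<^sup>2"
  let ?g2 = "\<lambda>x. \<bar>C\<bar> * (indicator {N..} x *\<^sub>R exp (- c * x))"
  let ?g3 = "\<lambda>x. \<bar>D\<bar> * (indicator {..-N} x *\<^sub>R exp (c * x))"
  have "integrable lborel ?g1"
    by (intro borel_integrable_compact continuous_on_subset[OF m]) auto
  moreover have "integrable lborel ?g2" "integrable lborel ?g3"
    using integrable_exp_right[OF c, of N] integrable_exp_left[OF c, of "-N"]
    unfolding set_integrable_def by (auto intro!: integrable_mult_right)
  ultimately show "integrable lborel (\<lambda>x. ?g1 x + ?g2 x + ?g3 x)" by (intro Bochner_Integration.integrable_add)
  show "u \<in> borel_measurable borel" using u by (rule borel_measurable_continuous_onI)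
  show "AE x in lborel. (cmod (u x))\<^sup>2 \<le> ?g1 x + ?g2 x + ?g3 x"
  proof (rule AE_I2)
    fix x
    have nn: "?g1 x \<ge> 0" "?g2 x \<ge> 0" "?g3 x \<ge> 0" by auto
    consider "x \<ge> N" | "x \<le> -N" | "x \<in> {-N..N}" by fastforce
    then show "(cmod (u x))\<^sup>2 \<le> ?g1 x + ?g2 x + ?g3 x"
    proof cases
      case 1
      have "(cmod (u x))\<^sup>2 \<le> \<bar>C\<bar> * exp (- c * x)"
        using r[OF 1] by (rule order_trans) (intro mult_right_mono, auto)
      also have "\<dots> = ?g2 x" using 1 by simp
      finally show ?thesis using nn by linarith
    next
      case 2
      have "(cmod (u x))\<^sup>2 \<le> \<bar>D\<bar> * exp (c * x)"
        using l[OF 2] by (rule order_trans) (intro mult_right_mono, auto)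
      also have "\<dots> = ?g3 x" using 2 by simp
      finally show ?thesis using nn by linarith
    next
      case 3
      then have "(cmod (u x))\<^sup>2 = ?g1 x" by simp
      then show ?thesis using nn by linarith
    qed
  qed
qed

text \<open>Meant for Wronskians: a constant that is integrable over a half-line has to be
  zero.\<close>

lemma integrable_indicator_const_infinite:
  fixes C :: complex and A :: "real set"
  assumes "integrable lborel (\<lambda>x. indicator A x *\<^sub>R C)" "A \<in> sets borel" "emeasure lborel A = \<infinity>"
  shows "C = 0"
proof (rule ccontr)
  assume C: "C \<noteq> 0"
  have "integrable lborel (\<lambda>x. norm (indicator A x *\<^sub>R C) / norm C)"
    using assms(1) by (intro integrable_divide integrable_norm)
  moreover have "norm (indicator A x *\<^sub>R C) / norm C = indicator A x" for x
    using C by (auto simp: indicator_def)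
  ultimately have "integrable lborel (indicator A :: real \<Rightarrow> real)" by simp
  then show False using assms(2,3) by (simp add: integrable_indicator_iff)
qed

lemma emeasure_lborel_half_lines:
  "emeasure lborel {a::real..} = \<infinity>" "emeasure lborel {..a::real} = \<infinity>"
proof -
  have *: "emeasure lborel A = \<infinity>"
    if A: "A \<in> sets borel" and sub: "\<And>n. \<exists>a. {a..a + real n} \<subseteq> A" for A
  proof -
    have "emeasure lborel A \<ge> of_nat n" for n
    proof -
      obtain a where "{a..a + real n} \<subseteq> A" using sub by blast
      then have "emeasure lborel {a..a + real n} \<le> emeasure lborel A" using A by (intro emeasure_mono) auto
      then show ?thesis by (simp add: ennreal_of_nat_eq_real_of_nat)
    qed
    then show ?thesis by (metis ennreal_Ex_less_of_nat infinity_ennreal_def leD top.not_eq_extremum)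
  qed
  show "emeasure lborel {a..} = \<infinity>" by (rule *) (auto intro: exI[of _ a])
  show "emeasure lborel {..a} = \<infinity>" by (rule *) (auto intro: exI[of _ "a - real _"])
qed

lemma integral_split_at:
  fixes g :: "real \<Rightarrow> complex"
  assumes "integrable lborel g"
  shows "(LINT y:{..x}|lborel. g y) + (LINT y:{x<..}|lborel. g y) = (LINT y|lborel. g y)"
proof -
  have i: "set_integrable lborel {..x} g" "set_integrable lborel {x<..} g"
    using assms by (auto simp: set_integrable_def intro: integrable_mult_indicator)
  have "(LINT y:{..x} \<union> {x<..}|lborel. g y) = (LINT y:{..x}|lborel. g y) + (LINT y:{x<..}|lborel. g y)"
    by (rule set_integral_Un[OF _ i]) auto
  moreover have "{..x} \<union> {x<..} = UNIV" by auto
  ultimately show ?thesis by (simp add: set_lebesgue_integral_def)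
qed

lemma set_integral_zero_AE:
  fixes g :: "real \<Rightarrow> complex"
  assumes "AE y in lborel. \<bar>y\<bar> > N \<longrightarrow> f y = 0" "\<And>y. y \<in> A \<Longrightarrow> \<bar>y\<bar> > N"
  shows "(LINT y:A|lborel. g y * f y) = 0"
  unfolding set_lebesgue_integral_def
proof (rule integral_eq_zero_AE)
  show "AE y in lborel. indicat_real A y *\<^sub>R (g y * f y) = 0"
    using assms(1) by eventually_elim (use assms(2) in \<open>auto simp: indicator_def\<close>)
qed

lemma abs_cont_integral:
  fixes g :: "real \<Rightarrow> complex"
  assumes g: "integrable lborel g"
  shows "abs_cont (\<lambda>x. LINT y:{..x}|lborel. g y) g"
    "abs_cont (\<lambda>x. LINT y:{x<..}|lborel. g y) (\<lambda>x. - g x)"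
proof -
  have i: "set_integrable lborel A g" if "A \<in> sets borel" for A
    using g that by (auto simp: set_integrable_def intro: integrable_mult_indicator)
  show *: "abs_cont (\<lambda>x. LINT y:{..x}|lborel. g y) g"
  proof (rule abs_contI)
    show "loc_int g" using i by (auto simp: loc_int_def)
    fix a b :: real assume ab: "a \<le> b"
    have "(LINT y:{..a} \<union> {a..b}|lborel. g y) = (LINT y:{..a}|lborel. g y) + (LINT y:{a..b}|lborel. g y)"
    proof (rule set_integral_Un_AE)
      show "AE x in lborel. \<not> (x \<in> {..a} \<and> x \<in> {a..b})"
        using AE_lborel_singleton[of a] by eventually_elim auto
    qed (auto intro: i)
    moreover have "{..a} \<union> {a..b} = {..b}" using ab by auto
    ultimately show "(LINT y:{..b}|lborel. g y) - (LINT y:{..a}|lborel. g y) = (LINT y:{a..b}|lborel. g y)"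
      by simp
  qed
  have "(LINT y:{x<..}|lborel. g y) = (LINT y|lborel. g y) - (LINT y:{..x}|lborel. g y)" for x
    using integral_split_at[OF g, of x] by (simp add: algebra_simps)
  then show "abs_cont (\<lambda>x. LINT y:{x<..}|lborel. g y) (\<lambda>x. - g x)"
    using abs_cont_sub[OF abs_cont_const *] by simp
qed

lemma L2_compD:
  assumes "f \<in> L2_comp"
  obtains N where "f \<in> L2" "AE x in lborel. \<bar>x\<bar> > N \<longrightarrow> f x = 0" "N \<ge> M"
proof -
  from assms obtain N where N: "f \<in> L2" "AE x in lborel. \<bar>x\<bar> > N \<longrightarrow> f x = 0" by (auto simp: L2_comp_def)
  show ?thesis
    by (rule that[OF N(1), of "max N M"]) (use N(2) in \<open>auto elim: eventually_mono\<close>)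
qed

lemma L2_comp_mult_integrable:
  assumes f: "f \<in> L2_comp" and g: "continuous_on UNIV g"
  shows "integrable lborel (\<lambda>x. g x * f x)"
proof -
  obtain N where N: "f \<in> L2" "AE x in lborel. \<bar>x\<bar> > N \<longrightarrow> f x = 0" using L2_compD[OF f] .
  have "integrable lborel (\<lambda>x. indicator {-N..N} x *\<^sub>R (g x * f x))"
    using loc_int_mult_continuous[OF L2_loc_int[OF N(1)] g] by (auto simp: loc_int_def set_integrable_def)
  moreover have [measurable]: "g \<in> borel_measurable borel" "f \<in> borel_measurable borel"
    using g N(1) by (auto intro: borel_measurable_continuous_onI L2_measurable)
  moreover have "AE x in lborel. indicator {-N..N} x *\<^sub>R (g x * f x) = g x * f x"
    using N(2) by eventually_elim (auto simp: indicator_def abs_le_iff not_le)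
  ultimately show ?thesis by (subst (asm) integrable_cong_AE[where g = "\<lambda>x. g x * f x"]) auto
qed

lemma weak_deriv_L2:
  assumes "u \<in> H1" shows "weak_deriv u \<in> L2" "has_weak_deriv u (weak_deriv u)"
  using assms someI_ex[of "\<lambda>v. v \<in> L2 \<and> has_weak_deriv u v"] unfolding H1_def weak_deriv_def by blast+

lemma weak_deriv_eq_AE:
  assumes "u \<in> H1" "has_weak_deriv u v" "v \<in> L2"
  shows "AE x in lborel. weak_deriv u x = v x"
  using weak_deriv_L2[OF assms(1)] assms(2,3) by (intro weak_deriv_unique[of u]) (auto intro: L2_loc_int)

section \<open>The operator domain and uniqueness for the resolvent equation\<close>

context layers begin

lemma inv_ak_bound: "cmod (1 / of_real (ak x)) \<le> b1\<^sup>2 + b2\<^sup>2"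
  using ak_cases[of x] by (auto simp: norm_power)

lemma ak_bound: "cmod (of_real (ak x)) \<le> 1 / b1\<^sup>2 + 1 / b2\<^sup>2"
  using ak_cases[of x] by (auto simp: norm_divide norm_power)

lemma L2_divide_ak: assumes "v \<in> L2" shows "(\<lambda>x. v x / of_real (ak x)) \<in> L2"
proof -
  have [measurable]: "ak \<in> borel_measurable borel" by (rule measurable_ak)
  have "(\<lambda>x. 1 / of_real (ak x) * v x) \<in> L2"
    by (rule L2_mult_bounded[OF assms _ inv_ak_bound]) measurable
  then show ?thesis by simp
qed

lemma L2_times_ak: assumes "v \<in> L2" shows "(\<lambda>x. of_real (ak x) * v x) \<in> L2"
proof -
  have [measurable]: "ak \<in> borel_measurable borel" by (rule measurable_ak)
  show ?thesis by (rule L2_mult_bounded[OF assms _ ak_bound]) measurable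
qed

text \<open>\<open>V\<close> is the flux of \<open>U\<close>. The derivative chosen in
  \<open>weak_deriv\<close> agrees with V/a only almost everywhere, so the chosen flux inherits its
  weak derivative from \<open>V\<close> along an equality almost everywhere.\<close>

lemma op_domainI:
  assumes U: "abs_cont U (\<lambda>x. V x / of_real (ak x))" and V: "abs_cont V g"
    and L: "U \<in> L2" "V \<in> L2" "g \<in> L2"
  shows "U \<in> op_domain ak" "AE x in lborel. op_P ak U x = - g x"
proof -
  have [measurable]: "ak \<in> borel_measurable borel" by (rule measurable_ak)
  have UH: "U \<in> H1"
    using L L2_divide_ak abs_cont_imp_weak_deriv[OF U] unfolding H1_def by blast
  have w: "AE x in lborel. weak_deriv U x = V x / of_real (ak x)"
    by (rule weak_deriv_eq_AE[OF UH abs_cont_imp_weak_deriv[OF U] L2_divide_ak[OF L(2)]])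
  let ?w = "\<lambda>x. of_real (ak x) * weak_deriv U x"
  have wL: "?w \<in> L2" by (rule L2_times_ak[OF weak_deriv_L2(1)[OF UH]])
  have e: "AE x in lborel. V x = ?w x" using w by eventually_elim (use ak_pos in \<open>simp add: less_imp_neq[symmetric]\<close>)
  have wd: "has_weak_deriv ?w g"
    by (rule has_weak_deriv_cong_AE[OF abs_cont_imp_weak_deriv[OF V] e AE_I2])
       (use L wL in \<open>auto intro: L2_measurable\<close>)
  have wH: "?w \<in> H1" using wL L(3) wd unfolding H1_def by blast
  show "U \<in> op_domain ak" using UH wH by (simp add: op_domain_def)
  show "AE x in lborel. op_P ak U x = - g x"
    using weak_deriv_eq_AE[OF wH wd L(3)] by eventually_elim (simp add: op_P_def)
qed

text \<open>Passing to absolutely continuous representatives of u and of its flux makes the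
  pointwise Wronskian argument available for an arbitrary element of the domain.\<close>

lemma op_domainD:
  assumes u: "u \<in> op_domain ak" and eq: "AE x in lborel. op_P ak u x - \<mu>\<^sup>2 * u x = f x" and f: "f \<in> L2"
  obtains U V where "abs_cont U (\<lambda>x. V x / of_real (ak x))" "abs_cont V (\<lambda>x. - \<mu>\<^sup>2 * U x - f x)"
    "AE x in lborel. u x = U x" "U \<in> L2" "V \<in> L2"
proof -
  have [measurable]: "ak \<in> borel_measurable borel" by (rule measurable_ak)
  let ?w = "\<lambda>x. of_real (ak x) * weak_deriv u x"
  have uH: "u \<in> H1" and wH: "?w \<in> H1" using u by (auto simp: op_domain_def)
  have L: "u \<in> L2" "?w \<in> L2" using uH wH by (auto simp: H1_def)
  note d = weak_deriv_L2[OF uH] weak_deriv_L2[OF wH]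
  obtain U where U: "abs_cont U (weak_deriv u)" "AE x in lborel. u x = U x"
    using has_weak_deriv_imp_abs_cont[OF d(2) L2_loc_int[OF L(1)] L2_loc_int[OF d(1)]] .
  obtain V where V: "abs_cont V (weak_deriv ?w)" "AE x in lborel. ?w x = V x"
    using has_weak_deriv_imp_abs_cont[OF d(4) L2_loc_int[OF L(2)] L2_loc_int[OF d(3)]] .
  have [measurable]: "U \<in> borel_measurable borel" "V \<in> borel_measurable borel" "f \<in> borel_measurable borel"
    using abs_cont_continuous[OF U(1)] abs_cont_continuous[OF V(1)] f
    by (auto intro: borel_measurable_continuous_onI L2_measurable)
  show ?thesis
  proof
    show "abs_cont U (\<lambda>x. V x / of_real (ak x))"
    proof (rule abs_cont_cong_AE[OF U(1)])
      show "AE x in lborel. weak_deriv u x = V x / of_real (ak x)"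
        using V(2)
      proof eventually_elim
        fix x assume "?w x = V x"
        then show "weak_deriv u x = V x / of_real (ak x)" using ak_pos[of x] by (simp add: field_simps)
      qed
    qed measurable
    show "abs_cont V (\<lambda>x. - \<mu>\<^sup>2 * U x - f x)"
    proof (rule abs_cont_cong_AE[OF V(1)])
      show "AE x in lborel. weak_deriv ?w x = - \<mu>\<^sup>2 * U x - f x"
        using eq U(2)
      proof eventually_elim
        fix x assume "op_P ak u x - \<mu>\<^sup>2 * u x = f x" "u x = U x"
        then have "f x = - weak_deriv ?w x - \<mu>\<^sup>2 * U x" by (simp add: op_P_def)
        then show "weak_deriv ?w x = - \<mu>\<^sup>2 * U x - f x" by simp
      qed
    qed measurable
    show "AE x in lborel. u x = U x" by (rule U(2))
    show "U \<in> L2" by (rule L2_cong_AE[OF L(1) U(2)]) measurable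
    show "V \<in> L2" by (rule L2_cong_AE[OF L(2) V(2)]) measurable
  qed
qed

lemma cmod_exp_iu: "cmod (exp (\<i> * \<mu> * of_real t)) = exp (- Im \<mu> * t)"
  "cmod (exp (- \<i> * \<mu> * of_real t)) = exp (Im \<mu> * t)"
  by (simp_all add: norm_exp_eq_Re)

text \<open>For Im \<mu> > 0 the exponentials decay outwards. The left half-line ends at -1 because
  \<open>pm_left\<close> needs x < 0.\<close>

lemma half_line_L2:
  assumes "Im \<mu> > 0"
  shows "(\<lambda>x. indicator {real k..} x *\<^sub>R pp \<mu> x) \<in> L2" "(\<lambda>x. indicator {real k..} x *\<^sub>R qp \<mu> x) \<in> L2"
    "(\<lambda>x. indicator {..-1} x *\<^sub>R pm \<mu> x) \<in> L2" "(\<lambda>x. indicator {..-1} x *\<^sub>R qm \<mu> x) \<in> L2"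
proof -
  have [measurable]: "pp \<mu> \<in> borel_measurable borel" "qp \<mu> \<in> borel_measurable borel"
      "pm \<mu> \<in> borel_measurable borel" "qm \<mu> \<in> borel_measurable borel"
    by (intro borel_measurable_continuous_onI continuous_pp continuous_pm)+
  let ?c = "2 * Im \<mu> * b1"
  have c: "?c > 0" using assms b1 by simp
  have r: "integrable lborel (\<lambda>x. D * (indicator {real k..} x *\<^sub>R exp (- ?c * x)))"
    and l: "integrable lborel (\<lambda>x. D * (indicator {..-1} x *\<^sub>R exp (?c * x)))" for D :: real
    using integrable_exp_right[OF c, of "real k"] integrable_exp_left[OF c, of "-1"]
    unfolding set_integrable_def by (auto intro!: integrable_mult_right)
  have sq: "(exp t)\<^sup>2 = exp (2 * t)" for t :: real by (simp add: exp_double)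
  show "(\<lambda>x. indicator {real k..} x *\<^sub>R pp \<mu> x) \<in> L2"
    by (rule L2_bound[OF r[of 1]], measurable, rule AE_I2)
       (auto simp: indicator_def pp_right cmod_exp_iu sq mult.assoc simp del: of_real_mult)
  show "(\<lambda>x. indicator {real k..} x *\<^sub>R qp \<mu> x) \<in> L2"
    by (rule L2_bound[OF r[of "1 / b1\<^sup>2"]], measurable, rule AE_I2)
       (auto simp: indicator_def pp_right cmod_exp_iu sq norm_divide power_divide mult.assoc simp del: of_real_mult)
  show "(\<lambda>x. indicator {..-1} x *\<^sub>R pm \<mu> x) \<in> L2"
    by (rule L2_bound[OF l[of 1]], measurable, rule AE_I2)
       (auto simp: indicator_def pm_left cmod_exp_iu[simplified] sq mult.assoc simp del: of_real_mult)
  show "(\<lambda>x. indicator {..-1} x *\<^sub>R qm \<mu> x) \<in> L2"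
    by (rule L2_bound[OF l[of "1 / b1\<^sup>2"]], measurable, rule AE_I2)
       (auto simp: indicator_def pm_left cmod_exp_iu[simplified] sq norm_divide power_divide mult.assoc simp del: of_real_mult)
qed

text \<open>The Wronskian of the given solution with \<open>pp\<close> is constant and integrable
  over the right half-line, hence zero; likewise with \<open>pm\<close> on the left. Since A is
  nonzero, \<open>pp\<close> and \<open>pm\<close> are independent, which leaves only d = 0.\<close>

lemma transport_L2_zero:
  assumes \<mu>: "Im \<mu> > 0" and t: "transport ak \<mu> d e" and L: "d \<in> L2" "e \<in> L2"
  shows "d x = 0"
proof -
  note h = half_line_L2[OF \<mu>]
  have W: "d x * q x - p x * e x = 0"
    if tp: "transport ak \<mu> p q" and A: "A \<in> sets borel" "emeasure lborel A = \<infinity>"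
      and i: "(\<lambda>x. indicator A x *\<^sub>R p x) \<in> L2" "(\<lambda>x. indicator A x *\<^sub>R q x) \<in> L2" for p q A
  proof -
    define C where "C = d x * q x - p x * e x"
    have C: "d y * q y - p y * e y = C" for y
      unfolding C_def by (rule transport_wronskian[OF t tp])
    have "integrable lborel (\<lambda>y. d y * (indicator A y *\<^sub>R q y) - (indicator A y *\<^sub>R p y) * e y)"
      by (intro Bochner_Integration.integrable_diff L2_mult_integrable L i)
    moreover have "d y * (indicator A y *\<^sub>R q y) - (indicator A y *\<^sub>R p y) * e y = indicator A y *\<^sub>R C" for y
      using C[of y] by (auto simp: indicator_def)
    ultimately have "integrable lborel (\<lambda>y. indicator A y *\<^sub>R C)" by simp
    then show ?thesis using integrable_indicator_const_infinite A unfolding C_def by blast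
  qed
  have 1: "d x * qp \<mu> x - pp \<mu> x * e x = 0"
    by (rule W[OF pp_transport _ _ h(1,2)]) (auto simp: emeasure_lborel_half_lines)
  have 2: "d x * qm \<mu> x - pm \<mu> x * e x = 0"
    by (rule W[OF pm_transport _ _ h(3,4)]) (auto simp: emeasure_lborel_half_lines)
  have "d x * (pp \<mu> x * qm \<mu> x - pm \<mu> x * qp \<mu> x)
     = pp \<mu> x * (d x * qm \<mu> x - pm \<mu> x * e x) - pm \<mu> x * (d x * qp \<mu> x - pp \<mu> x * e x)"
    by (simp add: algebra_simps)
  also have "\<dots> = 0" unfolding 1 2 by simp
  finally show ?thesis
    unfolding wronskian using cA_nonzero[of \<mu>] \<mu> b1 by simp
qed

section \<open>The kernel operator solves the resolvent equation\<close>

text \<open>Chosen so that \<open>cR \<mu>\<close> times the Wronskian of \<open>pp\<close> and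
  \<open>pm\<close> is -i/\<mu>, which yields the source term -f in the equation of the flux. At 0
  and at the zeros of \<open>cA\<close> it takes the default value 0; polar parts do not see values
  at single points.\<close>

definition cR :: "complex \<Rightarrow> complex" where "cR \<mu> = \<i> * of_real b1 / (2 * \<mu> * cA \<mu>)"

definition kern :: "complex \<Rightarrow> real \<Rightarrow> real \<Rightarrow> complex" where
  "kern \<mu> x y = pp \<mu> (max x y) * pm \<mu> (min x y)"

definition Rop :: "complex \<Rightarrow> fun_op" where
  "Rop \<mu> f x = cR \<mu> * (LINT y|lborel. kern \<mu> x y * f y)"

lemma Rop_eq:
  assumes f: "f \<in> L2_comp"
  shows "Rop \<mu> f x = cR \<mu> * (pp \<mu> x * (LINT y:{..x}|lborel. pm \<mu> y * f y)
     + pm \<mu> x * (LINT y:{x<..}|lborel. pp \<mu> y * f y))"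
proof -
  have i: "integrable lborel (\<lambda>y. pm \<mu> y * f y)" "integrable lborel (\<lambda>y. pp \<mu> y * f y)"
    using L2_comp_mult_integrable[OF f] continuous_pp continuous_pm by auto
  have g: "integrable lborel (\<lambda>y. indicator {..x} y *\<^sub>R (pm \<mu> y * f y))"
    "integrable lborel (\<lambda>y. indicator {x<..} y *\<^sub>R (pp \<mu> y * f y))"
    by (intro integrable_mult_indicator i; simp)+
  have "(LINT y|lborel. kern \<mu> x y * f y) = (LINT y|lborel. pp \<mu> x * (indicator {..x} y *\<^sub>R (pm \<mu> y * f y))
      + pm \<mu> x * (indicator {x<..} y *\<^sub>R (pp \<mu> y * f y)))"
    by (rule Bochner_Integration.integral_cong) (auto simp: kern_def indicator_def max_def min_def)
  also have "\<dots> = pp \<mu> x * (LINT y:{..x}|lborel. pm \<mu> y * f y)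
     + pm \<mu> x * (LINT y:{x<..}|lborel. pp \<mu> y * f y)"
    unfolding set_lebesgue_integral_def
    by (subst Bochner_Integration.integral_add[OF integrable_mult_right[OF g(1)] integrable_mult_right[OF g(2)]])
       (simp only: integral_mult_right_zero)
  finally show ?thesis by (simp add: Rop_def)
qed

text \<open>Variation of constants: the terms with \<open>f\<close> cancel in the derivative of
  \<open>u\<close> and combine to the Wronskian in that of \<open>q\<close>. Outside the support of
  \<open>f\<close> both are multiples of a decaying exponential, hence square integrable.\<close>

lemma Rop_solves:
  assumes \<mu>: "Im \<mu> > 0" and f: "f \<in> L2_comp"
  obtains V where "abs_cont (Rop \<mu> f) (\<lambda>x. V x / of_real (ak x))"
    "abs_cont V (\<lambda>x. - \<mu>\<^sup>2 * Rop \<mu> f x - f x)" "Rop \<mu> f \<in> L2" "V \<in> L2"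
proof -
  have mu0: "\<mu> \<noteq> 0" using \<mu> by auto
  have A0: "cA \<mu> \<noteq> 0" using cA_nonzero \<mu> by simp
  have b0: "complex_of_real b1 \<noteq> 0" using b1 by simp
  define F G where "F x = (LINT y:{..x}|lborel. pm \<mu> y * f y)"
    and "G x = (LINT y:{x<..}|lborel. pp \<mu> y * f y)" for x
  have i: "integrable lborel (\<lambda>y. pm \<mu> y * f y)" "integrable lborel (\<lambda>y. pp \<mu> y * f y)"
    using L2_comp_mult_integrable[OF f] continuous_pp continuous_pm by auto
  have FG: "abs_cont F (\<lambda>x. pm \<mu> x * f x)" "abs_cont G (\<lambda>x. - (pp \<mu> x * f x))"
    unfolding F_def[abs_def] G_def[abs_def] by (rule abs_cont_integral[OF i(1)], rule abs_cont_integral[OF i(2)])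
  define u q where "u x = cR \<mu> * (pp \<mu> x * F x + pm \<mu> x * G x)"
    and "q x = cR \<mu> * (qp \<mu> x * F x + qm \<mu> x * G x)" for x
  have Ru: "Rop \<mu> f = u" by (auto simp: Rop_eq[OF f] u_def F_def G_def)
  have t: "abs_cont (pp \<mu>) (\<lambda>x. \<i> * \<mu> * qp \<mu> x / of_real (ak x))" "abs_cont (qp \<mu>) (\<lambda>x. \<i> * \<mu> * pp \<mu> x)"
    "abs_cont (pm \<mu>) (\<lambda>x. \<i> * \<mu> * qm \<mu> x / of_real (ak x))" "abs_cont (qm \<mu>) (\<lambda>x. \<i> * \<mu> * pm \<mu> x)"
    using pp_transport[of \<mu>] pm_transport[of \<mu>] by (auto simp: transport_def)
  have "abs_cont u (\<lambda>x. cR \<mu> * ((\<i> * \<mu> * qp \<mu> x / of_real (ak x) * F x + pp \<mu> x * (pm \<mu> x * f x))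
      + (\<i> * \<mu> * qm \<mu> x / of_real (ak x) * G x + pm \<mu> x * (- (pp \<mu> x * f x)))))"
    unfolding u_def[abs_def] by (intro abs_cont_cmult abs_cont_add abs_cont_mult t FG)
  moreover have "cR \<mu> * ((\<i> * \<mu> * qp \<mu> x / of_real (ak x) * F x + pp \<mu> x * (pm \<mu> x * f x))
      + (\<i> * \<mu> * qm \<mu> x / of_real (ak x) * G x + pm \<mu> x * (- (pp \<mu> x * f x))))
      = \<i> * \<mu> * q x / of_real (ak x)" for x
    using ak_pos[of x] by (simp add: q_def field_simps)
  ultimately have ac_u: "abs_cont u (\<lambda>x. \<i> * \<mu> * q x / of_real (ak x))" by simp
  have "abs_cont q (\<lambda>x. cR \<mu> * ((\<i> * \<mu> * pp \<mu> x * F x + qp \<mu> x * (pm \<mu> x * f x))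
      + (\<i> * \<mu> * pm \<mu> x * G x + qm \<mu> x * (- (pp \<mu> x * f x)))))"
    unfolding q_def[abs_def] by (intro abs_cont_cmult abs_cont_add abs_cont_mult t FG)
  moreover have "cR \<mu> * ((\<i> * \<mu> * pp \<mu> x * F x + qp \<mu> x * (pm \<mu> x * f x))
      + (\<i> * \<mu> * pm \<mu> x * G x + qm \<mu> x * (- (pp \<mu> x * f x))))
      = \<i> * \<mu> * u x + \<i> / \<mu> * f x" for x
  proof -
    have "cR \<mu> * ((\<i> * \<mu> * pp \<mu> x * F x + qp \<mu> x * (pm \<mu> x * f x))
      + (\<i> * \<mu> * pm \<mu> x * G x + qm \<mu> x * (- (pp \<mu> x * f x))))
      = \<i> * \<mu> * u x - cR \<mu> * (pp \<mu> x * qm \<mu> x - pm \<mu> x * qp \<mu> x) * f x"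
      by (simp add: u_def algebra_simps)
    also have "cR \<mu> * (pp \<mu> x * qm \<mu> x - pm \<mu> x * qp \<mu> x) = - \<i> / \<mu>"
      unfolding wronskian cR_def using mu0 A0 b0 by (simp add: field_simps)
    finally show ?thesis by simp
  qed
  ultimately have ac_q: "abs_cont q (\<lambda>x. \<i> * \<mu> * u x + \<i> / \<mu> * f x)" by simp
  define V where "V x = \<i> * \<mu> * q x" for x
  have "abs_cont V (\<lambda>x. \<i> * \<mu> * (\<i> * \<mu> * u x + \<i> / \<mu> * f x))"
    unfolding V_def[abs_def] by (rule abs_cont_cmult[OF ac_q])
  moreover have "\<i> * \<mu> * (\<i> * \<mu> * u x + \<i> / \<mu> * f x) = - \<mu>\<^sup>2 * u x - f x" for x
    using mu0 by (simp add: algebra_simps power2_eq_square)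
  ultimately have acV: "abs_cont V (\<lambda>x. - \<mu>\<^sup>2 * u x - f x)" by simp
  obtain N where N: "f \<in> L2" "AE x in lborel. \<bar>x\<bar> > N \<longrightarrow> f x = 0" "N \<ge> real k + 1"
    using L2_compD[OF f] .
  have [measurable]: "f \<in> borel_measurable borel" "pp \<mu> \<in> borel_measurable borel" "pm \<mu> \<in> borel_measurable borel"
    using L2_measurable[OF N(1)] by (auto intro: borel_measurable_continuous_onI continuous_pp continuous_pm)
  note zero = set_integral_zero_AE[OF N(2)]
  define T1 T2 where "T1 = (LINT y|lborel. pm \<mu> y * f y)" and "T2 = (LINT y|lborel. pp \<mu> y * f y)"
  have G0: "G x = 0" if "x \<ge> N" for x unfolding G_def using that by (intro zero) auto
  \<comment> \<open>The closed half-line {..-N} still contains a point with |y| = N, hence the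
    margin 1 on the left; the open half-lines {x<..} need none.\<close>
  have F0: "F x = 0" if "x \<le> -N - 1" for x unfolding F_def using that by (intro zero) auto
  have F1: "F x = T1" if "x \<ge> N" for x
  proof -
    have "(LINT y:{x<..}|lborel. pm \<mu> y * f y) = 0" using that by (intro zero) auto
    then show ?thesis using integral_split_at[OF i(1), of x] by (simp add: F_def T1_def)
  qed
  have G1: "G x = T2" if "x \<le> -N - 1" for x
  proof -
    have "(LINT y:{..x}|lborel. pp \<mu> y * f y) = 0" using that by (intro zero) auto
    then show ?thesis using integral_split_at[OF i(2), of x] by (simp add: G_def T2_def)
  qed
  let ?c = "2 * Im \<mu> * b1"
  have c: "?c > 0" using \<mu> b1 by simp
  have sq: "(exp t)\<^sup>2 = exp (2 * t)" for t :: real by (simp add: exp_double)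
  have tails: "w \<in> L2"
    if "continuous_on UNIV w" and r: "\<And>x. x \<ge> N + 1 \<Longrightarrow> w x = C * wave_p \<mu> x"
      and l: "\<And>x. x \<le> - (N + 1) \<Longrightarrow> w x = D * wave_m \<mu> x" for w C D
  proof (rule L2_tails[OF that(1) c])
    show "(cmod (w x))\<^sup>2 \<le> (cmod C)\<^sup>2 * exp (- ?c * x)" if "x \<ge> N + 1" for x
      unfolding r[OF that]
      by (simp add: norm_mult cmod_exp_iu power_mult_distrib sq mult.assoc del: of_real_mult)
    show "(cmod (w x))\<^sup>2 \<le> (cmod D)\<^sup>2 * exp (?c * x)" if "x \<le> - (N + 1)" for x
      unfolding l[OF that]
      by (simp add: norm_mult cmod_exp_iu[simplified] power_mult_distrib sq mult.assoc del: of_real_mult)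
  qed
  have uL: "u \<in> L2"
    by (rule tails[OF abs_cont_continuous[OF ac_u], of "cR \<mu> * T1" "cR \<mu> * T2"])
       (use N(3) in \<open>simp_all add: u_def F1 G0 F0 G1 pp_right pm_left\<close>)
  have qL: "q \<in> L2"
    by (rule tails[OF abs_cont_continuous[OF ac_q], of "cR \<mu> * T1 / of_real b1" "- cR \<mu> * T2 / of_real b1"])
       (use N(3) in \<open>simp_all add: q_def F1 G0 F0 G1 pp_right pm_left\<close>)
  show ?thesis
  proof (rule that)
    show "abs_cont (Rop \<mu> f) (\<lambda>x. V x / of_real (ak x))" using ac_u by (simp add: Ru V_def)
    show "abs_cont V (\<lambda>x. - \<mu>\<^sup>2 * Rop \<mu> f x - f x)" using acV by (simp add: Ru)
    show "Rop \<mu> f \<in> L2" using uL by (simp add: Ru)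
    show "V \<in> L2" unfolding V_def[abs_def] by (rule L2_cmult[OF qL])
  qed
qed

text \<open>The kernel operator provides the existence without which the choice in
  \<open>resolvent\<close> would say nothing. The difference of the two solutions, with the
  difference of the fluxes divided by i \<mu>, is a square integrable solution of the homogeneous
  system.\<close>

lemma Rop_eq_resolvent:
  assumes \<mu>: "Im \<mu> > 0" and f: "f \<in> L2_comp"
  shows "AE x in lborel. Rop \<mu> f x = resolvent ak \<mu> f x"
proof -
  have mu0: "\<mu> \<noteq> 0" using \<mu> by auto
  have fL: "f \<in> L2" using f by (auto simp: L2_comp_def)
  obtain V where V: "abs_cont (Rop \<mu> f) (\<lambda>x. V x / of_real (ak x))"
    "abs_cont V (\<lambda>x. - \<mu>\<^sup>2 * Rop \<mu> f x - f x)" "Rop \<mu> f \<in> L2" "V \<in> L2"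
    using Rop_solves[OF \<mu> f] .
  have gL: "(\<lambda>x. - \<mu>\<^sup>2 * Rop \<mu> f x - f x) \<in> L2" by (intro L2_diff L2_cmult V fL)
  have "AE x in lborel. op_P ak (Rop \<mu> f) x - \<mu>\<^sup>2 * Rop \<mu> f x = f x"
    using op_domainI(2)[OF V gL] by eventually_elim simp
  then have ex: "\<exists>u. u \<in> op_domain ak \<and> (AE x in lborel. op_P ak u x - \<mu>\<^sup>2 * u x = f x)"
    using op_domainI(1)[OF V gL] by blast
  from someI_ex[OF ex] have r: "resolvent ak \<mu> f \<in> op_domain ak"
    "AE x in lborel. op_P ak (resolvent ak \<mu> f) x - \<mu>\<^sup>2 * resolvent ak \<mu> f x = f x"
    unfolding resolvent_def by auto
  obtain U W where U: "abs_cont U (\<lambda>x. W x / of_real (ak x))" "abs_cont W (\<lambda>x. - \<mu>\<^sup>2 * U x - f x)"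
    "AE x in lborel. resolvent ak \<mu> f x = U x" "U \<in> L2" "W \<in> L2"
    using op_domainD[OF r fL] .
  define d e where "d x = U x - Rop \<mu> f x" and "e x = 1 / (\<i> * \<mu>) * (W x - V x)" for x
  have "transport ak \<mu> d e"
    unfolding transport_def
  proof
    have "abs_cont d (\<lambda>x. W x / of_real (ak x) - V x / of_real (ak x))"
      unfolding d_def[abs_def] by (rule abs_cont_sub[OF U(1) V(1)])
    moreover have "\<i> * \<mu> * e x = W x - V x" for x using mu0 by (simp add: e_def)
    then have "W x / of_real (ak x) - V x / of_real (ak x) = \<i> * \<mu> * e x / of_real (ak x)" for x
      by (simp add: diff_divide_distrib)
    ultimately show "abs_cont d (\<lambda>x. \<i> * \<mu> * e x / of_real (ak x))" by simp
    have "abs_cont e (\<lambda>x. 1 / (\<i> * \<mu>) * ((- \<mu>\<^sup>2 * U x - f x) - (- \<mu>\<^sup>2 * Rop \<mu> f x - f x)))"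
      unfolding e_def[abs_def] by (rule abs_cont_cmult[OF abs_cont_sub[OF U(2) V(2)]])
    moreover have "1 / (\<i> * \<mu>) * ((- \<mu>\<^sup>2 * U x - f x) - (- \<mu>\<^sup>2 * Rop \<mu> f x - f x)) = \<i> * \<mu> * d x" for x
      using mu0 by (simp add: d_def field_simps power2_eq_square)
    ultimately show "abs_cont e (\<lambda>x. \<i> * \<mu> * d x)" by simp
  qed
  moreover have "d \<in> L2" unfolding d_def[abs_def] by (intro L2_diff U V)
  moreover have "e \<in> L2" unfolding e_def[abs_def] by (intro L2_cmult L2_diff U V)
  ultimately have "d x = 0" for x by (rule transport_L2_zero[OF \<mu>])
  then have UR: "U x = Rop \<mu> f x" for x by (simp add: d_def)
  show ?thesis using U(3) by eventually_elim (simp add: UR)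
qed

end

section \<open>Analytic families of integral operators\<close>

definition Kop :: "(real \<Rightarrow> real \<Rightarrow> complex) \<Rightarrow> fun_op" where
  "Kop K f x = (LINT y|lborel. K x y * f y)"

definition kernel_bound :: "real \<Rightarrow> (real \<Rightarrow> real \<Rightarrow> complex) \<Rightarrow> real \<Rightarrow> bool" where
  "kernel_bound N K C \<longleftrightarrow> 0 \<le> N \<and> 0 \<le> C \<and>
     (\<lambda>z. K (fst z) (snd z)) \<in> borel_measurable lborel2 \<and>
     (\<forall>x y. x \<notin> {-N..N} \<or> y \<notin> {-N..N} \<longrightarrow> K x y = 0) \<and> (\<forall>x y. cmod (K x y) \<le> C)"

lemma kernel_boundD:
  assumes "kernel_bound N K C"
  shows "0 \<le> N" "0 \<le> C" "(\<lambda>z. K (fst z) (snd z)) \<in> borel_measurable lborel2"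
    "\<And>x y. x \<notin> {-N..N} \<Longrightarrow> K x y = 0" "\<And>x y. y \<notin> {-N..N} \<Longrightarrow> K x y = 0" "\<And>x y. cmod (K x y) \<le> C"
  using assms by (auto simp: kernel_bound_def)

lemma L2_norm_square: "f \<in> L2 \<Longrightarrow> (L2_norm f)\<^sup>2 = (LINT x|lborel. (cmod (f x))\<^sup>2)"
  and L2_norm_nonneg: "L2_norm f \<ge> 0"
  unfolding L2_norm_def by (auto intro!: Bochner_Integration.integral_nonneg)

lemma L2_restrict_integrable:
  assumes "f \<in> L2" shows "integrable lborel (\<lambda>y. indicator {-N..N} y *\<^sub>R f y)"
  using L2_loc_int[OF assms] by (auto simp: loc_int_def set_integrable_def)

lemma kernel_section_measurable:
  assumes "kernel_bound N K C" shows "(\<lambda>y. K x y) \<in> borel_measurable borel"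
proof -
  have "(\<lambda>y. (\<lambda>z. K (fst z) (snd z)) (x, y)) \<in> borel_measurable lborel"
    by (rule measurable_compose[OF _ kernel_boundD(3)[OF assms]]) measurable
  then show ?thesis by simp
qed

lemma kernel_norm_le:
  assumes "kernel_bound N K C"
  shows "cmod (K x y * f y) \<le> C * cmod (indicator {-N..N} y *\<^sub>R f y)"
  using kernel_boundD(5,6)[OF assms] by (cases "y \<in> {-N..N}") (auto simp: norm_mult mult_right_mono)

lemma kernel_integrable:
  assumes k: "kernel_bound N K C" and f: "f \<in> L2"
  shows "integrable lborel (\<lambda>y. K x y * f y)"
proof (rule Bochner_Integration.integrable_bound)
  show "integrable lborel (\<lambda>y. C * cmod (indicator {-N..N} y *\<^sub>R f y))"
    by (intro integrable_mult_right integrable_norm L2_restrict_integrable f)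
  show "(\<lambda>y. K x y * f y) \<in> borel_measurable lborel"
    using kernel_section_measurable[OF k] L2_measurable[OF f] by auto
  show "AE y in lborel. norm (K x y * f y) \<le> norm (C * cmod (indicator {-N..N} y *\<^sub>R f y))"
    using kernel_norm_le[OF k] kernel_boundD(2)[OF k] by (intro AE_I2) (simp add: abs_mult)
qed

text \<open>Instead of the Cauchy-Schwarz inequality, |f| \<le> |f|^2/(2F) + F/2 with F the norm of
  f. The first term contributes F/2 over the line, the second N F over [-N, N]; this is the constant
  1/2 + N.\<close>

lemma L2_restrict_bound:
  assumes f: "f \<in> L2" and N: "N \<ge> 0"
  shows "(LINT y|lborel. cmod (indicator {-N..N} y *\<^sub>R f y)) \<le> (1 / 2 + N) * L2_norm f"
proof (cases "L2_norm f = 0")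
  case True
  then have "(LINT x|lborel. (cmod (f x))\<^sup>2) = 0" using L2_norm_square[OF f] by simp
  then have "AE x in lborel. (cmod (f x))\<^sup>2 = 0"
    by (subst (asm) integral_nonneg_eq_0_iff_AE) (auto intro: L2_square_integrable[OF f])
  then have "AE x in lborel. cmod (indicator {-N..N} x *\<^sub>R f x) = 0" by eventually_elim auto
  then have "(LINT y|lborel. cmod (indicator {-N..N} y *\<^sub>R f y)) = 0" by (rule integral_eq_zero_AE)
  then show ?thesis using True by simp
next
  case False
  define F where "F = L2_norm f"
  have F: "F > 0" using False L2_norm_nonneg[of f] by (simp add: F_def)
  have i: "integrable lborel (\<lambda>x. indicat_real {-N..N} x)"
    using emeasure_lborel_Icc_eq[of "-N" N] by (auto simp: integrable_indicator_iff)
  have "(LINT y|lborel. cmod (indicator {-N..N} y *\<^sub>R f y))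
     \<le> (LINT y|lborel. (cmod (f y))\<^sup>2 / (2 * F) + F / 2 * indicat_real {-N..N} y)"
  proof (rule integral_mono)
    show "integrable lborel (\<lambda>y. cmod (indicator {-N..N} y *\<^sub>R f y))"
      by (intro integrable_norm L2_restrict_integrable f)
    show "integrable lborel (\<lambda>y. (cmod (f y))\<^sup>2 / (2 * F) + F / 2 * indicat_real {-N..N} y)"
      using i L2_square_integrable[OF f] by auto
    fix y
    have "0 \<le> (cmod (f y) - F)\<^sup>2" by simp
    then have "2 * F * cmod (f y) \<le> (cmod (f y))\<^sup>2 + F\<^sup>2" by (simp add: power2_eq_square algebra_simps)
    then have "cmod (f y) \<le> (cmod (f y))\<^sup>2 / (2 * F) + F / 2"
      using F by (simp add: field_simps power2_eq_square)
    then show "cmod (indicator {-N..N} y *\<^sub>R f y) \<le> (cmod (f y))\<^sup>2 / (2 * F) + F / 2 * indicat_real {-N..N} y"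
      using F by (auto simp: indicator_def)
  qed
  also have "\<dots> = (LINT y|lborel. (cmod (f y))\<^sup>2 / (2 * F)) + (LINT y|lborel. F / 2 * indicat_real {-N..N} y)"
    using i L2_square_integrable[OF f] by (intro Bochner_Integration.integral_add) auto
  also have "\<dots> = F\<^sup>2 / (2 * F) + F / 2 * (2 * N)"
    using N L2_norm_square[OF f] by (simp add: F_def)
  also have "\<dots> = (1 / 2 + N) * F" using F by (simp add: field_simps power2_eq_square)
  finally show ?thesis by (simp add: F_def)
qed

lemma Kop_pointwise_bound:
  assumes k: "kernel_bound N K C" and f: "f \<in> L2"
  shows "cmod (Kop K f x) \<le> C * ((1 / 2 + N) * L2_norm f) * indicator {-N..N} x"
proof (cases "x \<in> {-N..N}")
  case True
  have "cmod (Kop K f x) \<le> (LINT y|lborel. cmod (K x y * f y))"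
    unfolding Kop_def by (rule integral_norm_bound)
  also have "\<dots> \<le> (LINT y|lborel. C * cmod (indicator {-N..N} y *\<^sub>R f y))"
    by (intro integral_mono integrable_norm kernel_integrable[OF k f] integrable_mult_right
        L2_restrict_integrable f kernel_norm_le[OF k])
  also have "\<dots> = C * (LINT y|lborel. cmod (indicator {-N..N} y *\<^sub>R f y))" by (rule integral_mult_right_zero)
  also have "\<dots> \<le> C * ((1 / 2 + N) * L2_norm f)"
    by (intro mult_left_mono L2_restrict_bound f kernel_boundD[OF k])
  finally show ?thesis using True by simp
next
  case False
  then have "Kop K f x = 0" using kernel_boundD(4)[OF k] by (simp add: Kop_def)
  then show ?thesis using False by simp
qed

lemma Kop_measurable:
  assumes k: "kernel_bound N K C" and f: "f \<in> L2"
  shows "Kop K f \<in> borel_measurable borel"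
proof -
  have [measurable]: "f \<in> borel_measurable borel" by (rule L2_measurable[OF f])
  have [measurable]: "(\<lambda>z. K (fst z) (snd z)) \<in> borel_measurable lborel2"
    by (rule kernel_boundD(3)[OF k])
  have "(\<lambda>z. K (fst z) (snd z) * f (snd z)) \<in> borel_measurable lborel2" by measurable
  then have "(\<lambda>(x, y). K x y * f y) \<in> borel_measurable lborel2" by (simp add: case_prod_beta')
  from lborel.borel_measurable_lebesgue_integral[OF this]
  show ?thesis unfolding Kop_def[abs_def] by simp
qed

text \<open>The factor of the pointwise bound on [-N, N] times the L^2 norm of the indicator of that
  interval.\<close>

definition norm_const :: "real \<Rightarrow> real" where "norm_const N = (1 / 2 + N) * sqrt (2 * N)"

lemma norm_const_nonneg: "N \<ge> 0 \<Longrightarrow> norm_const N \<ge> 0"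
  by (simp add: norm_const_def)

lemma Kop_op_bound:
  assumes k: "kernel_bound N K C"
  shows "op_bound (Kop K) (C * norm_const N)"
  unfolding op_bound_def
proof (intro ballI conjI)
  fix f assume f: "f \<in> L2"
  define M where "M = C * ((1 / 2 + N) * L2_norm f)"
  have N: "N \<ge> 0" "C \<ge> 0" using kernel_boundD[OF k] by auto
  then have M: "M \<ge> 0" using L2_norm_nonneg[of f] by (simp add: M_def)
  have i: "integrable lborel (\<lambda>x. M\<^sup>2 * indicat_real {-N..N} x)"
    using emeasure_lborel_Icc_eq[of "-N" N] by (auto simp: integrable_indicator_iff)
  have b: "(cmod (Kop K f x))\<^sup>2 \<le> M\<^sup>2 * indicat_real {-N..N} x" for x
  proof -
    have "(cmod (Kop K f x))\<^sup>2 \<le> (M * indicator {-N..N} x)\<^sup>2"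
      unfolding M_def by (intro power_mono Kop_pointwise_bound[OF k f]) auto
    then show ?thesis by (auto simp: indicator_def)
  qed
  show L: "Kop K f \<in> L2" by (rule L2_bound[OF i Kop_measurable[OF k f]]) (use b in auto)
  have "(L2_norm (Kop K f))\<^sup>2 = (LINT x|lborel. (cmod (Kop K f x))\<^sup>2)" by (rule L2_norm_square[OF L])
  also have "\<dots> \<le> (LINT x|lborel. M\<^sup>2 * indicat_real {-N..N} x)"
    by (intro integral_mono L2_square_integrable L i b)
  also have "\<dots> = (M * sqrt (2 * N))\<^sup>2" using N by (simp add: power_mult_distrib)
  finally have "L2_norm (Kop K f) \<le> M * sqrt (2 * N)"
    using M N by (auto intro: power2_le_imp_le)
  then show "L2_norm (Kop K f) \<le> C * norm_const N * L2_norm f" by (simp add: M_def norm_const_def mult_ac)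
qed

lemma Kop_bounded_op: assumes k: "kernel_bound N K C" shows "bounded_op (Kop K)"
  unfolding bounded_op_def
proof (intro conjI ballI allI AE_I2)
  show "\<exists>C. op_bound (Kop K) C" using Kop_op_bound[OF k] by blast
  fix f g c d x assume fg: "f \<in> L2" "g \<in> L2"
  have "Kop K (\<lambda>y. c * f y + d * g y) x = (LINT y|lborel. c * (K x y * f y) + d * (K x y * g y))"
    by (simp add: Kop_def algebra_simps)
  also have "\<dots> = c * Kop K f x + d * Kop K g x"
    unfolding Kop_def
    by (subst Bochner_Integration.integral_add[OF integrable_mult_right[OF kernel_integrable[OF k fg(1)]]
          integrable_mult_right[OF kernel_integrable[OF k fg(2)]]]) (simp only: integral_mult_right_zero)
  finally show "Kop K (\<lambda>y. c * f y + d * g y) x = c * Kop K f x + d * Kop K g x" .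
qed

lemma Kop_cmult: "Kop (\<lambda>x y. c * K x y) f x = c * Kop K f x"
  unfolding Kop_def mult.assoc by (rule integral_mult_right_zero)

lemma Kop_add:
  assumes "kernel_bound N K C" "kernel_bound N K' C'" "f \<in> L2"
  shows "Kop (\<lambda>x y. K x y + K' x y) f x = Kop K f x + Kop K' f x"
  unfolding Kop_def distrib_right
  by (rule Bochner_Integration.integral_add) (rule kernel_integrable[OF assms(1,3)] kernel_integrable[OF assms(2,3)])+

lemma kernel_bound_cmult: "kernel_bound N K C \<Longrightarrow> kernel_bound N (\<lambda>x y. c * K x y) (cmod c * C)"
  by (auto simp: kernel_bound_def norm_mult mult_left_mono)

section \<open>Divided differences of kernels and meromorphic families\<close>

text \<open>One constant serves the whole of \<open>U\<close> and all x and y. Vanishing outside the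
  window is asked for every \<mu>, so that the derivative inside \<open>ddiff\<close> is that of a
  zero function there.\<close>

definition kernel_family :: "real \<Rightarrow> complex set \<Rightarrow> (complex \<Rightarrow> real \<Rightarrow> real \<Rightarrow> complex) \<Rightarrow> real \<Rightarrow> bool" where
  "kernel_family N U k C \<longleftrightarrow> (\<forall>\<mu>\<in>U. kernel_bound N (k \<mu>) C) \<and>
     (\<forall>x y. (\<lambda>\<mu>. k \<mu> x y) holomorphic_on U) \<and>
     (\<forall>\<mu> x y. x \<notin> {-N..N} \<or> y \<notin> {-N..N} \<longrightarrow> k \<mu> x y = 0)"

text \<open>With the derivative filled in at the centre, the first order expansion
  \<open>ddiff_eq\<close> is exact and its remainder is again a holomorphic family, so the expansion
  can be iterated.\<close>

definition ddiff :: "complex \<Rightarrow> (complex \<Rightarrow> real \<Rightarrow> real \<Rightarrow> complex) \<Rightarrow> complex \<Rightarrow> real \<Rightarrow> real \<Rightarrow> complex" where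
  "ddiff z k \<mu> x y = (if \<mu> = z then deriv (\<lambda>w. k w x y) z else (k \<mu> x y - k z x y) / (\<mu> - z))"

lemma ddiff_eq: "k \<mu> x y = k z x y + (\<mu> - z) * ddiff z k \<mu> x y"
  by (simp add: ddiff_def)

text \<open>Boundedness of the divided difference near its centre comes from the maximum principle.\<close>

lemma kernel_family_ddiff:
  assumes k: "kernel_family N U k C" and U: "open U" and z: "z \<in> U"
  obtains C' where "kernel_family N U (ddiff z k) C'"
proof -
  obtain r where r: "r > 0" "cball z r \<subseteq> U" using U z open_contains_cball by blast
  have kb: "kernel_bound N (k \<mu>) C" if "\<mu> \<in> U" for \<mu> using k that by (auto simp: kernel_family_def)
  have hol: "(\<lambda>\<mu>. k \<mu> x y) holomorphic_on U" for x y using k by (auto simp: kernel_family_def)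
  have supp: "k \<mu> x y = 0" if "x \<notin> {-N..N} \<or> y \<notin> {-N..N}" for \<mu> x y
    using k that by (auto simp: kernel_family_def)
  have hd: "(\<lambda>\<mu>. ddiff z k \<mu> x y) holomorphic_on U" for x y
    unfolding ddiff_def by (rule pole_lemma_open[OF hol U])
  have sd: "ddiff z k \<mu> x y = 0" if "x \<notin> {-N..N} \<or> y \<notin> {-N..N}" for \<mu> x y
    using supp[OF that] by (simp add: ddiff_def)
  have C: "C \<ge> 0" "N \<ge> 0" using kernel_boundD[OF kb[OF z]] by auto
  \<comment> \<open>At distance at least r from the centre the quotient itself has this bound; the
    frontier points used in \<open>near\<close> are among these.\<close>
  have far: "cmod (ddiff z k \<mu> x y) \<le> 2 * C / r" if "\<mu> \<in> U" "dist z \<mu> \<ge> r" for \<mu> x y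
  proof -
    have "\<mu> \<noteq> z" using that r by auto
    then have "cmod (ddiff z k \<mu> x y) = cmod (k \<mu> x y - k z x y) / dist z \<mu>"
      by (simp add: ddiff_def norm_divide dist_norm norm_minus_commute)
    also have "\<dots> \<le> (C + C) / r"
      using kernel_boundD(6)[OF kb[OF that(1)], of x y] kernel_boundD(6)[OF kb[OF z], of x y] r that C
      by (intro frac_le) (auto intro!: order_trans[OF norm_triangle_ineq4] add_mono)
    finally show ?thesis by simp
  qed
  have near: "cmod (ddiff z k \<mu> x y) \<le> 2 * C / r" if "dist z \<mu> < r" for \<mu> x y
  proof (rule maximum_modulus_frontier[where S = "ball z r" and f = "\<lambda>\<mu>. ddiff z k \<mu> x y" and \<xi> = \<mu>])
    show "(\<lambda>\<mu>. ddiff z k \<mu> x y) holomorphic_on interior (ball z r)"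
      using hd holomorphic_on_subset r ball_subset_cball by (metis interior_subset order_trans)
    have "continuous_on U (\<lambda>\<mu>. ddiff z k \<mu> x y)" by (rule holomorphic_on_imp_continuous_on[OF hd])
    then show "continuous_on (closure (ball z r)) (\<lambda>\<mu>. ddiff z k \<mu> x y)"
      using r by (auto intro: continuous_on_subset)
    show "cmod (ddiff z k w x y) \<le> 2 * C / r" if "w \<in> frontier (ball z r)" for w
      using that r by (intro far) auto
  qed (use that in auto)
  have bd: "cmod (ddiff z k \<mu> x y) \<le> 2 * C / r" if "\<mu> \<in> U" for \<mu> x y
    using near far that by (cases "dist z \<mu> < r") auto
  have meas_ne: "(\<lambda>p. ddiff z k \<mu> (fst p) (snd p)) \<in> borel_measurable lborel2"
    if "\<mu> \<in> U" "\<mu> \<noteq> z" for \<mu>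
  proof -
    note [measurable] = kernel_boundD(3)[OF kb[OF that(1)]] kernel_boundD(3)[OF kb[OF z]]
    show ?thesis using that(2) by (simp add: ddiff_def) measurable
  qed
  have meas: "(\<lambda>p. ddiff z k \<mu> (fst p) (snd p)) \<in> borel_measurable lborel2" if "\<mu> \<in> U" for \<mu>
  proof (cases "\<mu> = z")
    case True
    \<comment> \<open>The kernel at the centre is a pointwise limit of difference quotients along a
      sequence, which makes it jointly measurable in both space variables.\<close>
    have "z islimpt U" by (rule interior_limit_point) (use U z in \<open>simp add: interior_open\<close>)
    then obtain w where w: "\<And>n. w n \<in> U - {z}" and wl: "w \<longlonglongrightarrow> z"
      unfolding islimpt_sequential by blast
    show ?thesis
    proof (rule borel_measurable_LIMSEQ_metric)
      show "(\<lambda>p. ddiff z k (w n) (fst p) (snd p)) \<in> borel_measurable lborel2" for n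
        using w[of n] by (intro meas_ne) auto
      fix p :: "real \<times> real"
      have "isCont (\<lambda>\<mu>. ddiff z k \<mu> (fst p) (snd p)) z"
        using holomorphic_on_imp_continuous_on[OF hd] U z continuous_on_eq_continuous_at by blast
      from isCont_tendsto_compose[OF this wl]
      show "(\<lambda>n. ddiff z k (w n) (fst p) (snd p)) \<longlonglongrightarrow> ddiff z k \<mu> (fst p) (snd p)" using True by simp
    qed
  qed (rule meas_ne[OF that])
  have "kernel_family N U (ddiff z k) (2 * C / r)"
    unfolding kernel_family_def kernel_bound_def using meas bd sd hd C r by auto
  then show ?thesis using that by blast
qed

lemma Kop_ddiff:
  assumes k: "kernel_family N U k C" and U: "open U" and z: "z \<in> U" and \<mu>: "\<mu> \<in> U" and f: "f \<in> L2"
  shows "Kop (k \<mu>) f x = Kop (k z) f x + (\<mu> - z) * Kop (ddiff z k \<mu>) f x"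
proof -
  obtain C' where d: "kernel_family N U (ddiff z k) C'" using kernel_family_ddiff[OF k U z] .
  have b: "kernel_bound N (k z) C" "kernel_bound N (ddiff z k \<mu>) C'"
    using k d z \<mu> by (auto simp: kernel_family_def)
  have "Kop (k \<mu>) f x = Kop (\<lambda>x y. k z x y + (\<mu> - z) * ddiff z k \<mu> x y) f x"
    by (subst ddiff_eq[of k \<mu> _ _ z, abs_def]) simp
  also have "\<dots> = Kop (k z) f x + Kop (\<lambda>x y. (\<mu> - z) * ddiff z k \<mu> x y) f x"
    by (rule Kop_add[OF b(1) kernel_bound_cmult[OF b(2)] f])
  finally show ?thesis by (simp add: Kop_cmult)
qed

lemma op_bound_mono: "op_bound T C \<Longrightarrow> C \<le> D \<Longrightarrow> op_bound T D"
  unfolding op_bound_def by (meson L2_norm_nonneg mult_right_mono order_trans)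

lemma op_bound_cong: "op_bound T C \<Longrightarrow> (\<And>f. f \<in> L2 \<Longrightarrow> S f = T f) \<Longrightarrow> op_bound S C"
  unfolding op_bound_def by simp

text \<open>The error of the difference quotient is exactly w - z times the operator of the second
  divided difference, whose norm is bounded uniformly in w.\<close>

lemma kernel_family_op_holomorphic:
  assumes k: "kernel_family N U k C" and U: "open U"
  shows "op_holomorphic_on (\<lambda>z. Kop (k z)) U"
  unfolding op_holomorphic_on_def
proof (intro ballI conjI exI)
  fix z assume z: "z \<in> U"
  obtain C1 where d1: "kernel_family N U (ddiff z k) C1" using kernel_family_ddiff[OF k U z] .
  obtain C2 where d2: "kernel_family N U (ddiff z (ddiff z k)) C2" using kernel_family_ddiff[OF d1 U z] .
  show "bounded_op (Kop (k z))" using k z by (auto simp: kernel_family_def intro: Kop_bounded_op)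
  show "bounded_op (Kop (ddiff z k z))" using d1 z by (auto simp: kernel_family_def intro: Kop_bounded_op)
  have kb2: "kernel_bound N (ddiff z (ddiff z k) w) C2" if "w \<in> U" for w
    using d2 that by (auto simp: kernel_family_def)
  define K where "K = C2 * norm_const N"
  have K: "K \<ge> 0" using kernel_boundD[OF kb2[OF z]] by (simp add: K_def norm_const_nonneg)
  let ?Q = "\<lambda>w f x. (Kop (k w) f x - Kop (k z) f x) / (w - z) - Kop (ddiff z k z) f x"
  show "op_has_deriv (\<lambda>z. Kop (k z)) (Kop (ddiff z k z)) z"
    unfolding op_has_deriv_def
  proof (intro allI impI)
    fix \<epsilon> :: real assume \<epsilon>: "\<epsilon> > 0"
    have "\<forall>\<^sub>F w in at z. w \<in> U - {z}" by (rule eventually_at_in_open[OF U z])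
    moreover have "\<forall>\<^sub>F w in at z. dist w z < \<epsilon> / (K + 1)"
      using \<epsilon> K by (intro eventually_at_ball'[THEN eventually_mono] tendstoD[OF tendsto_ident_at]) auto
    ultimately show "\<forall>\<^sub>F w in at z. op_bound (?Q w) \<epsilon>"
    proof eventually_elim
      fix w assume w: "w \<in> U - {z}" and d: "dist w z < \<epsilon> / (K + 1)"
      have "op_bound (Kop (\<lambda>x y. (w - z) * ddiff z (ddiff z k) w x y)) (cmod (w - z) * C2 * norm_const N)"
        using w by (intro Kop_op_bound kernel_bound_cmult kb2) auto
      then have "op_bound (?Q w) (cmod (w - z) * C2 * norm_const N)"
      proof (rule op_bound_cong)
        fix f assume f: "f \<in> L2"
        have "?Q w f x = (w - z) * Kop (ddiff z (ddiff z k) w) f x" for x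
          using w Kop_ddiff[OF k U z _ f, of w x] Kop_ddiff[OF d1 U z _ f, of w x] by simp
        then show "?Q w f = Kop (\<lambda>x y. (w - z) * ddiff z (ddiff z k) w x y) f" by (simp add: fun_eq_iff Kop_cmult)
      qed
      moreover have "cmod (w - z) * C2 * norm_const N \<le> \<epsilon>"
      proof -
        have "cmod (w - z) * K \<le> \<epsilon> / (K + 1) * K"
          using d K by (intro mult_right_mono) (auto simp: dist_norm)
        also have "\<dots> \<le> \<epsilon>" using K \<epsilon> by (simp add: field_simps)
        finally show ?thesis by (simp add: K_def mult_ac)
      qed
      ultimately show "op_bound (?Q w) \<epsilon>"
        by (rule op_bound_mono)
    qed
  qed
qed

lemma kernel_family_iterated_ddiff:
  assumes k: "kernel_family N U k C" and U: "open U" and z: "z \<in> U"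
  shows "\<exists>C'. kernel_family N U ((ddiff z ^^ n) k) C'"
proof (induction n)
  case (Suc n)
  then obtain C' where "kernel_family N U ((ddiff z ^^ n) k) C'" by blast
  then obtain C'' where "kernel_family N U (ddiff z ((ddiff z ^^ n) k)) C''"
    using kernel_family_ddiff[OF _ U z] by blast
  then show ?case by auto
qed (use k in auto)

text \<open>The exact Taylor formula divided by (\<mu> - z)^J: the Taylor coefficient of order J - j
  becomes the coefficient of the pole of order j.\<close>

lemma Kop_taylor:
  assumes "kernel_family N U k C" and U: "open U" and z: "z \<in> U" and \<mu>: "\<mu> \<in> U" "\<mu> \<noteq> z" and f: "f \<in> L2"
  shows "Kop (k \<mu>) f x / (\<mu> - z) ^ J = Kop ((ddiff z ^^ J) k \<mu>) f x
     + (\<Sum>j=1..J. Kop ((ddiff z ^^ (J - j)) k z) f x / (\<mu> - z) ^ j)"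
  using assms(1)
proof (induction J arbitrary: k C)
  case (Suc J)
  obtain C' where d: "kernel_family N U (ddiff z k) C'" using kernel_family_ddiff[OF Suc.prems U z] .
  have nz: "\<mu> - z \<noteq> 0" using \<mu> by simp
  have s: "(\<Sum>j=1..Suc J. Kop ((ddiff z ^^ (Suc J - j)) k z) f x / (\<mu> - z) ^ j)
     = (\<Sum>j=1..J. Kop ((ddiff z ^^ (J - j)) (ddiff z k) z) f x / (\<mu> - z) ^ j)
       + Kop (k z) f x / (\<mu> - z) ^ Suc J"
    by (auto intro!: sum.cong simp: Suc_diff_le funpow_swap1)
  have "Kop (k \<mu>) f x / (\<mu> - z) ^ Suc J
     = Kop (ddiff z k \<mu>) f x / (\<mu> - z) ^ J + Kop (k z) f x / (\<mu> - z) ^ Suc J"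
    unfolding Kop_ddiff[OF Suc.prems U z \<mu>(1) f, of x] using nz by (simp add: field_simps)
  also have "Kop (ddiff z k \<mu>) f x / (\<mu> - z) ^ J = Kop ((ddiff z ^^ Suc J) k \<mu>) f x
     + (\<Sum>j=1..J. Kop ((ddiff z ^^ (J - j)) (ddiff z k) z) f x / (\<mu> - z) ^ j)"
    using Suc.IH[OF d] by (simp add: funpow_swap1)
  finally show ?case unfolding s by (simp only: add_ac)
qed simp

text \<open>The numerator is holomorphic across z, so the J-th divided difference is the regular
  part. For J \<ge> 1 the top coefficient is the operator with kernel \<open>k z\<close>.\<close>

lemma kernel_family_polar_part:
  assumes k: "kernel_family N (ball z r) k C" and r: "r > 0"
    and T: "\<And>\<mu> f x. \<mu> \<in> ball z r - {z} \<Longrightarrow> T \<mu> f x = Kop (k \<mu>) f x / (\<mu> - z) ^ J"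
  shows "op_polar_part T z J (\<lambda>j. Kop ((ddiff z ^^ (J - j)) k z))"
  unfolding op_polar_part_def
proof (intro conjI ballI exI allI AE_I2)
  have U: "open (ball z r)" "z \<in> ball z r" using r by auto
  have it: "\<exists>C'. kernel_family N (ball z r) ((ddiff z ^^ n) k) C'" for n
    by (rule kernel_family_iterated_ddiff[OF k U])
  show "bounded_op (Kop ((ddiff z ^^ (J - j)) k z))" for j
  proof -
    obtain C' where "kernel_family N (ball z r) ((ddiff z ^^ (J - j)) k) C'" using it by blast
    then show ?thesis using U(2) by (auto simp: kernel_family_def intro: Kop_bounded_op)
  qed
  show "0 < r" by (rule r)
  show "op_holomorphic_on (\<lambda>\<mu>. Kop ((ddiff z ^^ J) k \<mu>)) (ball z r)"
  proof -
    obtain C' where "kernel_family N (ball z r) ((ddiff z ^^ J) k) C'" using it by blast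
    then show ?thesis by (rule kernel_family_op_holomorphic[OF _ U(1)])
  qed
  fix \<mu> assume \<mu>: "\<mu> \<in> ball z r - {z}"
  have "T \<mu> = Kop (\<lambda>x y. 1 / (\<mu> - z) ^ J * k \<mu> x y)"
    by (intro ext) (simp only: T[OF \<mu>] Kop_cmult, simp)
  moreover have "kernel_bound N (k \<mu>) C" using k \<mu> by (auto simp: kernel_family_def)
  then have "bounded_op (Kop (\<lambda>x y. 1 / (\<mu> - z) ^ J * k \<mu> x y))"
    by (rule Kop_bounded_op[OF kernel_bound_cmult])
  ultimately show "bounded_op (T \<mu>)" by (simp only:)
  fix f x assume f: "f \<in> L2"
  show "T \<mu> f x = Kop ((ddiff z ^^ J) k \<mu>) f x + (\<Sum>j=1..J. Kop ((ddiff z ^^ (J - j)) k z) f x / (\<mu> - z) ^ j)"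
    using T[OF \<mu>] Kop_taylor[OF k U _ _ f, of \<mu> x J] \<mu> by simp
qed

section \<open>Matrix elements and the comparison of poles\<close>

text \<open>Matrix elements turn statements on operator families into statements on scalar
  functions. The form is bilinear; a conjugate is put into \<open>g\<close> where a norm is
  wanted.\<close>

definition pairing :: "(real \<Rightarrow> complex) \<Rightarrow> (real \<Rightarrow> complex) \<Rightarrow> complex" where
  "pairing u g = (LINT x|lborel. u x * g x)"

text \<open>Weighting the product as |u g| \<le> |u|^2/\<epsilon> + \<epsilon> |g|^2 makes the bound
  linear in the operator bound \<epsilon>.\<close>

lemma pairing_bound:
  assumes T: "op_bound T \<epsilon>" and e: "\<epsilon> > 0" and f: "f \<in> L2" and g: "g \<in> L2"
  shows "cmod (pairing (T f) g) \<le> \<epsilon> * ((L2_norm f)\<^sup>2 + (L2_norm g)\<^sup>2)"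
proof -
  have TL: "T f \<in> L2" "L2_norm (T f) \<le> \<epsilon> * L2_norm f" using T f by (auto simp: op_bound_def)
  have "cmod (pairing (T f) g) \<le> (LINT x|lborel. cmod (T f x * g x))"
    unfolding pairing_def by (rule integral_norm_bound)
  also have "\<dots> \<le> (LINT x|lborel. (cmod (T f x))\<^sup>2 / \<epsilon> + \<epsilon> * (cmod (g x))\<^sup>2)"
  proof (rule integral_mono)
    show "integrable lborel (\<lambda>x. cmod (T f x * g x))"
      by (intro integrable_norm L2_mult_integrable TL g)
    show "integrable lborel (\<lambda>x. (cmod (T f x))\<^sup>2 / \<epsilon> + \<epsilon> * (cmod (g x))\<^sup>2)"
      using L2_square_integrable[OF TL(1)] L2_square_integrable[OF g] by auto
    fix x
    have "cmod (T f x) * cmod (g x) * (2 * \<epsilon>) \<le> (cmod (T f x))\<^sup>2 + (\<epsilon> * cmod (g x))\<^sup>2"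
      using sum_squares_bound[of "cmod (T f x)" "\<epsilon> * cmod (g x)"] by (simp add: mult_ac)
    moreover have "0 \<le> cmod (T f x) * cmod (g x) * \<epsilon>" using e by simp
    ultimately have "cmod (T f x) * cmod (g x) * \<epsilon> \<le> (cmod (T f x))\<^sup>2 + (\<epsilon> * cmod (g x))\<^sup>2" by linarith
    then show "cmod (T f x * g x) \<le> (cmod (T f x))\<^sup>2 / \<epsilon> + \<epsilon> * (cmod (g x))\<^sup>2"
      using e by (simp add: norm_mult field_simps power2_eq_square)
  qed
  also have "\<dots> = (L2_norm (T f))\<^sup>2 / \<epsilon> + \<epsilon> * (L2_norm g)\<^sup>2"
    using L2_square_integrable[OF TL(1)] L2_square_integrable[OF g]
    by (simp add: L2_norm_square[OF TL(1)] L2_norm_square[OF g])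
  also have "(L2_norm (T f))\<^sup>2 / \<epsilon> \<le> (\<epsilon> * L2_norm f)\<^sup>2 / \<epsilon>"
    using TL(2) L2_norm_nonneg[of "T f"] e by (intro divide_right_mono power_mono) auto
  also have "(\<epsilon> * L2_norm f)\<^sup>2 / \<epsilon> = \<epsilon> * (L2_norm f)\<^sup>2" using e by (simp add: power2_eq_square)
  finally show ?thesis by (simp add: distrib_left)
qed

lemma bounded_op_L2: "bounded_op T \<Longrightarrow> f \<in> L2 \<Longrightarrow> T f \<in> L2"
  by (auto simp: bounded_op_def op_bound_def)

lemma pairing_holomorphic:
  assumes A: "op_holomorphic_on A U" and U: "open U" and f: "f \<in> L2" and g: "g \<in> L2"
  shows "(\<lambda>z. pairing (A z f) g) holomorphic_on U"
proof (rule holomorphic_onI)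
  fix z assume z: "z \<in> U"
  obtain D where D: "bounded_op D" "op_has_deriv A D z" using A z by (auto simp: op_holomorphic_on_def)
  have AL: "A w f \<in> L2" if "w \<in> U" for w using A that f by (auto simp: op_holomorphic_on_def intro: bounded_op_L2)
  define K where "K = (L2_norm f)\<^sup>2 + (L2_norm g)\<^sup>2"
  have K: "K \<ge> 0" by (simp add: K_def)
  have "((\<lambda>z. pairing (A z f) g) has_field_derivative pairing (D f) g) (at z)"
    unfolding has_field_derivative_iff
  proof (rule tendstoI)
    fix e :: real assume e: "e > 0"
    define \<epsilon> where "\<epsilon> = e / (K + 1)"
    have \<epsilon>: "\<epsilon> > 0" "\<epsilon> * K < e" using e K by (auto simp: \<epsilon>_def field_simps)
    have "\<forall>\<^sub>F w in at z. w \<in> U - {z}" by (rule eventually_at_in_open[OF U z])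
    moreover have "\<forall>\<^sub>F w in at z. op_bound (\<lambda>f x. (A w f x - A z f x) / (w - z) - D f x) \<epsilon>"
      using D(2) \<epsilon>(1) by (simp add: op_has_deriv_def)
    ultimately show "\<forall>\<^sub>F w in at z. dist ((pairing (A w f) g - pairing (A z f) g) / (w - z)) (pairing (D f) g) < e"
    proof eventually_elim
      fix w assume w: "w \<in> U - {z}" and b: "op_bound (\<lambda>f x. (A w f x - A z f x) / (w - z) - D f x) \<epsilon>"
      have i: "integrable lborel (\<lambda>x. A w f x * g x)" "integrable lborel (\<lambda>x. A z f x * g x)"
        "integrable lborel (\<lambda>x. D f x * g x)"
        using w z by (auto intro!: L2_mult_integrable AL g bounded_op_L2[OF D(1) f])
      have "pairing (\<lambda>x. (A w f x - A z f x) / (w - z) - D f x) g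
         = (LINT x|lborel. (A w f x * g x - A z f x * g x) / (w - z) - D f x * g x)"
        unfolding pairing_def by (rule Bochner_Integration.integral_cong) (auto simp: algebra_simps diff_divide_distrib)
      also have "\<dots> = (pairing (A w f) g - pairing (A z f) g) / (w - z) - pairing (D f) g"
        unfolding pairing_def using i by simp
      finally have "dist ((pairing (A w f) g - pairing (A z f) g) / (w - z)) (pairing (D f) g)
         = cmod (pairing (\<lambda>x. (A w f x - A z f x) / (w - z) - D f x) g)" by (simp add: dist_norm)
      also have "\<dots> \<le> \<epsilon> * K"
        unfolding K_def using pairing_bound[OF b \<epsilon>(1) f g] .
      finally show "dist ((pairing (A w f) g - pairing (A z f) g) / (w - z)) (pairing (D f) g) < e"
        using \<epsilon>(2) by linarith
    qed
  qed
  then show "(\<lambda>z. pairing (A z f) g) field_differentiable at z within U"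
    by (meson field_differentiable_at_within field_differentiable_def)
qed

text \<open>Integrating the expansion term by term needs measurability of \<open>T w f\<close>,
  which is available only in the punctured ball; hence the eventual form of the identity.\<close>

lemma polar_part_pairing:
  assumes "op_polar_part T z J B" and f: "f \<in> L2" and g: "g \<in> L2"
  obtains h r where "r > 0" "h holomorphic_on ball z r"
    "\<forall>\<^sub>F w in at z. pairing (T w f) g = h w + (\<Sum>j=1..J. pairing (B j f) g / (w - z) ^ j)"
proof -
  from assms(1) obtain r A where B: "\<And>j. j \<in> {1..J} \<Longrightarrow> bounded_op (B j)"
    and r: "r > 0" and A: "op_holomorphic_on A (ball z r)"
    and T: "\<And>w. w \<in> ball z r - {z} \<Longrightarrow> bounded_op (T w)"
      "\<And>w. w \<in> ball z r - {z} \<Longrightarrow> AE x in lborel. T w f x = A w f x + (\<Sum>j=1..J. B j f x / (w - z) ^ j)"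
    unfolding op_polar_part_def using f by blast
  show ?thesis
  proof
    show "r > 0" by (rule r)
    show "(\<lambda>w. pairing (A w f) g) holomorphic_on ball z r" by (rule pairing_holomorphic[OF A _ f g]) simp
    have "\<forall>\<^sub>F w in at z. w \<in> ball z r - {z}" using r by (intro eventually_at_in_open) auto
    then show "\<forall>\<^sub>F w in at z. pairing (T w f) g = pairing (A w f) g + (\<Sum>j=1..J. pairing (B j f) g / (w - z) ^ j)"
    proof eventually_elim
      fix w assume w: "w \<in> ball z r - {z}"
      have AL: "A w f \<in> L2" using A w f by (auto simp: op_holomorphic_on_def intro: bounded_op_L2)
      have BL: "B j f \<in> L2" if "j \<in> {1..J}" for j using bounded_op_L2[OF B[OF that] f] .
      have SL: "(\<lambda>x. \<Sum>j=1..J. B j f x / (w - z) ^ j) \<in> borel_measurable borel"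
        by (intro borel_measurable_sum borel_measurable_divide borel_measurable_const L2_measurable[OF BL])
      note [measurable] = L2_measurable[OF AL] SL L2_measurable[OF g] L2_measurable[OF bounded_op_L2[OF T(1)[OF w] f]]
      have "pairing (T w f) g = (LINT x|lborel. (A w f x + (\<Sum>j=1..J. B j f x / (w - z) ^ j)) * g x)"
        unfolding pairing_def
      proof (rule integral_cong_AE)
        show "AE x in lborel. T w f x * g x = (A w f x + (\<Sum>j=1..J. B j f x / (w - z) ^ j)) * g x"
          using T(2)[OF w] by eventually_elim simp
      qed measurable
      also have "\<dots> = (LINT x|lborel. A w f x * g x + (\<Sum>j=1..J. 1 / (w - z) ^ j * (B j f x * g x)))"
        by (rule Bochner_Integration.integral_cong) (auto simp: distrib_right sum_distrib_right)
      also have "\<dots> = (LINT x|lborel. A w f x * g x) + (LINT x|lborel. (\<Sum>j=1..J. 1 / (w - z) ^ j * (B j f x * g x)))"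
        by (intro Bochner_Integration.integral_add Bochner_Integration.integrable_sum integrable_mult_right
            L2_mult_integrable AL BL g)
      also have "(LINT x|lborel. (\<Sum>j=1..J. 1 / (w - z) ^ j * (B j f x * g x)))
         = (\<Sum>j=1..J. (LINT x|lborel. 1 / (w - z) ^ j * (B j f x * g x)))"
        by (intro Bochner_Integration.integral_sum integrable_mult_right L2_mult_integrable BL g)
      also have "\<dots> = (\<Sum>j=1..J. pairing (B j f) g / (w - z) ^ j)"
        by (intro sum.cong refl) (simp only: integral_mult_right_zero pairing_def, simp)
      finally show "pairing (T w f) g = pairing (A w f) g + (\<Sum>j=1..J. pairing (B j f) g / (w - z) ^ j)"
        by (simp add: pairing_def)
    qed
  qed
qed

lemma pairing_meromorphic:
  assumes "op_meromorphic_at T z" and f: "f \<in> L2" and g: "g \<in> L2"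
  shows "(\<lambda>w. pairing (T w f) g) meromorphic_on {z}"
proof -
  from assms(1) obtain J B where "op_polar_part T z J B" by (auto simp: op_meromorphic_at_def)
  from polar_part_pairing[OF this f g] obtain h r where r: "r > 0" and h: "h holomorphic_on ball z r"
    and ev: "\<forall>\<^sub>F w in at z. pairing (T w f) g = h w + (\<Sum>j=1..J. pairing (B j f) g / (w - z) ^ j)" .
  have "h analytic_on {z}" using h r by (auto simp: analytic_at intro!: exI[of _ "ball z r"])
  then have "h meromorphic_on {z}" by (rule analytic_on_imp_meromorphic_on)
  then have "(\<lambda>w. h w + (\<Sum>j=1..J. pairing (B j f) g / (w - z) ^ j)) meromorphic_on {z}"
    by (intro meromorphic_intros)
  then show ?thesis
    by (subst meromorphic_on_cong[where g = "\<lambda>w. h w + (\<Sum>j=1..J. pairing (B j f) g / (w - z) ^ j)"])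
       (use ev in auto)
qed

lemma op_meromorphic_at_eventually_L2:
  assumes "op_meromorphic_at T z" and f: "f \<in> L2"
  shows "\<forall>\<^sub>F w in at z. T w f \<in> L2"
proof -
  from assms obtain r where r: "r > 0" and T: "\<And>w. w \<in> ball z r - {z} \<Longrightarrow> bounded_op (T w)"
    unfolding op_meromorphic_at_def op_polar_part_def by blast
  have "\<forall>\<^sub>F w in at z. w \<in> ball z r - {z}" using r by (intro eventually_at_in_open) auto
  then show ?thesis by eventually_elim (use T f in \<open>auto intro: bounded_op_L2\<close>)
qed

text \<open>At an exceptional point the members of a meromorphic family need not be measurable, so the
  equality of the pairings is only claimed near \<open>\<i>\<close> before the identity theorem is applied.\<close>

lemma pairing_identity:
  assumes T: "\<And>z. op_meromorphic_at T z" and S: "\<And>z. op_meromorphic_at S z"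
    and eq: "\<And>\<mu>. Im \<mu> > 0 \<Longrightarrow> AE x in lborel. T \<mu> f x = S \<mu> f x"
    and f: "f \<in> L2" and g: "g \<in> L2"
  shows "\<forall>\<^sub>F w in at z. pairing (T w f) g = pairing (S w f) g"
proof -
  let ?s = "\<lambda>w. pairing (T w f) g - pairing (S w f) g"
  have "(\<lambda>w. pairing (T w f) g) meromorphic_on UNIV" "(\<lambda>w. pairing (S w f) g) meromorphic_on UNIV"
    using pairing_meromorphic[OF T f g] pairing_meromorphic[OF S f g]
    by (subst meromorphic_on_meromorphic_at, blast)+
  then have m: "?s meromorphic_on UNIV" by (intro meromorphic_intros)
  have "\<forall>\<^sub>F w in at \<i>. w \<in> {w. Im w > 0} - {\<i>}"
    by (intro eventually_at_in_open open_halfspace_Im_gt) auto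
  then have z: "\<forall>\<^sub>F w in at \<i>. ?s w = 0"
    using op_meromorphic_at_eventually_L2[OF T f] op_meromorphic_at_eventually_L2[OF S f]
  proof eventually_elim
    fix w assume w: "w \<in> {w. Im w > 0} - {\<i>}" and L: "T w f \<in> L2" "S w f \<in> L2"
    note [measurable] = L2_measurable[OF L(1)] L2_measurable[OF L(2)] L2_measurable[OF g]
    have "pairing (T w f) g = pairing (S w f) g"
      unfolding pairing_def
    proof (rule integral_cong_AE)
      have "AE x in lborel. T w f x = S w f x" using w by (intro eq) auto
      then show "AE x in lborel. T w f x * g x = S w f x * g x" by eventually_elim simp
    qed measurable
    then show "?s w = 0" by simp
  qed
  \<comment> \<open>The identity theorem as an alternative: the difference of the pairings is zero
    off a sparse set or nonzero off one, and the second contradicts its vanishing near \<i>.\<close>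
  from meromorphic_imp_constant_or_avoid[OF m open_UNIV connected_UNIV, of 0]
  consider "\<forall>\<^sub>\<approx>z\<in>UNIV. ?s z = 0" | "\<forall>\<^sub>\<approx>z\<in>UNIV. ?s z \<noteq> 0" by blast
  then show ?thesis
  proof cases
    case 1
    then have "\<forall>\<^sub>F w in at z. ?s w = 0" by (simp add: eventually_cosparse_open_eq)
    then show ?thesis by eventually_elim simp
  next
    case 2
    then have "\<forall>\<^sub>F w in at \<i>. ?s w \<noteq> 0" by (simp add: eventually_cosparse_open_eq)
    with z have "\<forall>\<^sub>F w in at \<i>. False" by eventually_elim simp
    then show ?thesis by simp
  qed
qed

text \<open>Multiplication by (w - z)^J leaves a positive power of w - z in every term except the
  one with j = J.\<close>

lemma polar_limit:
  fixes c :: "nat \<Rightarrow> complex"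
  assumes h: "isCont h z" and J: "J \<ge> 1"
  shows "((\<lambda>w. (w - z) ^ J * (h w + (\<Sum>j=1..J. c j / (w - z) ^ j))) \<longlongrightarrow> c J) (at z)"
proof -
  have "((\<lambda>w. (w - z) ^ J * h w + (\<Sum>j=1..J. c j * (w - z) ^ (J - j))) \<longlongrightarrow>
      (z - z) ^ J * h z + (\<Sum>j=1..J. c j * (z - z) ^ (J - j))) (at z)"
    using h by (intro tendsto_intros) (auto simp: isCont_def)
  \<comment> \<open>The term j = J survives at the centre because 0 ^ 0 = 1.\<close>
  moreover have "(\<Sum>j=1..J. c j * (z - z) ^ (J - j)) = c J"
  proof -
    have "(\<Sum>j=1..J. c j * (z - z) ^ (J - j)) = (\<Sum>j\<in>{1..J}. if j = J then c j else 0)"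
      by (intro sum.cong refl) (auto simp: power_0_left)
    then show ?thesis using J by simp
  qed
  ultimately have l: "((\<lambda>w. (w - z) ^ J * h w + (\<Sum>j=1..J. c j * (w - z) ^ (J - j))) \<longlongrightarrow> c J) (at z)"
    using J by (simp add: power_0_left)
  have ev: "\<forall>\<^sub>F w in at z. w \<noteq> z" by (auto simp: eventually_at intro: exI[of _ 1])
  show ?thesis
  proof (rule Lim_transform_eventually[OF l])
    show "\<forall>\<^sub>F w in at z. (w - z) ^ J * h w + (\<Sum>j=1..J. c j * (w - z) ^ (J - j))
       = (w - z) ^ J * (h w + (\<Sum>j=1..J. c j / (w - z) ^ j))"
      using ev
    proof eventually_elim
      fix w assume w: "w \<noteq> z"
      have "(w - z) ^ J * (\<Sum>j=1..J. c j / (w - z) ^ j) = (\<Sum>j=1..J. c j * (w - z) ^ (J - j))"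
        unfolding sum_distrib_left
      proof (intro sum.cong refl)
        fix j assume "j \<in> {1..J}"
        then show "(w - z) ^ J * (c j / (w - z) ^ j) = c j * (w - z) ^ (J - j)"
          using w by (simp add: power_diff field_simps)
      qed
      then show "(w - z) ^ J * h w + (\<Sum>j=1..J. c j * (w - z) ^ (J - j))
       = (w - z) ^ J * (h w + (\<Sum>j=1..J. c j / (w - z) ^ j))" by (simp add: distrib_left)
    qed
  qed
qed

text \<open>Times (w - z)^J, a matrix element of \<open>T\<close> tends to that of its top
  coefficient. Near z it equals a matrix element of \<open>S\<close>, which stays bounded, so the
  limit is zero.\<close>

lemma no_pole_transfer:
  assumes T: "\<And>z. op_meromorphic_at T z" and S: "\<And>z. op_meromorphic_at S z"
    and eq: "\<And>\<mu> f. Im \<mu> > 0 \<Longrightarrow> f \<in> L2 \<Longrightarrow> AE x in lborel. T \<mu> f x = S \<mu> f x"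
    and S0: "op_polar_part S z 0 B0"
  shows "\<not> op_is_pole T z"
proof
  assume "op_is_pole T z"
  then obtain J B where J: "J \<ge> 1" and P: "op_polar_part T z J B" and nz: "\<not> (\<forall>f\<in>L2. AE x in lborel. B J f x = 0)"
    by (auto simp: op_is_pole_def)
  have "AE x in lborel. B J f x = 0" if f: "f \<in> L2" for f
  proof -
    have "bounded_op (B J)" using P J by (auto simp: op_polar_part_def)
    then have BL: "B J f \<in> L2" by (rule bounded_op_L2[OF _ f])
    \<comment> \<open>With this choice the pairing is the squared norm of \<open>B J f\<close>, so
      its vanishing kills \<open>B J f\<close> almost everywhere.\<close>
    define g where "g x = cnj (B J f x)" for x
    have g: "g \<in> L2" unfolding g_def[abs_def] by (rule L2_cnj[OF BL])
    let ?c = "\<lambda>w. \<Sum>j=1..J. pairing (B j f) g / (w - z) ^ j"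
    obtain h r where h: "r > 0" "h holomorphic_on ball z r"
      and ev: "\<forall>\<^sub>F w in at z. pairing (T w f) g = h w + ?c w"
      using polar_part_pairing[OF P f g] .
    obtain h0 r0 where h0: "r0 > 0" "h0 holomorphic_on ball z r0"
      and ev0: "\<forall>\<^sub>F w in at z. pairing (S w f) g = h0 w + (\<Sum>j=1..0. pairing (B0 j f) g / (w - z) ^ j)"
      using polar_part_pairing[OF S0 f g] .
    have c: "isCont h z" "isCont h0 z"
      using h h0 holomorphic_on_imp_continuous_on continuous_on_eq_continuous_at
      by (metis centre_in_ball open_ball)+
    have id: "\<forall>\<^sub>F w in at z. pairing (T w f) g = pairing (S w f) g"
      by (rule pairing_identity[OF T S eq f g]) (use f in auto)
    have "\<forall>\<^sub>F w in at z. h w + ?c w = h0 w"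
      using ev ev0 id by eventually_elim simp
    then have e: "\<forall>\<^sub>F w in at z. (w - z) ^ J * (h w + ?c w) = (w - z) ^ J * h0 w"
      by eventually_elim simp
    have "((\<lambda>w. (w - z) ^ J * h0 w) \<longlongrightarrow> (z - z) ^ J * h0 z) (at z)"
      using c(2) by (intro tendsto_intros) (auto simp: isCont_def)
    then have "((\<lambda>w. (w - z) ^ J * h0 w) \<longlongrightarrow> 0) (at z)" using J by (simp add: power_0_left)
    moreover have "((\<lambda>w. (w - z) ^ J * h0 w) \<longlongrightarrow> pairing (B J f) g) (at z)"
      by (rule Lim_transform_eventually[OF polar_limit[OF c(1) J] e])
    ultimately have "pairing (B J f) g = 0"
      using tendsto_unique[OF at_neq_bot] by blast
    then have "(LINT x|lborel. complex_of_real ((cmod (B J f x))\<^sup>2)) = 0"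
      by (simp add: pairing_def g_def complex_norm_square[symmetric])
    then have "(LINT x|lborel. (cmod (B J f x))\<^sup>2) = 0"
      by (simp only: integral_complex_of_real of_real_eq_0_iff)
    then have "AE x in lborel. (cmod (B J f x))\<^sup>2 = 0"
      by (subst (asm) integral_nonneg_eq_0_iff_AE) (auto intro: L2_square_integrable[OF BL])
    then show ?thesis by eventually_elim simp
  qed
  then show False using nz by blast
qed

section \<open>Resonances\<close>

context layers begin

definition window_kern :: "real \<Rightarrow> complex \<Rightarrow> real \<Rightarrow> real \<Rightarrow> complex" where
  "window_kern N \<mu> x y = indicator {-N..N} x * indicator {-N..N} y * kern \<mu> x y"

lemma cutoff_Rop: "cutoff N (Rop \<mu>) f x = cR \<mu> * Kop (window_kern N \<mu>) f x"
proof -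
  have "indicator {-N..N} x * (cR \<mu> * (LINT y|lborel. kern \<mu> x y * (indicator {-N..N} y * f y)))
     = cR \<mu> * (indicator {-N..N} x * (LINT y|lborel. kern \<mu> x y * (indicator {-N..N} y * f y)))"
    by (simp only: mult_ac)
  also have "indicator {-N..N} x * (LINT y|lborel. kern \<mu> x y * (indicator {-N..N} y * f y))
     = (LINT y|lborel. indicator {-N..N} x * (kern \<mu> x y * (indicator {-N..N} y * f y)))"
    by (rule integral_mult_right_zero[symmetric])
  also have "\<dots> = Kop (window_kern N \<mu>) f x"
    unfolding Kop_def window_kern_def by (simp only: mult_ac)
  finally show ?thesis by (simp only: cutoff_def Rop_def)
qed

lemma window_kern_bound: "\<exists>C\<ge>0. \<forall>\<mu>\<in>ball z r. \<forall>x y. cmod (window_kern N \<mu> x y) \<le> C"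
proof -
  obtain C D where C: "\<And>\<mu> x. cmod \<mu> \<le> cmod z + r \<Longrightarrow> \<bar>x\<bar> \<le> \<bar>N\<bar> \<Longrightarrow> cmod (pp \<mu> x) \<le> C"
    and D: "\<And>\<mu> x. cmod \<mu> \<le> cmod z + r \<Longrightarrow> \<bar>x\<bar> \<le> \<bar>N\<bar> \<Longrightarrow> cmod (pm \<mu> x) \<le> D"
    using pp_loc_bounded pm_loc_bounded unfolding loc_bounded_def by meson
  have "cmod (window_kern N \<mu> x y) \<le> \<bar>C\<bar> * \<bar>D\<bar>" if \<mu>: "\<mu> \<in> ball z r" for \<mu> x y
  proof (cases "x \<in> {-N..N} \<and> y \<in> {-N..N}")
    case True
    have "cmod \<mu> \<le> cmod z + r"
      using \<mu> norm_triangle_ineq2[of \<mu> z] by (auto simp: dist_norm norm_minus_commute)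
    moreover have "\<bar>max x y\<bar> \<le> \<bar>N\<bar>" "\<bar>min x y\<bar> \<le> \<bar>N\<bar>" using True by auto
    ultimately have "cmod (pp \<mu> (max x y)) \<le> \<bar>C\<bar>" "cmod (pm \<mu> (min x y)) \<le> \<bar>D\<bar>"
      using C D by (meson abs_ge_self order_trans)+
    then show ?thesis using True by (simp add: window_kern_def kern_def norm_mult mult_mono)
  next
    case False
    then have "window_kern N \<mu> x y = 0" by (auto simp: window_kern_def)
    then show ?thesis by simp
  qed
  then show ?thesis by (intro exI[of _ "\<bar>C\<bar> * \<bar>D\<bar>"]) auto
qed

lemma window_kern_measurable:
  "(\<lambda>p. window_kern N \<mu> (fst p) (snd p)) \<in> borel_measurable lborel2"
proof -
  have [measurable]: "pp \<mu> \<in> borel_measurable borel" "pm \<mu> \<in> borel_measurable borel"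
    by (intro borel_measurable_continuous_onI continuous_pp continuous_pm)+
  show ?thesis unfolding window_kern_def kern_def by measurable
qed

lemma window_kern_holomorphic: "(\<lambda>\<mu>. window_kern N \<mu> x y) holomorphic_on UNIV"
  unfolding window_kern_def kern_def by (intro holomorphic_intros pp_holomorphic pm_holomorphic)

text \<open>J is the order of the zero of 2 \<mu> A(\<mu>) at z, so regular points are the case J =
  0. The top coefficient is made explicit because recognising a pole means showing that it is not
  the zero operator.\<close>

lemma Rop_polar_part:
  obtains J c B where "c \<noteq> 0" "J = 0 \<longleftrightarrow> z * cA z \<noteq> 0"
    "op_polar_part (\<lambda>\<mu>. cutoff N (Rop \<mu>)) z J B" "B J = Kop (\<lambda>x y. c * window_kern N z x y)"
proof -
  define D where "D \<mu> = 2 * \<mu> * cA \<mu>" for \<mu>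
  have D: "D holomorphic_on UNIV" unfolding D_def[abs_def] by (intro holomorphic_intros cA_holomorphic)
  \<comment> \<open>Some nonzero value is needed for orders of zeros to exist; A has no zeros in the
    upper half plane.\<close>
  have "D \<i> \<noteq> 0" using cA_nonzero[of \<i>] by (simp add: D_def)
  then have ne: "\<exists>w\<in>UNIV. D w \<noteq> 0" by blast
  define J where "J = nat (zorder D z)"
  define g where "g = zor_poly D z"
  from zorder_exist_zero[OF D open_UNIV connected_UNIV UNIV_I ne, of z]
  obtain r where J0: "if D z = 0 then zorder D z > 0 else zorder D z = 0" and r: "r > 0"
    and g: "g holomorphic_on cball z r" "\<And>w. w \<in> cball z r \<Longrightarrow> D w = g w * (w - z) ^ J"
      "\<And>w. w \<in> cball z r \<Longrightarrow> g w \<noteq> 0"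
    unfolding J_def g_def by blast
  have J: "J = 0 \<longleftrightarrow> z * cA z \<noteq> 0" using J0 by (auto simp: J_def D_def split: if_splits)
  define G where "G w = \<i> * of_real b1 / g w" for w
  have G: "G holomorphic_on cball z r" unfolding G_def[abs_def] using g by (intro holomorphic_intros) auto
  have "bounded (G ` cball z r)"
    by (intro compact_imp_bounded compact_continuous_image holomorphic_on_imp_continuous_on[OF G]) auto
  then obtain C1 where C1: "\<And>w. w \<in> cball z r \<Longrightarrow> cmod (G w) \<le> C1"
    unfolding bounded_iff by blast
  obtain C2 where C2: "C2 \<ge> 0" "\<And>\<mu> x y. \<mu> \<in> ball z r \<Longrightarrow> cmod (window_kern N \<mu> x y) \<le> C2"
    using window_kern_bound[of z r N] by blast
  have "cmod (G z) \<le> C1" using r by (intro C1) simp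
  then have C10: "C1 \<ge> 0" by (rule order_trans[OF norm_ge_zero])
  define K where "K \<mu> x y = G \<mu> * window_kern N \<mu> x y" for \<mu> x y
  \<comment> \<open>The cut-off parameter may be negative, and then the window is empty; kernel
    bounds are stated for nonnegative windows.\<close>
  have supp: "K \<mu> x y = 0" if "x \<notin> {-\<bar>N\<bar>..\<bar>N\<bar>} \<or> y \<notin> {-\<bar>N\<bar>..\<bar>N\<bar>}" for \<mu> x y
    using that by (auto simp: K_def window_kern_def indicator_def)
  have "kernel_family \<bar>N\<bar> (ball z r) K (C1 * C2)"
    unfolding kernel_family_def kernel_bound_def
  proof (intro conjI ballI allI impI supp)
    show "0 \<le> \<bar>N\<bar>" "0 \<le> C1 * C2" using C10 C2(1) by auto
    fix \<mu> assume \<mu>: "\<mu> \<in> ball z r"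
    note [measurable] = window_kern_measurable[of N \<mu>]
    show "(\<lambda>p. K \<mu> (fst p) (snd p)) \<in> borel_measurable lborel2"
      unfolding K_def by measurable
    show "cmod (K \<mu> x y) \<le> C1 * C2" for x y
      unfolding K_def norm_mult using \<mu> C10 by (intro mult_mono C1 C2) auto
  next
    show "(\<lambda>\<mu>. K \<mu> x y) holomorphic_on ball z r" for x y
      unfolding K_def
      by (intro holomorphic_intros holomorphic_on_subset[OF G] holomorphic_on_subset[OF window_kern_holomorphic]) auto
  qed
  then have P: "op_polar_part (\<lambda>\<mu>. cutoff N (Rop \<mu>)) z J (\<lambda>j. Kop ((ddiff z ^^ (J - j)) K z))"
  proof (rule kernel_family_polar_part[OF _ r])
    fix \<mu> f x assume \<mu>: "\<mu> \<in> ball z r - {z}"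
    have "cR \<mu> = \<i> * of_real b1 / D \<mu>" by (simp add: cR_def D_def)
    also have "\<dots> = G \<mu> / (\<mu> - z) ^ J" using \<mu> g(2)[of \<mu>] by (simp add: G_def)
    finally have "cutoff N (Rop \<mu>) f x = G \<mu> * Kop (window_kern N \<mu>) f x / (\<mu> - z) ^ J"
      by (simp add: cutoff_Rop)
    also have "G \<mu> * Kop (window_kern N \<mu>) f x = Kop (K \<mu>) f x"
      unfolding K_def[abs_def] by (rule Kop_cmult[symmetric])
    finally show "cutoff N (Rop \<mu>) f x = Kop (K \<mu>) f x / (\<mu> - z) ^ J" .
  qed
  show ?thesis
  proof (rule that[OF _ J P])
    show "G z \<noteq> 0" using g(3)[of z] r b1 by (simp add: G_def)
    show "Kop ((ddiff z ^^ (J - J)) K z) = Kop (\<lambda>x y. G z * window_kern N z x y)"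
      by (simp add: K_def[abs_def])
  qed
qed

lemma Rop_resolvent_continuation: "resolvent_continuation ak Rop"
  unfolding resolvent_continuation_def op_meromorphic_at_def
proof (intro conjI allI impI ballI)
  show "AE x in lborel. Rop \<mu> f x = resolvent ak \<mu> f x" if "Im \<mu> > 0" "f \<in> L2_comp" for \<mu> f
    using that by (rule Rop_eq_resolvent)
  fix N z
  obtain J c B where "op_polar_part (\<lambda>\<mu>. cutoff N (Rop \<mu>)) z J B" by (rule Rop_polar_part)
  then show "\<exists>J B. op_polar_part (\<lambda>\<mu>. cutoff N (Rop \<mu>)) z J B" by blast
qed

text \<open>For y in [-2, -1] and x in (k, k + 1) the kernel is the product of \<open>pp z x\<close>
  and \<open>pm z y\<close>, both exponentials without zeros. Testing with the conjugate of
  \<open>pm\<close> gives a positive integral in y; the window k + 2 contains both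
  intervals.\<close>

lemma window_kern_nonzero:
  assumes c: "c \<noteq> 0"
  shows "\<exists>f\<in>L2. \<not> (AE x in lborel. Kop (\<lambda>x y. c * window_kern (real k + 2) z x y) f x = 0)"
proof
  define f where "f y = indicator {-2..-1} y * cnj (pm z y)" for y
  define I where "I = (LINT y|lborel. indicator {-2..-1} y *\<^sub>R (cmod (pm z y))\<^sup>2)"
  have cm: "continuous_on UNIV (\<lambda>y. (cmod (pm z y))\<^sup>2)" by (intro continuous_intros continuous_pm)
  have int: "integrable lborel (\<lambda>y. indicator {-2..-1} y *\<^sub>R (cmod (pm z y))\<^sup>2)"
    by (intro borel_integrable_compact continuous_on_subset[OF cm]) auto
  have "continuous_on UNIV (\<lambda>y. cnj (pm z y))" by (intro continuous_intros continuous_pm)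
  then have [measurable]: "(\<lambda>y. cnj (pm z y)) \<in> borel_measurable borel" by (rule borel_measurable_continuous_onI)
  show "f \<in> L2"
    by (rule L2_bound[OF int]) (auto simp: f_def[abs_def] indicator_def)
  have I: "I \<noteq> 0"
  proof
    assume "I = 0"
    then have "AE y in lborel. indicator {-2..-1} y *\<^sub>R (cmod (pm z y))\<^sup>2 = 0"
      unfolding I_def by (subst (asm) integral_nonneg_eq_0_iff_AE[OF int]) auto
    then have "AE y in lborel. y \<notin> {-2..-1::real}"
      by eventually_elim (auto simp: pm_left)
    then have "emeasure lborel {-2..-1::real} = 0" by (subst (asm) AE_iff_measurable[of "{-2..-1}"]) auto
    then show False by simp
  qed
  have val: "Kop (\<lambda>x y. c * window_kern (real k + 2) z x y) f x = c * (pp z x * of_real I)"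
    if x: "x \<in> {real k<..<real k + 1}" for x
  proof -
    have "Kop (window_kern (real k + 2) z) f x
       = (LINT y|lborel. pp z x * complex_of_real (indicator {-2..-1} y *\<^sub>R (cmod (pm z y))\<^sup>2))"
      unfolding Kop_def
    proof (rule Bochner_Integration.integral_cong[OF refl])
      fix y
      show "window_kern (real k + 2) z x y * f y
         = pp z x * complex_of_real (indicator {-2..-1} y *\<^sub>R (cmod (pm z y))\<^sup>2)"
      proof (cases "y \<in> {-2..-1}")
        case True
        then have "max x y = x" "min x y = y" "x \<in> {-(real k + 2)..real k + 2}" "y \<in> {-(real k + 2)..real k + 2}"
          using x by auto
        then show ?thesis using True complex_norm_square[of "pm z y"]
          by (simp add: window_kern_def kern_def f_def)
      qed (simp add: f_def)
    qed
    also have "\<dots> = pp z x * of_real I" unfolding I_def by (simp only: integral_mult_right_zero integral_complex_of_real)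
    finally show ?thesis by (simp only: Kop_cmult)
  qed
  show "\<not> (AE x in lborel. Kop (\<lambda>x y. c * window_kern (real k + 2) z x y) f x = 0)"
  proof
    assume "AE x in lborel. Kop (\<lambda>x y. c * window_kern (real k + 2) z x y) f x = 0"
    then have "AE x in lborel. x \<notin> {real k<..<real k + 1}"
      by eventually_elim (use val c I in \<open>auto simp: pp_right\<close>)
    then have "emeasure lborel {real k<..<real k + 1} = 0"
      by (subst (asm) AE_iff_measurable[of "{real k<..<real k + 1}"]) auto
    then show False by simp
  qed
qed

text \<open>Resonances are defined by the existence of a continuation with a pole. A zero of A is
  witnessed by \<open>Rop\<close> itself; conversely the continuation is arbitrary and has to be
  compared with \<open>Rop\<close>.\<close>

lemma resonances_eq: "resonances ak = {\<mu>. Im \<mu> < 0 \<and> cA \<mu> = 0}"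
proof (intro set_eqI iffI)
  fix z assume "z \<in> {\<mu>. Im \<mu> < 0 \<and> cA \<mu> = 0}"
  then have z: "Im z < 0" "cA z = 0" by auto
  obtain J c B where P: "c \<noteq> 0" "J = 0 \<longleftrightarrow> z * cA z \<noteq> 0"
    "op_polar_part (\<lambda>\<mu>. cutoff (real k + 2) (Rop \<mu>)) z J B"
    "B J = Kop (\<lambda>x y. c * window_kern (real k + 2) z x y)"
    by (rule Rop_polar_part)
  have "J \<ge> 1" using P(2) z by auto
  moreover have "\<not> (\<forall>f\<in>L2. AE x in lborel. B J f x = 0)"
    using window_kern_nonzero[OF P(1), of z] unfolding P(4) by blast
  ultimately have "op_is_pole (\<lambda>\<mu>. cutoff (real k + 2) (Rop \<mu>)) z"
    unfolding op_is_pole_def using P(3) by blast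
  then show "z \<in> resonances ak"
    unfolding resonances_def using z Rop_resolvent_continuation by blast
next
  fix z assume "z \<in> resonances ak"
  then obtain R N where z: "Im z < 0" and R: "resolvent_continuation ak R"
    and pole: "op_is_pole (\<lambda>\<mu>. cutoff N (R \<mu>)) z"
    by (auto simp: resonances_def)
  show "z \<in> {\<mu>. Im \<mu> < 0 \<and> cA \<mu> = 0}"
  proof (rule ccontr)
    assume "z \<notin> {\<mu>. Im \<mu> < 0 \<and> cA \<mu> = 0}"
    then have A: "z * cA z \<noteq> 0" using z by auto
    obtain J c B where P: "J = 0 \<longleftrightarrow> z * cA z \<noteq> 0" "op_polar_part (\<lambda>\<mu>. cutoff N (Rop \<mu>)) z J B"
      by (rule Rop_polar_part)
    have P0: "op_polar_part (\<lambda>\<mu>. cutoff N (Rop \<mu>)) z 0 B" using P A by simp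
    have "\<not> op_is_pole (\<lambda>\<mu>. cutoff N (R \<mu>)) z"
    proof (rule no_pole_transfer[OF _ _ _ P0])
      show "op_meromorphic_at (\<lambda>\<mu>. cutoff N (R \<mu>)) w" "op_meromorphic_at (\<lambda>\<mu>. cutoff N (Rop \<mu>)) w" for w
        using R Rop_resolvent_continuation by (auto simp: resolvent_continuation_def)
      fix \<mu> f assume \<mu>: "Im \<mu> > 0" and f: "f \<in> L2"
      \<comment> \<open>The cut-off function has compact support, so both continuations agree on it
        with the resolvent.\<close>
      let ?f = "\<lambda>y. indicator {-N..N} y * f y"
      have "?f \<in> L2" by (rule L2_mult_bounded[OF f, where C = 1]) (auto simp: indicator_def)
      then have fc: "?f \<in> L2_comp"
        unfolding L2_comp_def by (auto intro!: exI[of _ N] AE_I2 simp: indicator_def)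
      have "AE x in lborel. R \<mu> ?f x = resolvent ak \<mu> ?f x"
        using R \<mu> fc by (auto simp: resolvent_continuation_def)
      then show "AE x in lborel. cutoff N (R \<mu>) f x = cutoff N (Rop \<mu>) f x"
        using Rop_eq_resolvent[OF \<mu> fc] by eventually_elim (simp add: cutoff_def)
    qed
    then show False using pole by simp
  qed
qed

text \<open>At a zero of A the numerator B is nonzero. Since A does not vanish at \<i>, its zeros
  are isolated, so A tends to 0 through nonzero values and the quotient tends to infinity.\<close>

lemma is_pole_reflection_iff: "is_pole (\<lambda>\<mu>. cB \<mu> / cA \<mu>) z \<longleftrightarrow> cA z = 0"
proof
  assume p: "is_pole (\<lambda>\<mu>. cB \<mu> / cA \<mu>) z"
  show "cA z = 0"
  proof (rule ccontr)
    assume nz: "cA z \<noteq> 0"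
    have "continuous_on UNIV cA" by (rule holomorphic_on_imp_continuous_on[OF cA_holomorphic])
    then have o: "open {w. cA w \<noteq> 0}" by (intro open_Collect_neq) auto
    have "(\<lambda>\<mu>. cB \<mu> / cA \<mu>) holomorphic_on {w. cA w \<noteq> 0}"
      by (intro holomorphic_intros holomorphic_on_subset[OF cA_holomorphic] holomorphic_on_subset[OF cB_holomorphic]) auto
    then show False using not_is_pole_holomorphic[OF o] nz p by blast
  qed
next
  assume A: "cA z = 0"
  have c: "isCont cA z" "isCont cB z"
    using holomorphic_on_imp_continuous_on[OF cA_holomorphic] holomorphic_on_imp_continuous_on[OF cB_holomorphic]
    by (auto simp: continuous_on_eq_continuous_at)
  have "cA \<i> \<noteq> 0" by (rule cA_nonzero) simp
  then obtain r where r: "0 < r" "ball z r \<subseteq> UNIV" "\<And>w. w \<in> ball z r - {z} \<Longrightarrow> cA w \<noteq> 0"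
  proof (rule isolated_zeros[OF cA_holomorphic open_UNIV connected_UNIV UNIV_I A UNIV_I])
    fix r assume "0 < r" "ball z r \<subseteq> UNIV" "\<And>w. w \<in> ball z r - {z} \<Longrightarrow> cA w \<noteq> 0"
    then show thesis by (rule that)
  qed
  have "\<forall>\<^sub>F w in at z. w \<in> ball z r - {z}" using r by (intro eventually_at_in_open) auto
  then have "\<forall>\<^sub>F w in at z. cA w \<noteq> 0" by eventually_elim (rule r(3))
  moreover have "(cA \<longlongrightarrow> 0) (at z)" using c(1) A by (simp add: isCont_def)
  ultimately have "filterlim cA (at 0) (at z)" by (auto simp: filterlim_at elim: eventually_mono)
  then show "is_pole (\<lambda>\<mu>. cB \<mu> / cA \<mu>) z"
    using c(2) cA_cB_nonzero[of z] A by (intro is_pole_divide) auto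
qed

lemma reflection_meromorphic: "(\<lambda>\<mu>. cB \<mu> / cA \<mu>) meromorphic_on A"
proof -
  have "(\<lambda>\<mu>. cB \<mu> / cA \<mu>) meromorphic_on UNIV"
    using cA_holomorphic cB_holomorphic
    by (intro meromorphic_on_divide analytic_on_imp_meromorphic_on) (simp_all add: analytic_on_open)
  then show ?thesis by (rule meromorphic_on_subset) simp
qed

end

theorem proposition1:
  fixes b1 b2 x2 :: real and k :: nat
  assumes "b1 > 0" and "b2 > 0" and "0 < x2" and "x2 < 1" and "k \<ge> 1"
  shows "\<exists>r. r meromorphic_on (UNIV - {0}) \<and>
             (\<forall>\<mu>. Im \<mu> \<ge> 0 \<and> \<mu> \<noteq> 0 \<longrightarrow> r \<mu> = reflection_coeff b1 b2 x2 k \<mu>) \<and>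
             {\<mu>. Im \<mu> < 0 \<and> is_pole r \<mu>} = resonances (coeff_trunc b1 b2 x2 k)"
proof -
  interpret layers b1 b2 x2 k using assms by unfold_locales
  show ?thesis
    by (intro exI[of _ "\<lambda>\<mu>. cB \<mu> / cA \<mu>"])
       (auto simp: reflection_coeff_eq resonances_eq is_pole_reflection_iff intro: reflection_meromorphic)
qed

end
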